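(* Let $\mathcal C$ be a central arrangement of hyperplanes in the vector space $X=\mathbb C^N$ with graph $\Gamma$, and let $\mathcal V\in Qui_\Gamma$ be a quiver. Then the Fourier transform of the quiver $\mathcal D_X$-module $E\mathcal V$ is isomorphic to the quiver $\mathcal D_{X^*}$-module $\tilde E\tilde{\mathcal V}$.
   Context: **Arrangement, graph.** $\mathcal C=\{H_j\}_{j\in J}$ is a finite set of hyperplanes in $X=\mathbb C^N$ all containing $0$. The intersections of subfamilies (including $X$) are denoted $\overline X_\alpha$, $\alpha\in I$; $X_\alpha$ is $\overline X_\alpha$ minus all smaller $\overline X_\beta$; $l(\alpha)=\operatorname{codim}_X\overline X_\alpha$. Write $\alpha\succ\beta$ if $\overline X_\alpha\supset\overline X_\beta$ with $\operatorname{codim}_{\overline X_\alpha}\overline X_\beta=1$; adjacent means $\alpha\succ\beta$ or $\beta\succ\alpha$. $\varepsilon(\alpha,\beta)=1$ if $\alpha\succ\beta$, $-1$ if $\beta\succ\alpha$, $0$ otherwise. **Quivers.** A quiver $\mathcal V=\{V_\alpha,A_{\alpha,\beta}\}\in Qui_\Gamma$ consists of finite-dimensional complex vector spaces $V_\alpha$ ($\alpha\in I$) and linear maps $A_{\alpha,\beta}:V_\beta\to V_\alpha$ such that (a) $A_{\alpha,\beta}=0$ if $\alpha,\beta$ are not adjacent; (b) $\sum_\beta A_{\alpha,\beta}A_{\beta,\gamma}=0$ if $|l(\alpha)-l(\gamma)|=2$; (c) $\sum_\beta A_{\alpha,\beta}A_{\beta,\gamma}=0$ if $l(\alpha)=l(\gamma)$,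 $\alpha\ne\gamma$, and there is $\delta$ with $\alpha\succ\delta,\gamma\succ\delta$. $\tilde{\mathcal V}=\{W_\alpha,B_{\alpha,\beta}\}$ is given by $W_\alpha=V_\alpha$, $B_{\alpha,\beta}=\varepsilon(\beta,\alpha)A_{\alpha,\beta}$. **$E\mathcal V$.** $F_\alpha$ = affine functions vanishing on $X_\alpha$; $T_\alpha$ = constant vector fields parallel to $X_\alpha$; $\langle\xi,f\rangle=\xi(f)$; $\overline\Omega_\alpha$ = one-dimensional space of translation-invariant top forms on $\overline X_\alpha$. Choose for each $\alpha\succ\beta$ elements $f_{\beta,\alpha}\in F_\beta\setminus F_\alpha$, $\xi_{\alpha,\beta}\in T_\alpha\setminus T_\beta$, and define $\pi_{\beta,\alpha}:\overline\Omega_\alpha\to\overline\Omega_\beta$: if $\alpha\succ\beta$, $\pi_{\beta,\alpha}(\overline\omega_\alpha)=\overline\omega_\beta$ iff $df_{\beta,\alpha}\wedge\overline\omega_\beta=\overline\omega_\alpha$; if $\beta\succ\alpha$, iff $i_{\xi_{\beta,\alpha}}\overline\omega_\beta=\overline\omega_\alpha$. $E\mathcal V$ is the quotient of the free left module $\mathcal D_X\otimes\bigoplus_\alpha\overline\Omega_\alpha\otimes V_\alpha$ by the submodule generated by $\xi\otimes\overline\omega_\alpha\otimes v_\alpha-\sum_{\beta:\alpha\succ\beta}\langle\xi,f_{\beta,\alpha}\rangle 1\otimes\pi_{\beta,\alpha}(\overline\omega_\alpha)\otimes A_{\beta,\alpha}(v_\alpha)$ ($\xi\in T_\alpha$) and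 $f\otimes\overline\omega_\alpha\otimes v_\alpha-\sum_{\beta:\beta\succ\alpha}\langle\xi_{\beta,\alpha},f\rangle 1\otimes\pi_{\beta,\alpha}(\overline\omega_\alpha)\otimes A_{\beta,\alpha}(v_\alpha)$ ($f\in F_\alpha$). **$\tilde E\mathcal V$.** On the dual space $X^*$ set $\overline X_\alpha^*=\overline X_\alpha^\perp$, $\alpha\in I$ (the closed strata of the line arrangement $\{H_j^\perp\}$). Write $\alpha\succ^*\beta$ if $\overline X^*_\alpha\supset\overline X^*_\beta$ in codimension one, equivalently $\beta\succ\alpha$. Let $F^*_\alpha,T^*_\alpha,\overline\Omega^*_\alpha$ be the spaces of linear functions on $X^*$ vanishing on $\overline X^*_\alpha$, constant vector fields parallel to $\overline X_\alpha^*$, and translation-invariant top forms on $\overline X_\alpha^*$; choose for $\alpha\succ^*\beta$ elements $f^*_{\beta,\alpha}\in F^*_\beta\setminus F^*_\alpha$, $\xi^*_{\alpha,\beta}\in T^*_\alpha\setminus T^*_\beta$ and define $\pi^*_{\beta,\alpha}:\overline\Omega^*_\alpha\to\overline\Omega^*_\beta$ by the same rules as $\pi_{\beta,\alpha}$ with $\succ$ replaced by $\succ^*$. For a quiver $\mathcal V\in Qui_\Gamma$, $\tilde E\mathcal V$ is the quotient of the free left module $\mathcal D_{X^*}\otimes\bigoplus_\alpha\overline\Omega^*_\alpha\otimes V_\alpha$ by the submodule generated by $\xi\otimes\overline\omega_\alpha\otimes v_\alpha-\sum_{\beta:\alpha\succ^*\beta}\langle\xi,f^*_{\beta,\alpha}\rangle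 1\otimes\pi^*_{\beta,\alpha}(\overline\omega_\alpha)\otimes A_{\beta,\alpha}(v_\alpha)$ ($\xi\in T^*_\alpha$) and $f\otimes\overline\omega_\alpha\otimes v_\alpha-\sum_{\beta:\beta\succ^*\alpha}\langle\xi^*_{\beta,\alpha},f\rangle 1\otimes\pi^*_{\beta,\alpha}(\overline\omega_\alpha)\otimes A_{\beta,\alpha}(v_\alpha)$ ($f\in F^*_\alpha$). Neither $E\mathcal V$ nor $\tilde E\mathcal V$ depends on the choices. **Fourier transform.** Let $z_1,\dots,z_N$ be linear coordinates on $X$ and $\xi_1,\dots,\xi_N$ the dual coordinates on $X^*$. The ring isomorphism $D_{X^*}\to D_X$, $\xi_i\mapsto-\partial/\partial z_i$, $\partial/\partial\xi_i\mapsto z_i$, turns the global sections of a $\mathcal D_X$-module into a $D_{X^*}$-module; the corresponding $\mathcal D_{X^*}$-module is the Fourier transform. *)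

theory Defs
  imports
    "HOL-Analysis.Analysis"
    "HOL-Library.Poly_Mapping"
    "HOL-Algebra.Coset"
begin

section \<open>Algebraic differential operators on affine space\<close>

text \<open>Modules over the sheaf of differential operators on an affine space are represented by their
  global sections, as modules over the ring of global differential operators.\<close>

text \<open>The regular functions on affine space with coordinates indexed by \<open>'n\<close>: polynomials, as
  finitely supported maps from exponents to coefficients.\<close>

type_synonym 'n cpoly = "('n \<Rightarrow>\<^sub>0 nat) \<Rightarrow>\<^sub>0 complex"

definition poly_const :: "complex \<Rightarrow> 'n cpoly" where
  "poly_const c = Poly_Mapping.single 0 c"

definition poly_coord :: "'n \<Rightarrow> 'n cpoly" where
  "poly_coord i = Poly_Mapping.single (Poly_Mapping.single i 1) 1"

text \<open>Formal partial derivative. If \<open>lookup m i = 0\<close> the (truncated) exponent is irrelevant, as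
  the coefficient vanishes.\<close>

definition poly_partial :: "'n \<Rightarrow> 'n cpoly \<Rightarrow> 'n cpoly" where
  "poly_partial i p = (\<Sum>m\<in>Poly_Mapping.keys p. Poly_Mapping.single (m - Poly_Mapping.single i 1)
                         (of_nat (Poly_Mapping.lookup m i) * Poly_Mapping.lookup p m))"

text \<open>The ring of differential operators: the ring of endomaps of the polynomial ring generated by
  multiplications by functions and by the coordinate derivations.\<close>

inductive_set diff_operators :: "('n cpoly \<Rightarrow> 'n cpoly) set" where
  mult_fun: "(\<lambda>p. g * p) \<in> diff_operators"
| deriv_coord: "poly_partial i \<in> diff_operators"
| add: "P \<in> diff_operators \<Longrightarrow> Q \<in> diff_operators \<Longrightarrow> (\<lambda>p. P p + Q p) \<in> diff_operators"
| comp: "P \<in> diff_operators \<Longrightarrow> Q \<in> diff_operators \<Longrightarrow> (\<lambda>p. P (Q p)) \<in> diff_operators"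

typedef 'n diffop = "diff_operators :: ('n cpoly \<Rightarrow> 'n cpoly) set"
  by (blast intro: diff_operators.deriv_coord)

setup_lifting type_definition_diffop

lemma poly_partial_altdef:
  assumes "finite S" "Poly_Mapping.keys p \<subseteq> S"
  shows "poly_partial i p = (\<Sum>m\<in>S. Poly_Mapping.single (m - Poly_Mapping.single i 1)
           (of_nat (Poly_Mapping.lookup m i) * Poly_Mapping.lookup p m))"
  unfolding poly_partial_def
  by (rule sum.mono_neutral_left) (use assms in \<open>auto simp: in_keys_iff\<close>)

lemma poly_partial_add: "poly_partial i (p + q) = poly_partial i p + poly_partial i q"
proof -
  let ?S = "Poly_Mapping.keys p \<union> Poly_Mapping.keys q"
  have "Poly_Mapping.keys (p + q) \<subseteq> ?S" by (rule Poly_Mapping.keys_add)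
  then show ?thesis
    by (simp add: poly_partial_altdef[of ?S] lookup_add single_add distrib_left sum.distrib)
qed

lemma diff_operators_add: "P \<in> diff_operators \<Longrightarrow> P (p + q) = P p + P q"
  by (induction arbitrary: p q rule: diff_operators.induct)
     (auto simp: poly_partial_add algebra_simps)

lemma diff_operators_zero: "P \<in> diff_operators \<Longrightarrow> P 0 = 0"
  using diff_operators_add[of P 0 0] by simp

instantiation diffop :: (type) ring_1
begin

lift_definition zero_diffop :: "'a diffop" is "\<lambda>p. 0"
  using diff_operators.mult_fun[of 0] by (metis (no_types, lifting) ext mult_zero_left)

lift_definition one_diffop :: "'a diffop" is "\<lambda>p. p"
  using diff_operators.mult_fun[of 1] by (metis (no_types, lifting) ext mult_1)

lift_definition plus_diffop :: "'a diffop \<Rightarrow> 'a diffop \<Rightarrow> 'a diffop" is "\<lambda>P Q p. P p + Q p"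
  by (rule diff_operators.add)

lift_definition times_diffop :: "'a diffop \<Rightarrow> 'a diffop \<Rightarrow> 'a diffop" is "\<lambda>P Q p. P (Q p)"
  by (rule diff_operators.comp)

lift_definition uminus_diffop :: "'a diffop \<Rightarrow> 'a diffop" is "\<lambda>P p. - P p"
  using diff_operators.comp[OF diff_operators.mult_fun[of "- 1"]] by simp

definition minus_diffop :: "'a diffop \<Rightarrow> 'a diffop \<Rightarrow> 'a diffop" where
  "minus_diffop P Q = P + (- Q)"

instance
proof
  show "(0 :: 'a diffop) \<noteq> 1"
  proof
    assume "(0 :: 'a diffop) = 1"
    then have "(\<lambda>p :: 'a cpoly. 0) = (\<lambda>p. p)" by transfer
    then show False by (metis one_neq_zero)
  qed
qed (auto simp: minus_diffop_def Rep_diffop_inject[symmetric] zero_diffop.rep_eq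
      one_diffop.rep_eq plus_diffop.rep_eq times_diffop.rep_eq uminus_diffop.rep_eq
      diff_operators_add[OF Rep_diffop] algebra_simps)

end

definition op_function :: "'n cpoly \<Rightarrow> 'n diffop" where
  "op_function g = Abs_diffop (\<lambda>p. g * p)"

definition op_partial :: "'n \<Rightarrow> 'n diffop" where
  "op_partial i = Abs_diffop (poly_partial i)"

definition op_const :: "complex \<Rightarrow> 'n diffop" where
  "op_const c = op_function (poly_const c)"

definition op_coord :: "'n \<Rightarrow> 'n diffop" where
  "op_coord i = op_function (poly_coord i)"

text \<open>Affine functions on \<open>complex ^ 'n\<close> and constant vector fields (given by their value) as
  differential operators, and the action of the latter on the former.\<close>

definition affine_functions :: "((complex ^ 'n) \<Rightarrow> complex) set" where
  "affine_functions = {f. \<exists>c a. f = (\<lambda>x. c + (\<Sum>i\<in>UNIV. a $ i * x $ i))}"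

definition linear_functions :: "((complex ^ 'n) \<Rightarrow> complex) set" where
  "linear_functions = {f. \<exists>a. f = (\<lambda>x. \<Sum>i\<in>UNIV. a $ i * x $ i)}"

definition pairing :: "complex ^ 'n \<Rightarrow> (complex ^ 'n \<Rightarrow> complex) \<Rightarrow> complex" where
  "pairing \<xi> f = f \<xi> - f 0"

definition op_affine :: "(complex ^ 'n \<Rightarrow> complex) \<Rightarrow> ('n :: finite) diffop" where
  "op_affine f = op_const (f 0) + (\<Sum>i\<in>UNIV. op_const (pairing (axis i 1) f) * op_coord i)"

definition op_field :: "complex ^ 'n \<Rightarrow> ('n :: finite) diffop" where
  "op_field \<xi> = (\<Sum>i\<in>UNIV. op_const (\<xi> $ i) * op_partial i)"


section \<open>Left modules\<close>

text \<open>A left module is an abelian group (a \<open>monoid\<close> record, whose \<open>mult\<close> is the addition) with an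
  action of the elements of a type of scalars.\<close>

record ('r, 'm) lmodule = "'m monoid" +
  act :: "'r \<Rightarrow> 'm \<Rightarrow> 'm"

definition free_lmodule :: "'s set \<Rightarrow> ('r :: ring_1, 's \<Rightarrow>\<^sub>0 'r) lmodule" where
  "free_lmodule S = \<lparr> carrier = {p. Poly_Mapping.keys p \<subseteq> S}, mult = (+), one = 0,
                      act = (\<lambda>r. Poly_Mapping.map ((*) r)) \<rparr>"

inductive_set generated_submodule :: "('r, 'm, 'x) lmodule_scheme \<Rightarrow> 'm set \<Rightarrow> 'm set"
  for M :: "('r, 'm, 'x) lmodule_scheme" and G :: "'m set" where
  zero: "\<one>\<^bsub>M\<^esub> \<in> generated_submodule M G"
| gen: "x \<in> G \<Longrightarrow> x \<in> generated_submodule M G"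
| add: "x \<in> generated_submodule M G \<Longrightarrow> y \<in> generated_submodule M G \<Longrightarrow>
        x \<otimes>\<^bsub>M\<^esub> y \<in> generated_submodule M G"
| act: "x \<in> generated_submodule M G \<Longrightarrow> act M r x \<in> generated_submodule M G"

definition quotient_lmodule :: "('r, 'm) lmodule \<Rightarrow> 'm set \<Rightarrow> ('r, 'm set) lmodule" where
  "quotient_lmodule M R = monoid.extend (M Mod R)
     (lmodule.fields (\<lambda>r U. \<Union>x\<in>U. R #>\<^bsub>M\<^esub> act M r x))"

definition isomorphic_lmodules ::
    "('r, 'm) lmodule \<Rightarrow> ('r, 'k) lmodule \<Rightarrow> bool" (infix \<open>\<cong>\<^sub>l\<close> 50) where
  "M \<cong>\<^sub>l N \<longleftrightarrow> (\<exists>h\<in>iso M N. \<forall>r. \<forall>x\<in>carrier M. h (act M r x) = act N r (h x))"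


section \<open>Fourier transform\<close>

text \<open>The dual space of \<open>complex ^ 'n\<close> is \<open>complex ^ 'n\<close> with the dual coordinates, so both rings
  of differential operators are \<open>'n diffop\<close>. The Fourier isomorphism is the isomorphism of
  \<open>complex\<close>-algebras, from operators on the dual space to operators on the space, with the given
  values on the generators.\<close>

definition is_fourier_iso :: "('n diffop \<Rightarrow> 'n diffop) \<Rightarrow> bool" where
  "is_fourier_iso \<phi> \<longleftrightarrow>
     bij \<phi> \<and>
     (\<forall>P Q. \<phi> (P + Q) = \<phi> P + \<phi> Q) \<and>
     (\<forall>P Q. \<phi> (P * Q) = \<phi> P * \<phi> Q) \<and>
     (\<forall>c. \<phi> (op_const c) = op_const c) \<and>
     (\<forall>i. \<phi> (op_coord i) = - op_partial i) \<and>
     (\<forall>i. \<phi> (op_partial i) = op_coord i)"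

definition fourier_iso :: "'n diffop \<Rightarrow> 'n diffop" where
  "fourier_iso = (THE \<phi>. is_fourier_iso \<phi>)"

definition fourier_transform :: "('n diffop, 'm) lmodule \<Rightarrow> ('n diffop, 'm) lmodule" where
  "fourier_transform M = M \<lparr> act := (\<lambda>P. act M (fourier_iso P)) \<rparr>"


section \<open>Translation-invariant forms on a linear subspace\<close>

text \<open>A translation-invariant \<open>k\<close>-form on a linear subspace \<open>S\<close> is an alternating multilinear
  function of \<open>k\<close> vectors of \<open>S\<close>, here given as a list; it is extended by \<open>0\<close> to all other
  lists.\<close>

definition inv_forms :: "(complex ^ 'n) set \<Rightarrow> nat \<Rightarrow> ((complex ^ 'n) list \<Rightarrow> complex) set" where
  "inv_forms S k = {\<omega>.
     (\<forall>xs. \<not> (length xs = k \<and> set xs \<subseteq> S) \<longrightarrow> \<omega> xs = 0) \<and>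
     (\<forall>xs i x y c. length xs = k \<and> set xs \<subseteq> S \<and> i < k \<and> x \<in> S \<and> y \<in> S \<longrightarrow>
        \<omega> (xs[i := c *s x + y]) = c * \<omega> (xs[i := x]) + \<omega> (xs[i := y])) \<and>
     (\<forall>xs. \<not> distinct xs \<longrightarrow> \<omega> xs = 0)}"

definition top_forms :: "(complex ^ 'n :: finite) set \<Rightarrow> ((complex ^ 'n) list \<Rightarrow> complex) set" where
  "top_forms S = inv_forms S (vec.dim S)"

definition restrict_form :: "(complex ^ 'n) set \<Rightarrow> ((complex ^ 'n) list \<Rightarrow> complex) \<Rightarrow>
    (complex ^ 'n) list \<Rightarrow> complex" where
  "restrict_form S \<omega> xs = (if set xs \<subseteq> S then \<omega> xs else 0)"

text \<open>\<open>df \<and> \<eta>\<close> on \<open>S\<close>, for an affine function \<open>f\<close> and a form \<open>\<eta>\<close> on \<open>S\<close>\<close>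

definition wedge_form :: "(complex ^ 'n) set \<Rightarrow> (complex ^ 'n \<Rightarrow> complex) \<Rightarrow>
    ((complex ^ 'n) list \<Rightarrow> complex) \<Rightarrow> (complex ^ 'n) list \<Rightarrow> complex" where
  "wedge_form S f \<eta> = restrict_form S
     (\<lambda>xs. \<Sum>i<length xs. (-1) ^ i * pairing (xs ! i) f * \<eta> (take i xs @ drop (Suc i) xs))"

definition contract_form :: "complex ^ 'n \<Rightarrow> ((complex ^ 'n) list \<Rightarrow> complex) \<Rightarrow>
    (complex ^ 'n) list \<Rightarrow> complex" where
  "contract_form \<xi> \<omega> xs = \<omega> (\<xi> # xs)"


section \<open>The quotient of the free module attached to strata and linear maps\<close>

text \<open>This section is common to an arrangement and to its dual: \<open>S \<alpha>\<close> is the closed stratum (a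
  linear subspace) with index \<open>\<alpha>\<close>, and \<open>F \<alpha>\<close> the space of functions vanishing on the stratum.\<close>

definition covers :: "('i \<Rightarrow> (complex ^ 'n :: finite) set) \<Rightarrow> 'i \<Rightarrow> 'i \<Rightarrow> bool" where
  "covers S \<alpha> \<beta> \<longleftrightarrow> S \<beta> \<subseteq> S \<alpha> \<and> vec.dim (S \<alpha>) = vec.dim (S \<beta>) + 1"

definition parallel_fields :: "(complex ^ 'n) set \<Rightarrow> (complex ^ 'n) set" where
  "parallel_fields S = {\<xi>. \<forall>x\<in>S. \<forall>t. x + t *s \<xi> \<in> S}"

definition admissible_choice :: "'i set \<Rightarrow> ('i \<Rightarrow> (complex ^ 'n :: finite) set) \<Rightarrow>
    ('i \<Rightarrow> (complex ^ 'n \<Rightarrow> complex) set) \<Rightarrow>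
    ('i \<Rightarrow> 'i \<Rightarrow> complex ^ 'n \<Rightarrow> complex) \<Rightarrow> ('i \<Rightarrow> 'i \<Rightarrow> complex ^ 'n) \<Rightarrow> bool" where
  "admissible_choice I S F f \<xi> \<longleftrightarrow>
     (\<forall>\<alpha>\<in>I. \<forall>\<beta>\<in>I. covers S \<alpha> \<beta> \<longrightarrow>
        f \<beta> \<alpha> \<in> F \<beta> - F \<alpha> \<and> \<xi> \<alpha> \<beta> \<in> parallel_fields (S \<alpha>) - parallel_fields (S \<beta>))"

text \<open>\<open>transition S f \<xi> \<beta> \<alpha>\<close> is the map \<open>\<pi>\<^sub>\<beta>\<^sub>\<alpha>\<close> from top forms on \<open>S \<alpha>\<close> to top forms on
  \<open>S \<beta>\<close>. In the first case the form \<open>\<omega>'\<close> on the hyperplane \<open>S \<beta>\<close> of \<open>S \<alpha>\<close> has to be extended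
  to a form \<open>\<eta>\<close> on \<open>S \<alpha>\<close> before wedging it with \<open>df\<close>; the product does not depend on the
  extension since \<open>f\<close> vanishes on \<open>S \<beta>\<close>. In the second case the contraction of a form on \<open>S \<beta>\<close>
  is restricted to \<open>S \<alpha>\<close>.\<close>

definition transition :: "('i \<Rightarrow> (complex ^ 'n :: finite) set) \<Rightarrow>
    ('i \<Rightarrow> 'i \<Rightarrow> complex ^ 'n \<Rightarrow> complex) \<Rightarrow> ('i \<Rightarrow> 'i \<Rightarrow> complex ^ 'n) \<Rightarrow> 'i \<Rightarrow> 'i \<Rightarrow>
    ((complex ^ 'n) list \<Rightarrow> complex) \<Rightarrow> ((complex ^ 'n) list \<Rightarrow> complex)" where
  "transition S f \<xi> \<beta> \<alpha> \<omega> =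
     (if covers S \<alpha> \<beta> then
        (THE \<omega>'. \<omega>' \<in> top_forms (S \<beta>) \<and>
           (\<exists>\<eta>\<in>inv_forms (S \<alpha>) (vec.dim (S \<beta>)).
              restrict_form (S \<beta>) \<eta> = \<omega>' \<and> wedge_form (S \<alpha>) (f \<beta> \<alpha>) \<eta> = \<omega>))
      else if covers S \<beta> \<alpha> then
        (THE \<omega>'. \<omega>' \<in> top_forms (S \<beta>) \<and>
           restrict_form (S \<alpha>) (contract_form (\<xi> \<beta> \<alpha>) \<omega>') = \<omega>)
      else (\<lambda>xs. 0))"

type_synonym ('i, 'n, 'v) symbol = "'i \<times> ((complex ^ 'n) list \<Rightarrow> complex) \<times> 'v"

text \<open>The symbol \<open>(\<alpha>, \<omega>, v)\<close> stands for the tensor \<open>1 \<otimes> \<omega> \<otimes> v\<close>, so \<open>tens P \<alpha> \<omega> v\<close> is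
  \<open>P \<otimes> \<omega> \<otimes> v\<close>.\<close>

definition symbols :: "'i set \<Rightarrow> ('i \<Rightarrow> (complex ^ 'n :: finite) set) \<Rightarrow> ('i \<Rightarrow> 'v set) \<Rightarrow>
    ('i, 'n, 'v) symbol set" where
  "symbols I S V = {(\<alpha>, \<omega>, v). \<alpha> \<in> I \<and> \<omega> \<in> top_forms (S \<alpha>) \<and> v \<in> V \<alpha>}"

abbreviation tens :: "'n diffop \<Rightarrow> 'i \<Rightarrow> ((complex ^ 'n) list \<Rightarrow> complex) \<Rightarrow> 'v \<Rightarrow>
    ('i, 'n, 'v) symbol \<Rightarrow>\<^sub>0 'n diffop" where
  "tens P \<alpha> \<omega> v \<equiv> Poly_Mapping.single (\<alpha>, \<omega>, v) P"

text \<open>The free module on the symbols modulo these relations is the tensor product of the ring of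
  differential operators with \<open>\<Oplus>\<^sub>\<alpha> \<Omega>\<^sub>\<alpha> \<otimes> V\<^sub>\<alpha>\<close> (over the complex numbers).\<close>

definition tensor_relations :: "'i set \<Rightarrow> ('i \<Rightarrow> (complex ^ 'n :: finite) set) \<Rightarrow>
    (complex \<Rightarrow> 'v \<Rightarrow> 'v) \<Rightarrow> ('i \<Rightarrow> 'v :: ab_group_add set) \<Rightarrow>
    (('i, 'n, 'v) symbol \<Rightarrow>\<^sub>0 'n diffop) set" where
  "tensor_relations I S smul V =
     {tens 1 \<alpha> (\<lambda>xs. \<omega> xs + \<omega>' xs) v - tens 1 \<alpha> \<omega> v - tens 1 \<alpha> \<omega>' v |\<alpha> \<omega> \<omega>' v.
        \<alpha> \<in> I \<and> \<omega> \<in> top_forms (S \<alpha>) \<and> \<omega>' \<in> top_forms (S \<alpha>) \<and> v \<in> V \<alpha>} \<union>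
     {tens 1 \<alpha> \<omega> (v + v') - tens 1 \<alpha> \<omega> v - tens 1 \<alpha> \<omega> v' |\<alpha> \<omega> v v'.
        \<alpha> \<in> I \<and> \<omega> \<in> top_forms (S \<alpha>) \<and> v \<in> V \<alpha> \<and> v' \<in> V \<alpha>} \<union>
     {tens 1 \<alpha> (\<lambda>xs. c * \<omega> xs) v - tens (op_const c) \<alpha> \<omega> v |\<alpha> \<omega> v c.
        \<alpha> \<in> I \<and> \<omega> \<in> top_forms (S \<alpha>) \<and> v \<in> V \<alpha>} \<union>
     {tens 1 \<alpha> \<omega> (smul c v) - tens (op_const c) \<alpha> \<omega> v |\<alpha> \<omega> v c.
        \<alpha> \<in> I \<and> \<omega> \<in> top_forms (S \<alpha>) \<and> v \<in> V \<alpha>}"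

definition field_relations :: "'i set \<Rightarrow> ('i \<Rightarrow> (complex ^ 'n :: finite) set) \<Rightarrow>
    ('i \<Rightarrow> 'i \<Rightarrow> complex ^ 'n \<Rightarrow> complex) \<Rightarrow> ('i \<Rightarrow> 'i \<Rightarrow> complex ^ 'n) \<Rightarrow>
    ('i \<Rightarrow> 'v set) \<Rightarrow> ('i \<Rightarrow> 'i \<Rightarrow> 'v \<Rightarrow> 'v) \<Rightarrow> (('i, 'n, 'v) symbol \<Rightarrow>\<^sub>0 'n diffop) set" where
  "field_relations I S f \<xi> V A =
     {tens (op_field \<zeta>) \<alpha> \<omega> v -
        (\<Sum>\<beta>\<in>{\<beta>\<in>I. covers S \<alpha> \<beta>}.
           tens (op_const (pairing \<zeta> (f \<beta> \<alpha>))) \<beta> (transition S f \<xi> \<beta> \<alpha> \<omega>) (A \<beta> \<alpha> v)) |\<zeta> \<alpha> \<omega> v.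
        \<alpha> \<in> I \<and> \<zeta> \<in> parallel_fields (S \<alpha>) \<and> \<omega> \<in> top_forms (S \<alpha>) \<and> v \<in> V \<alpha>}"

definition function_relations :: "'i set \<Rightarrow> ('i \<Rightarrow> (complex ^ 'n :: finite) set) \<Rightarrow>
    ('i \<Rightarrow> (complex ^ 'n \<Rightarrow> complex) set) \<Rightarrow>
    ('i \<Rightarrow> 'i \<Rightarrow> complex ^ 'n \<Rightarrow> complex) \<Rightarrow> ('i \<Rightarrow> 'i \<Rightarrow> complex ^ 'n) \<Rightarrow>
    ('i \<Rightarrow> 'v set) \<Rightarrow> ('i \<Rightarrow> 'i \<Rightarrow> 'v \<Rightarrow> 'v) \<Rightarrow> (('i, 'n, 'v) symbol \<Rightarrow>\<^sub>0 'n diffop) set" where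
  "function_relations I S F f \<xi> V A =
     {tens (op_affine g) \<alpha> \<omega> v -
        (\<Sum>\<beta>\<in>{\<beta>\<in>I. covers S \<beta> \<alpha>}.
           tens (op_const (pairing (\<xi> \<beta> \<alpha>) g)) \<beta> (transition S f \<xi> \<beta> \<alpha> \<omega>) (A \<beta> \<alpha> v)) |g \<alpha> \<omega> v.
        \<alpha> \<in> I \<and> g \<in> F \<alpha> \<and> \<omega> \<in> top_forms (S \<alpha>) \<and> v \<in> V \<alpha>}"

text \<open>Dividing by the tensor relations and by the defining relations is done in one step.\<close>

definition strata_module :: "'i set \<Rightarrow> ('i \<Rightarrow> (complex ^ 'n :: finite) set) \<Rightarrow>
    ('i \<Rightarrow> (complex ^ 'n \<Rightarrow> complex) set) \<Rightarrow>
    ('i \<Rightarrow> 'i \<Rightarrow> complex ^ 'n \<Rightarrow> complex) \<Rightarrow> ('i \<Rightarrow> 'i \<Rightarrow> complex ^ 'n) \<Rightarrow>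
    (complex \<Rightarrow> 'v \<Rightarrow> 'v) \<Rightarrow> ('i \<Rightarrow> 'v :: ab_group_add set) \<Rightarrow> ('i \<Rightarrow> 'i \<Rightarrow> 'v \<Rightarrow> 'v) \<Rightarrow>
    ('n diffop, (('i, 'n, 'v) symbol \<Rightarrow>\<^sub>0 'n diffop) set) lmodule" where
  "strata_module I S F f \<xi> smul V A =
     (let M = free_lmodule (symbols I S V) in
        quotient_lmodule M (generated_submodule M
          (tensor_relations I S smul V \<union> field_relations I S f \<xi> V A \<union>
           function_relations I S F f \<xi> V A)))"


section \<open>Central arrangements, quivers and their modules\<close>

definition hyperplane :: "(complex ^ 'n :: finite) set \<Rightarrow> bool" where
  "hyperplane H \<longleftrightarrow> (\<exists>a c. a \<noteq> 0 \<and> H = {x. (\<Sum>i\<in>UNIV. a $ i * x $ i) = c})"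

definition central_arrangement :: "(complex ^ 'n :: finite) set set \<Rightarrow> bool" where
  "central_arrangement C \<longleftrightarrow> finite C \<and> (\<forall>H\<in>C. hyperplane H \<and> 0 \<in> H)"

text \<open>The vertices of the graph of an arrangement are the closed strata themselves, so that they
  are their own indices. The empty intersection is the whole space.\<close>

definition closed_strata :: "(complex ^ 'n) set set \<Rightarrow> (complex ^ 'n) set set" where
  "closed_strata C = {\<Inter>B |B. B \<subseteq> C}"

definition open_stratum :: "(complex ^ 'n) set set \<Rightarrow> (complex ^ 'n) set \<Rightarrow> (complex ^ 'n) set" where
  "open_stratum C \<alpha> = \<alpha> - \<Union>{\<beta>\<in>closed_strata C. \<beta> \<subset> \<alpha>}"

definition level :: "(complex ^ 'n :: finite) set \<Rightarrow> int" where
  "level \<alpha> = int CARD('n) - int (vec.dim \<alpha>)"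

abbreviation above :: "(complex ^ 'n :: finite) set \<Rightarrow> (complex ^ 'n) set \<Rightarrow> bool"
    (infix \<open>\<succ>\<close> 50) where
  "\<alpha> \<succ> \<beta> \<equiv> covers (\<lambda>\<gamma>. \<gamma>) \<alpha> \<beta>"

definition incidence :: "(complex ^ 'n :: finite) set \<Rightarrow> (complex ^ 'n) set \<Rightarrow> complex" where
  "incidence \<alpha> \<beta> = (if \<alpha> \<succ> \<beta> then 1 else if \<beta> \<succ> \<alpha> then -1 else 0)"

text \<open>The spaces of a quiver are finite-dimensional subspaces of an arbitrary complex vector space
  (which may be taken to be their direct sum); \<open>A \<alpha> \<beta>\<close> maps \<open>V \<beta>\<close> to \<open>V \<alpha>\<close>, and only its values
  on \<open>V \<beta>\<close> matter.\<close>

locale quiver = vector_space smul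
  for smul :: "complex \<Rightarrow> 'v \<Rightarrow> 'v :: ab_group_add" +
  fixes C :: "(complex ^ 'n :: finite) set set"
    and V :: "(complex ^ 'n) set \<Rightarrow> 'v set"
    and A :: "(complex ^ 'n) set \<Rightarrow> (complex ^ 'n) set \<Rightarrow> 'v \<Rightarrow> 'v"
  assumes subspace_V: "\<alpha> \<in> closed_strata C \<Longrightarrow> subspace (V \<alpha>)"
    and finite_dim_V: "\<alpha> \<in> closed_strata C \<Longrightarrow> \<exists>B. finite B \<and> V \<alpha> = span B"
    and maps_A: "\<lbrakk>\<alpha> \<in> closed_strata C; \<beta> \<in> closed_strata C; v \<in> V \<beta>\<rbrakk> \<Longrightarrow> A \<alpha> \<beta> v \<in> V \<alpha>"
    and add_A: "\<lbrakk>\<alpha> \<in> closed_strata C; \<beta> \<in> closed_strata C; v \<in> V \<beta>; w \<in> V \<beta>\<rbrakk> \<Longrightarrow>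
      A \<alpha> \<beta> (v + w) = A \<alpha> \<beta> v + A \<alpha> \<beta> w"
    and scale_A: "\<lbrakk>\<alpha> \<in> closed_strata C; \<beta> \<in> closed_strata C; v \<in> V \<beta>\<rbrakk> \<Longrightarrow>
      A \<alpha> \<beta> (smul c v) = smul c (A \<alpha> \<beta> v)"
    and not_adjacent: "\<lbrakk>\<alpha> \<in> closed_strata C; \<beta> \<in> closed_strata C; \<not> \<alpha> \<succ> \<beta>; \<not> \<beta> \<succ> \<alpha>; v \<in> V \<beta>\<rbrakk> \<Longrightarrow>
      A \<alpha> \<beta> v = 0"
    and level_two: "\<lbrakk>\<alpha> \<in> closed_strata C; \<gamma> \<in> closed_strata C; \<bar>level \<alpha> - level \<gamma>\<bar> = 2; v \<in> V \<gamma>\<rbrakk> \<Longrightarrow>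
      (\<Sum>\<beta>\<in>closed_strata C. A \<alpha> \<beta> (A \<beta> \<gamma> v)) = 0"
    and level_zero: "\<lbrakk>\<alpha> \<in> closed_strata C; \<gamma> \<in> closed_strata C; level \<alpha> = level \<gamma>; \<alpha> \<noteq> \<gamma>;
      \<delta> \<in> closed_strata C; \<alpha> \<succ> \<delta>; \<gamma> \<succ> \<delta>; v \<in> V \<gamma>\<rbrakk> \<Longrightarrow>
      (\<Sum>\<beta>\<in>closed_strata C. A \<alpha> \<beta> (A \<beta> \<gamma> v)) = 0"

text \<open>The linear maps of the quiver with a tilde (its spaces are unchanged)\<close>

definition signed_maps :: "(complex \<Rightarrow> 'v \<Rightarrow> 'v) \<Rightarrow>
    ((complex ^ 'n :: finite) set \<Rightarrow> (complex ^ 'n) set \<Rightarrow> 'v \<Rightarrow> 'v) \<Rightarrow>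
    (complex ^ 'n) set \<Rightarrow> (complex ^ 'n) set \<Rightarrow> 'v \<Rightarrow> 'v" where
  "signed_maps smul A \<alpha> \<beta> v = smul (incidence \<beta> \<alpha>) (A \<alpha> \<beta> v)"

definition vanishing_affine :: "(complex ^ 'n) set set \<Rightarrow> (complex ^ 'n) set \<Rightarrow>
    (complex ^ 'n \<Rightarrow> complex) set" where
  "vanishing_affine C \<alpha> = {f\<in>affine_functions. \<forall>x\<in>open_stratum C \<alpha>. f x = 0}"

definition quiver_module :: "(complex ^ 'n :: finite) set set \<Rightarrow>
    ((complex ^ 'n) set \<Rightarrow> (complex ^ 'n) set \<Rightarrow> complex ^ 'n \<Rightarrow> complex) \<Rightarrow>
    ((complex ^ 'n) set \<Rightarrow> (complex ^ 'n) set \<Rightarrow> complex ^ 'n) \<Rightarrow>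
    (complex \<Rightarrow> 'v \<Rightarrow> 'v :: ab_group_add) \<Rightarrow> ((complex ^ 'n) set \<Rightarrow> 'v set) \<Rightarrow>
    ((complex ^ 'n) set \<Rightarrow> (complex ^ 'n) set \<Rightarrow> 'v \<Rightarrow> 'v) \<Rightarrow>
    ('n diffop, (((complex ^ 'n) set, 'n, 'v) symbol \<Rightarrow>\<^sub>0 'n diffop) set) lmodule" where
  "quiver_module C = strata_module (closed_strata C) (\<lambda>\<alpha>. \<alpha>) (vanishing_affine C)"

definition orth :: "(complex ^ 'n) set \<Rightarrow> (complex ^ 'n) set" where
  "orth S = {y. \<forall>x\<in>S. (\<Sum>i\<in>UNIV. y $ i * x $ i) = 0}"

definition vanishing_linear_orth :: "(complex ^ 'n) set \<Rightarrow> (complex ^ 'n \<Rightarrow> complex) set" where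
  "vanishing_linear_orth \<alpha> = {f\<in>linear_functions. \<forall>y\<in>orth \<alpha>. f y = 0}"

definition dual_quiver_module :: "(complex ^ 'n :: finite) set set \<Rightarrow>
    ((complex ^ 'n) set \<Rightarrow> (complex ^ 'n) set \<Rightarrow> complex ^ 'n \<Rightarrow> complex) \<Rightarrow>
    ((complex ^ 'n) set \<Rightarrow> (complex ^ 'n) set \<Rightarrow> complex ^ 'n) \<Rightarrow>
    (complex \<Rightarrow> 'v \<Rightarrow> 'v :: ab_group_add) \<Rightarrow> ((complex ^ 'n) set \<Rightarrow> 'v set) \<Rightarrow>
    ((complex ^ 'n) set \<Rightarrow> (complex ^ 'n) set \<Rightarrow> 'v \<Rightarrow> 'v) \<Rightarrow>
    ('n diffop, (((complex ^ 'n) set, 'n, 'v) symbol \<Rightarrow>\<^sub>0 'n diffop) set) lmodule" where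
  "dual_quiver_module C = strata_module (closed_strata C) orth vanishing_linear_orth"

end

theory Submission
  imports Defs "Jordan_Normal_Form.Determinant"
begin

text \<open>
  The Fourier transform exchanges the two families of relations of a quiver module. A constant field
  with value \<open>a\<close>, parallel to a stratum \<open>\<alpha>\<close>, becomes minus the linear function \<open>dot a\<close> on the dual
  space, and \<open>dot a\<close> vanishes on \<open>orth \<alpha>\<close>; a function vanishing on \<open>\<alpha>\<close> is \<open>dot b\<close> with \<open>b \<in> orth \<alpha>\<close>, and
  becomes the field \<open>b\<close>, parallel to \<open>orth \<alpha>\<close>. So both modules have presentations on the same vertices
  and vector spaces, and it remains to identify the lines of top forms on \<open>\<alpha>\<close> and on \<open>orth \<alpha>\<close> by
  isomorphisms \<open>\<theta>\<^sub>\<alpha>\<close> compatible with the maps \<open>\<pi>\<close>. For \<open>\<alpha> \<succ> \<beta>\<close>, comparing the relation for the field \<open>a\<close> with the one for the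
  function \<open>dot a\<close>, whose leading terms differ by a sign, leads to the condition
  \<open>\<langle>a, f\<rangle> \<theta>\<^sub>\<beta> \<pi>\<^sub>\<beta>\<^sub>\<alpha> = - \<langle>\<xi>\<^sup>*, a\<rangle> \<pi>\<^sup>*\<^sub>\<beta>\<^sub>\<alpha> \<theta>\<^sub>\<alpha>\<close> for all \<open>a \<in> \<alpha>\<close>.
  In the opposite direction the Fourier transform creates no sign, but the linear
  maps of the quiver with a tilde do, and the condition is
  \<open>\<langle>\<xi>, b\<rangle> \<theta>\<^sub>\<alpha> \<pi>\<^sub>\<alpha>\<^sub>\<beta> = - \<langle>b, f\<^sup>*\<rangle> \<pi>\<^sup>*\<^sub>\<alpha>\<^sub>\<beta> \<theta>\<^sub>\<beta>\<close> for all \<open>b \<in> orth \<beta>\<close>.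

  The isomorphism \<open>\<theta>\<^sub>\<alpha>\<close> (\<open>dual_form\<close>) is the contraction of a volume form of the dual space. If \<open>bs\<close> is a
  basis of \<open>\<alpha>\<close> and \<open>zs\<close> are covectors dual to it, then \<open>\<theta>\<^sub>\<alpha> \<omega>\<close> maps a list \<open>ys\<close> in \<open>orth \<alpha>\<close> to
  \<open>\<omega> bs * volume (rev zs @ ys)\<close>, with a sign depending on the codimension. For other lists \<open>bs\<close> and \<open>zs\<close>
  the determinant of the pairings between them enters (\<open>dual_form_any_frame\<close>). For \<open>\<alpha> \<succ> \<beta>\<close> one may therefore
  compute \<open>\<theta>\<^sub>\<alpha>\<close> with a frame of \<open>\<beta>\<close> extended by one vector \<open>a\<close> and one covector \<open>y\<close>; the forms on \<open>orth \<alpha>\<close> and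
  \<open>orth \<beta>\<close> are then given by the same values of the volume form, so contraction with \<open>a\<close> on one side is contraction
  with \<open>y\<close> on the other (\<open>dual_form_contract\<close>). As the maps \<open>\<pi>\<close> are contractions or inverses of contractions
  (\<open>transition_down\<close>, \<open>transition_up\<close>), both conditions follow. Since \<open>\<theta>\<^sub>\<alpha>\<close> is defined for each
  stratum separately, nothing has to be checked along chains of strata.

  Differential operators are concrete endomaps of the polynomial ring, and the Fourier automorphism
  cannot be read off from a presentation by generators and relations. It is a product of
  maps which are visibly well defined: the adjoint for the pairing in which monomials are orthogonal and
  \<open>x\<^sup>m\<close> has square \<open>m!\<close>, which exchanges coordinates and derivations, and conjugation by the exponential
  of a multiple of the Laplace operator, which fixes the derivations and shifts the coordinates by multiples of them.
\<close>

text \<open>The sign \<open>$\<close> is reserved for components of vectors in \<open>complex ^ 'n\<close>.\<close>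

no_notation Matrix.vec_index (infixl "$" 100)

section \<open>Generators of the ring of differential operators\<close>

lemma poly_coord_single: "poly_coord j * Poly_Mapping.single m c = Poly_Mapping.single (Poly_Mapping.single j 1 + m) c"
  by (simp add: poly_coord_def mult_single)

lemma poly_const_single: "poly_const d * Poly_Mapping.single m c = Poly_Mapping.single m (d * c)"
  by (simp add: poly_const_def mult_single)

lemma poly_const_add: "poly_const (c + d) = poly_const c + poly_const d"
  by (simp add: poly_const_def single_add)

lemma poly_const_uminus: "poly_const (- c) = - poly_const c"
  by (simp add: poly_const_def single_uminus)

lemma poly_const_mult: "poly_const (c * d) = poly_const c * poly_const d"
  by (simp add: poly_const_def mult_single)

lemma poly_partial_single:
  "poly_partial i (Poly_Mapping.single m c) =
     Poly_Mapping.single (m - Poly_Mapping.single i 1) (of_nat (Poly_Mapping.lookup m i) * c)"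
  by (subst poly_partial_altdef[of "{m}"]) (auto simp: keys_single)

lemma cpoly_induct [case_names const coord add]:
  fixes P :: "('n :: finite) cpoly \<Rightarrow> bool"
  assumes const: "\<And>c. P (poly_const c)"
    and coord: "\<And>i p. P p \<Longrightarrow> P (poly_coord i * p)"
    and add: "\<And>p q. P p \<Longrightarrow> P q \<Longrightarrow> P (p + q)"
  shows "P p"
proof -
  have mono: "P (Poly_Mapping.single m c)" for m :: "'n \<Rightarrow>\<^sub>0 nat" and c
  proof (induction "\<Sum>i\<in>UNIV. Poly_Mapping.lookup m i" arbitrary: m rule: less_induct)
    case less
    show ?case
    proof (cases "m = 0")
      case True
      then show ?thesis using const[of c] by (simp add: poly_const_def)
    next
      case False
      then obtain i where i: "Poly_Mapping.lookup m i \<noteq> 0"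
        by (metis poly_mapping_eqI lookup_zero)
      \<comment> \<open>The total degree drops, which makes the induction work.\<close>
      define m' where "m' = m - Poly_Mapping.single i 1"
      have m: "m = Poly_Mapping.single i 1 + m'"
        using i by (intro poly_mapping_eqI) (auto simp: m'_def lookup_add lookup_minus lookup_single when_def)
      have "(\<Sum>j\<in>UNIV. Poly_Mapping.lookup m' j) < (\<Sum>j\<in>UNIV. Poly_Mapping.lookup m j)"
        by (rule sum_strict_mono_ex1)
           (use m in \<open>auto simp: m lookup_add lookup_single when_def\<close>)
      then have "P (Poly_Mapping.single m' c)" by (rule less)
      from coord[OF this, of i] show ?thesis by (simp add: poly_coord_single m)
    qed
  qed
  show ?thesis
  proof (induction p rule: update_induct)
    case const
    show ?case using assms(1)[of 0] by (simp add: poly_const_def)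
  next
    case (update p a b)
    have "Poly_Mapping.update a b p = Poly_Mapping.single a b + p"
      using update by (intro poly_mapping_eqI)
        (auto simp: lookup_update lookup_add lookup_single when_def in_keys_iff)
    then show ?case using update mono add by metis
  qed
qed

lemma poly_partial_const [simp]: "poly_partial i (poly_const c) = 0"
  by (simp add: poly_const_def poly_partial_single)

lemma poly_partial_zero [simp]: "poly_partial i 0 = 0"
  by (simp add: poly_partial_def)

lemma poly_mapping_add_induct [case_names single add]:
  fixes P :: "('a \<Rightarrow>\<^sub>0 'b::comm_monoid_add) \<Rightarrow> bool"
  assumes single: "\<And>m c. P (Poly_Mapping.single m c)"
    and add: "\<And>p q. P p \<Longrightarrow> P q \<Longrightarrow> P (p + q)"
  shows "P p"
proof (induction p rule: update_induct)
  case const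
  show ?case using single[of undefined 0] by simp
next
  case (update p a b)
  have "Poly_Mapping.update a b p = Poly_Mapping.single a b + p"
    using update by (intro poly_mapping_eqI)
      (auto simp: lookup_update lookup_add lookup_single when_def in_keys_iff)
  then show ?case using update add single by metis
qed

lemma poly_partial_coord_mult:
  "poly_partial i (poly_coord j * p) = (if i = j then p else 0) + poly_coord j * poly_partial i p"
proof (induction p rule: poly_mapping_add_induct)
  case (single m c)
  have *: "Poly_Mapping.single j 1 + m - Poly_Mapping.single i 1 =
      Poly_Mapping.single j 1 + (m - Poly_Mapping.single i (1::nat))" if "i \<noteq> j \<or> Poly_Mapping.lookup m i \<noteq> 0"
    using that by (intro poly_mapping_eqI) (auto simp: lookup_add lookup_minus lookup_single when_def)
  show ?case
  proof (cases "i = j")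
    case False
    then show ?thesis
      using * by (simp add: poly_coord_single poly_partial_single lookup_add lookup_single when_def)
  next
    case True
    have "Poly_Mapping.single j (1::nat) + (m - Poly_Mapping.single j 1) = m" if "Poly_Mapping.lookup m j \<noteq> 0"
      using that by (intro poly_mapping_eqI) (auto simp: lookup_add lookup_minus lookup_single when_def)
    then show ?thesis using True
      by (cases "Poly_Mapping.lookup m j = 0")
        (simp_all add: poly_coord_single poly_partial_single lookup_add distrib_right single_add)
  qed
qed (auto simp: distrib_left poly_partial_add)

lemma poly_partial_const_mult: "poly_partial i (poly_const c * p) = poly_const c * poly_partial i p"
  by (induction p rule: poly_mapping_add_induct)
     (simp_all add: poly_const_single poly_partial_single poly_partial_add distrib_left mult.left_commute)

lemma poly_partial_commute:
  fixes p :: "('n::finite) cpoly"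
  shows "poly_partial i (poly_partial j p) = poly_partial j (poly_partial i p)"
  by (induction p rule: cpoly_induct)
     (simp_all add: poly_partial_add poly_partial_coord_mult)

lemma Rep_op_function: "Rep_diffop (op_function g) p = g * p"
  by (simp add: op_function_def Abs_diffop_inverse diff_operators.mult_fun)

lemma Rep_op_const: "Rep_diffop (op_const c) p = poly_const c * p"
  by (simp add: op_const_def Rep_op_function)

lemma Rep_op_coord: "Rep_diffop (op_coord i) p = poly_coord i * p"
  by (simp add: op_coord_def Rep_op_function)

lemma Rep_op_partial: "Rep_diffop (op_partial i) p = poly_partial i p"
  by (simp add: op_partial_def Abs_diffop_inverse diff_operators.deriv_coord)

lemma Rep_diffop_add: "Rep_diffop P (p + q) = Rep_diffop P p + Rep_diffop P q"
  by (rule diff_operators_add[OF Rep_diffop])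

lemma diffop_eqI: "(\<And>p. Rep_diffop P p = Rep_diffop Q p) \<Longrightarrow> P = Q"
  by (simp add: Rep_diffop_inject[symmetric] fun_eq_iff)

lemmas Rep_diffop_simps = Rep_op_const Rep_op_coord Rep_op_partial plus_diffop.rep_eq
  times_diffop.rep_eq one_diffop.rep_eq zero_diffop.rep_eq uminus_diffop.rep_eq

text \<open>Multiplications by arbitrary polynomials are sums of products of coordinates, so that the
  generators below suffice. This turns uniqueness and multiplicativity statements about maps between
  rings of operators into checks on coordinates and derivations.\<close>

lemma diffop_induct [case_names const coord partial add mult]:
  fixes K :: "('n :: finite) diffop \<Rightarrow> bool"
  assumes const: "\<And>c. K (op_const c)"
    and coord: "\<And>i. K (op_coord i)"
    and partial: "\<And>i. K (op_partial i)"
    and add: "\<And>P Q. K P \<Longrightarrow> K Q \<Longrightarrow> K (P + Q)"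
    and mult: "\<And>P Q. K P \<Longrightarrow> K Q \<Longrightarrow> K (P * Q)"
  shows "K P"
proof -
  have fn: "K (op_function g)" for g
  proof (induction g rule: cpoly_induct)
    case (const c)
    then show ?case using assms(1)[of c] by (simp add: op_const_def)
  next
    case (coord i p)
    have "op_function (poly_coord i * p) = op_coord i * op_function p"
      by (rule diffop_eqI) (simp add: Rep_op_function Rep_diffop_simps mult.assoc)
    then show ?case using coord mult assms(2) by metis
  next
    case (add p q)
    have "op_function (p + q) = op_function p + op_function q"
      by (rule diffop_eqI) (simp add: Rep_op_function Rep_diffop_simps distrib_right)
    then show ?case using add assms(4) by metis
  qed
  have "P' \<in> diff_operators \<Longrightarrow> K (Abs_diffop P')" for P' :: "'n cpoly \<Rightarrow> 'n cpoly"
  proof (induction rule: diff_operators.induct)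
    case (mult_fun g)
    then show ?case using fn[of g] by (simp add: op_function_def)
  next
    case (deriv_coord i)
    then show ?case using partial[of i] by (simp add: op_partial_def)
  next
    case (add P Q)
    have "Abs_diffop (\<lambda>p. P p + Q p) = Abs_diffop P + Abs_diffop Q"
      by (rule diffop_eqI)
        (simp add: Abs_diffop_inverse add.hyps plus_diffop.rep_eq diff_operators.add)
    then show ?case using add.IH assms(4) by metis
  next
    case (comp P Q)
    have "Abs_diffop (\<lambda>p. P (Q p)) = Abs_diffop P * Abs_diffop Q"
      by (rule diffop_eqI)
        (simp add: Abs_diffop_inverse comp.hyps times_diffop.rep_eq diff_operators.comp)
    then show ?case using comp.IH mult by metis
  qed
  from this[OF Rep_diffop[of P]] show ?thesis by (simp add: Rep_diffop_inverse)
qed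

section \<open>The adjoint for the Fischer pairing\<close>

definition multifact :: "('n :: finite \<Rightarrow>\<^sub>0 nat) \<Rightarrow> complex" where
  "multifact m = (\<Prod>i\<in>UNIV. fact (Poly_Mapping.lookup m i))"

text \<open>The Fischer pairing, for which multiplication by a coordinate is adjoint to the derivation.\<close>

definition fischer :: "('n :: finite) cpoly \<Rightarrow> 'n cpoly \<Rightarrow> complex" where
  "fischer p q = (\<Sum>m\<in>Poly_Mapping.keys p. Poly_Mapping.lookup p m * Poly_Mapping.lookup q m * multifact m)"

lemma fischer_superset:
  assumes "finite S" "Poly_Mapping.keys p \<subseteq> S"
  shows "fischer p q = (\<Sum>m\<in>S. Poly_Mapping.lookup p m * Poly_Mapping.lookup q m * multifact m)"
  unfolding fischer_def
  by (rule sum.mono_neutral_left) (use assms in \<open>auto simp: in_keys_iff\<close>)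

lemma fischer_commute: "fischer p q = fischer q p"
  by (simp add: fischer_superset[of "Poly_Mapping.keys p \<union> Poly_Mapping.keys q"] mult.commute)

lemma fischer_add_left: "fischer (p + p') q = fischer p q + fischer p' q"
proof -
  let ?S = "Poly_Mapping.keys p \<union> Poly_Mapping.keys p'"
  show ?thesis
    by (simp add: fischer_superset[of ?S] Poly_Mapping.keys_add lookup_add ring_distribs sum.distrib)
qed

lemma fischer_add_right: "fischer q (p + p') = fischer q p + fischer q p'"
  by (metis fischer_add_left fischer_commute)

lemma fischer_single: "fischer (Poly_Mapping.single m c) q = c * Poly_Mapping.lookup q m * multifact m"
  by (simp add: fischer_superset[of "{m}"])

lemma multifact_nonzero: "multifact m \<noteq> 0"
  by (simp add: multifact_def)

lemma fischer_nondegenerate: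
  assumes "\<And>p. fischer p q = fischer p q'"
  shows "q = q'"
proof (rule poly_mapping_eqI)
  fix m
  show "Poly_Mapping.lookup q m = Poly_Mapping.lookup q' m"
    using assms[of "Poly_Mapping.single m 1"] multifact_nonzero[of m] by (simp add: fischer_single)
qed

lemma fischer_const: "fischer (poly_const c * p) q = fischer p (poly_const c * q)"
proof (induction p rule: poly_mapping_add_induct)
  case (single m d)
  have "Poly_Mapping.lookup (poly_const c * q) m = c * Poly_Mapping.lookup q m"
    by (induction q rule: poly_mapping_add_induct)
      (simp_all add: poly_const_single lookup_single lookup_add distrib_left when_def)
  then show ?case by (simp add: poly_const_single fischer_single)
qed (simp add: distrib_left fischer_add_left)

lemma multifact_Suc:
  "multifact (Poly_Mapping.single i 1 + m) = of_nat (Suc (Poly_Mapping.lookup m i)) * multifact m"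
proof -
  have "multifact (Poly_Mapping.single i 1 + m) =
     (\<Prod>j\<in>UNIV. (if j = i then of_nat (Suc (Poly_Mapping.lookup m i)) else 1) * fact (Poly_Mapping.lookup m j))"
    unfolding multifact_def
    by (rule prod.cong) (auto simp: lookup_add lookup_single when_def)
  then show ?thesis by (simp add: prod.distrib multifact_def)
qed

lemma lookup_poly_partial:
  "Poly_Mapping.lookup (poly_partial i q) m =
     of_nat (Suc (Poly_Mapping.lookup m i)) * Poly_Mapping.lookup q (Poly_Mapping.single i 1 + m)"
proof (induction q rule: poly_mapping_add_induct)
  case (single k c)
  have "k - Poly_Mapping.single i 1 = m \<longleftrightarrow> k = Poly_Mapping.single i 1 + m" if "Poly_Mapping.lookup k i \<noteq> 0"
    using that by (auto simp: poly_mapping_eq_iff fun_eq_iff lookup_add lookup_minus lookup_single when_def)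
  moreover have "k \<noteq> Poly_Mapping.single i 1 + m" if "Poly_Mapping.lookup k i = 0"
    using that by (auto simp: lookup_add)
  ultimately show ?case
    by (cases "Poly_Mapping.lookup k i = 0")
      (auto simp: poly_partial_single lookup_single when_def lookup_add)
qed (simp add: poly_partial_add lookup_add distrib_left)

text \<open>On monomials both sides are the factorial of the larger exponent, since
  \<open>(k + 1)! = (k + 1) k!\<close>.\<close>

lemma fischer_coord: "fischer (poly_coord i * p) q = fischer p (poly_partial i q)"
proof (induction p rule: poly_mapping_add_induct)
  case (single m c)
  show ?case
    unfolding poly_coord_single fischer_single lookup_poly_partial multifact_Suc by (simp only: mult_ac)
next
  case (add p p')
  then show ?case by (simp add: distrib_left fischer_add_left)
qed

lemma adjoint_exists: "\<exists>Q. \<forall>p q. fischer (Rep_diffop P p) q = fischer p (Rep_diffop Q q)"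
  for P :: "('n::finite) diffop"
proof (induction P rule: diffop_induct)
  case (const c)
  then show ?case
    by (intro exI[of _ "op_const c"]) (simp add: Rep_diffop_simps fischer_const)
next
  case (coord i)
  then show ?case
    by (intro exI[of _ "op_partial i"]) (simp add: Rep_diffop_simps fischer_coord)
next
  case (partial i)
  then show ?case
    by (intro exI[of _ "op_coord i"]) (metis Rep_op_coord Rep_op_partial fischer_commute fischer_coord)
next
  case (add P Q)
  then obtain P' Q' where "\<forall>p q. fischer (Rep_diffop P p) q = fischer p (Rep_diffop P' q)"
    "\<forall>p q. fischer (Rep_diffop Q p) q = fischer p (Rep_diffop Q' q)" by blast
  then show ?case
    by (intro exI[of _ "P' + Q'"]) (simp add: Rep_diffop_simps fischer_add_left fischer_add_right)
next
  case (mult P Q)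
  then obtain P' Q' where "\<forall>p q. fischer (Rep_diffop P p) q = fischer p (Rep_diffop P' q)"
    "\<forall>p q. fischer (Rep_diffop Q p) q = fischer p (Rep_diffop Q' q)" by blast
  then show ?case
    by (intro exI[of _ "Q' * P'"]) (simp add: Rep_diffop_simps)
qed

definition adjoint_op :: "('n::finite) diffop \<Rightarrow> 'n diffop" where
  "adjoint_op P = (SOME Q. \<forall>p q. fischer (Rep_diffop P p) q = fischer p (Rep_diffop Q q))"

lemma adjoint_op:
  fixes P :: "('n::finite) diffop"
  shows "fischer (Rep_diffop P p) q = fischer p (Rep_diffop (adjoint_op P) q)"
  using someI_ex[OF adjoint_exists[of P]] unfolding adjoint_op_def by blast

lemma adjoint_op_unique:
  fixes P :: "('n::finite) diffop"
  assumes "\<And>p q. fischer (Rep_diffop P p) q = fischer p (Rep_diffop Q q)"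
  shows "adjoint_op P = Q"
  by (intro diffop_eqI fischer_nondegenerate) (metis adjoint_op assms)

text \<open>An adjoint is unique because the pairing is nondegenerate, hence every identity follows by
  exhibiting an adjoint.\<close>

lemma adjoint_op_simps:
  fixes P Q :: "('n::finite) diffop"
  shows
  "adjoint_op (op_const c) = op_const c"
  "adjoint_op (op_coord i) = op_partial i"
  "adjoint_op (op_partial i) = op_coord i"
  "adjoint_op (P + Q) = adjoint_op P + adjoint_op Q"
  "adjoint_op (P * Q) = adjoint_op Q * adjoint_op P"
  "adjoint_op (adjoint_op P) = P"
proof -
  show "adjoint_op (op_const c) = op_const c"
    by (rule adjoint_op_unique) (simp add: Rep_diffop_simps fischer_const)
  show "adjoint_op (op_coord i) = op_partial i"
    by (rule adjoint_op_unique) (simp add: Rep_diffop_simps fischer_coord)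
  show "adjoint_op (op_partial i) = op_coord i"
    by (rule adjoint_op_unique) (metis Rep_op_coord Rep_op_partial fischer_commute fischer_coord)
  show "adjoint_op (P + Q) = adjoint_op P + adjoint_op Q"
    by (rule adjoint_op_unique)
      (simp add: Rep_diffop_simps fischer_add_left fischer_add_right adjoint_op)
  show "adjoint_op (P * Q) = adjoint_op Q * adjoint_op P"
    by (rule adjoint_op_unique) (simp add: Rep_diffop_simps adjoint_op)
  show "adjoint_op (adjoint_op P) = P"
    by (rule adjoint_op_unique) (metis fischer_commute adjoint_op)
qed

section \<open>Shears and the Fourier automorphism\<close>

text \<open>The coordinates shifted by multiples of the derivations. They commute with each other, and
  therefore a polynomial can be evaluated at them.\<close>

definition shear_coord :: "complex \<Rightarrow> 'n \<Rightarrow> ('n::finite) diffop" where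
  "shear_coord c i = op_coord i + op_const c * op_partial i"

lemma Rep_diffop_const_mult:
  fixes P :: "('n::finite) diffop"
  shows "Rep_diffop P (poly_const c * p) = poly_const c * Rep_diffop P p"
  by (induction P arbitrary: p rule: diffop_induct)
     (simp_all add: Rep_diffop_simps poly_partial_const_mult distrib_left mult.left_commute)

lemma commute_mult_left: "(a :: 'a :: semigroup_mult) * p = p * a \<Longrightarrow> a * (p * q) = p * (a * q)"
  by (metis mult.assoc)

lemma op_const_commute:
  fixes P :: "('n::finite) diffop"
  shows "op_const c * P = P * op_const c"
  by (rule diffop_eqI) (simp add: Rep_diffop_simps Rep_diffop_const_mult)

text \<open>The cross terms \<open>c (x\<^sub>i \<partial>\<^sub>j + \<partial>\<^sub>i x\<^sub>j)\<close> are symmetric for \<open>i \<noteq> j\<close> as the two factors commute.\<close>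

lemma shear_coord_commute: "shear_coord c i * shear_coord c j = shear_coord c j * shear_coord c i"
proof (cases "i = j")
  case False
  have xx: "op_coord i * op_coord j = op_coord j * op_coord i"
    by (rule diffop_eqI) (simp add: Rep_diffop_simps mult.left_commute)
  have dd: "op_partial i * op_partial j = op_partial j * op_partial i"
    by (rule diffop_eqI) (simp add: Rep_diffop_simps poly_partial_commute[of i j])
  have dx: "op_partial k * op_coord l = op_coord l * op_partial k" if "k \<noteq> l" for k l :: 'a
    by (rule diffop_eqI) (use that in \<open>simp add: Rep_diffop_simps poly_partial_coord_mult\<close>)
  define b b' :: "'a diffop" where "b = op_const c * op_partial i" and "b' = op_const c * op_partial j"
  have "b * op_coord j = op_coord j * b"
    unfolding b_def by (metis dx[OF False] op_const_commute mult.assoc)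
  moreover have "op_coord i * b' = b' * op_coord i"
    unfolding b'_def using False by (metis dx op_const_commute mult.assoc)
  moreover have "b * b' = b' * b"
    unfolding b_def b'_def by (metis dd op_const_commute mult.assoc)
  ultimately show ?thesis
    by (simp add: shear_coord_def flip: b_def b'_def) (simp add: xx distrib_left distrib_right add_ac)
qed simp

definition shear_monomial :: "complex \<Rightarrow> 'n list \<Rightarrow> ('n \<Rightarrow>\<^sub>0 nat) \<Rightarrow> ('n::finite) diffop" where
  "shear_monomial c is m = prod_list (map (\<lambda>i. shear_coord c i ^ Poly_Mapping.lookup m i) is)"

lemma commute_power: "(a::'a::monoid_mult) * b = b * a \<Longrightarrow> a * b ^ n = b ^ n * a"
  by (metis power_commuting_commutes)

lemma shear_monomial_add:
  assumes "distinct is"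
  shows "shear_monomial c is (Poly_Mapping.single i 1 + m) =
    (if i \<in> set is then shear_coord c i * shear_monomial c is m else shear_monomial c is m)"
  using assms
proof (induction "is")
  case (Cons j js)
  show ?case
  proof (cases "i = j")
    case True
    then show ?thesis using Cons
      by (simp add: shear_monomial_def lookup_add mult.assoc)
  next
    case False
    then show ?thesis using Cons
      commute_mult_left[OF commute_power[OF shear_coord_commute, of c i j "Poly_Mapping.lookup m j"]]
      by (simp add: shear_monomial_def lookup_add lookup_single)
  qed
qed (simp add: shear_monomial_def)

text \<open>The polynomial is evaluated at the shifted coordinates and the resulting operator is applied to 1. This
  is the exponential of \<open>c / 2\<close> times the Laplace operator \<open>\<Sum>\<^sub>i \<partial>\<^sub>i\<^sup>2\<close>, but the definition involves
  no series; as the factors commute, the product may be taken along any list of the coordinates.\<close>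

definition shear :: "complex \<Rightarrow> ('n :: finite) cpoly \<Rightarrow> 'n cpoly" where
  "shear c p = (\<Sum>m\<in>Poly_Mapping.keys p. poly_const (Poly_Mapping.lookup p m) *
     Rep_diffop (shear_monomial c (SOME is. set is = UNIV \<and> distinct is) m) 1)"

lemma shear_superset:
  assumes "finite S" "Poly_Mapping.keys p \<subseteq> S"
  shows "shear c p = (\<Sum>m\<in>S. poly_const (Poly_Mapping.lookup p m) *
     Rep_diffop (shear_monomial c (SOME is. set is = UNIV \<and> distinct is) m) 1)"
  unfolding shear_def
  by (rule sum.mono_neutral_left) (use assms in \<open>auto simp: in_keys_iff poly_const_def\<close>)

lemma shear_add: "shear c (p + q) = shear c p + shear c q"
  by (simp add: shear_superset[of "Poly_Mapping.keys p \<union> Poly_Mapping.keys q"] Poly_Mapping.keys_add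
     lookup_add poly_const_add distrib_right sum.distrib)

lemma shear_single: "shear c (Poly_Mapping.single m d) =
   poly_const d * Rep_diffop (shear_monomial c (SOME is. set is = UNIV \<and> distinct is) m) 1"
  by (simp add: shear_superset[of "{m}"])

lemma poly_const_1 [simp]: "poly_const 1 = 1"
  by (simp add: poly_const_def)

lemma shear_const [simp]: "shear c (poly_const d) = poly_const d"
proof -
  have "shear_monomial c is 0 = 1" for "is" :: "'a list"
    by (induction "is") (simp_all add: shear_monomial_def)
  then show ?thesis by (simp add: poly_const_def shear_single one_diffop.rep_eq)
qed

lemma shear_zero [simp]: "shear c 0 = 0"
  by (simp add: shear_def)

lemma shear_const_mult: "shear c (poly_const d * p) = poly_const d * shear c p"
  by (induction p rule: poly_mapping_add_induct)
     (simp_all add: poly_const_single shear_single poly_const_mult shear_add distrib_left mult.assoc)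

lemma shear_coord_mult:
  fixes p :: "('n::finite) cpoly"
  shows "shear c (poly_coord i * p) = poly_coord i * shear c p + poly_const c * poly_partial i (shear c p)"
proof -
  have "shear c (poly_coord i * p) = Rep_diffop (shear_coord c i) (shear c p)"
  proof (induction p rule: poly_mapping_add_induct)
    case (single m d)
    have ex: "\<exists>is. set is = (UNIV :: 'n set) \<and> distinct is"
      by (rule finite_distinct_list) simp
    show ?case using someI_ex[OF ex]
      by (simp add: poly_coord_single shear_single shear_monomial_add[simplified] times_diffop.rep_eq
           Rep_diffop_const_mult)
  qed (simp add: distrib_left shear_add Rep_diffop_add)
  then show ?thesis by (simp add: shear_coord_def Rep_diffop_simps)
qed

text \<open>The commutator of \<open>\<partial>\<^sub>i\<close> with the shifted coordinate \<open>x\<^sub>j + c \<partial>\<^sub>j\<close> is the same as that with \<open>x\<^sub>j\<close>.\<close>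

lemma shear_partial: "shear c (poly_partial i p) = poly_partial i (shear c p)"
proof (induction p rule: cpoly_induct)
  case (const d)
  then show ?case by simp
next
  case (coord j p)
  then show ?case
    using poly_partial_commute[of i j "shear c p"]
    by (simp add: poly_partial_coord_mult shear_add shear_coord_mult poly_partial_add
          poly_partial_const_mult)
qed (simp add: poly_partial_add shear_add)

text \<open>The composition commutes with multiplication by coordinates, because the two shifts cancel, and it fixes
  the constants.\<close>

lemma shear_inverse: "shear (- c) (shear c p) = p"
proof (induction p rule: cpoly_induct)
  case (coord j p)
  then show ?case
    by (simp add: poly_const_uminus shear_add shear_coord_mult shear_const_mult shear_partial)
qed (simp_all add: shear_add)

lemma shear_conj_exists: "\<exists>Q. \<forall>p. Rep_diffop Q (shear c p) = shear c (Rep_diffop P p)"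
  for P :: "('n::finite) diffop"
proof (induction P rule: diffop_induct)
  case (const d)
  then show ?case
    by (intro exI[of _ "op_const d"]) (simp add: Rep_diffop_simps shear_const_mult)
next
  case (coord i)
  then show ?case
    by (intro exI[of _ "shear_coord c i"]) (simp add: Rep_diffop_simps shear_coord_def shear_coord_mult)
next
  case (partial i)
  then show ?case
    by (intro exI[of _ "op_partial i"]) (simp add: Rep_diffop_simps shear_partial)
next
  case (add P Q)
  then obtain P' Q' where "\<forall>p. Rep_diffop P' (shear c p) = shear c (Rep_diffop P p)"
    "\<forall>p. Rep_diffop Q' (shear c p) = shear c (Rep_diffop Q p)" by blast
  then show ?case
    by (intro exI[of _ "P' + Q'"]) (simp add: Rep_diffop_simps shear_add)
next
  case (mult P Q)
  then obtain P' Q' where "\<forall>p. Rep_diffop P' (shear c p) = shear c (Rep_diffop P p)"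
    "\<forall>p. Rep_diffop Q' (shear c p) = shear c (Rep_diffop Q p)" by blast
  then show ?case
    by (intro exI[of _ "P' * Q'"]) (simp add: Rep_diffop_simps)
qed

definition shear_conj :: "complex \<Rightarrow> ('n::finite) diffop \<Rightarrow> 'n diffop" where
  "shear_conj c P = (SOME Q. \<forall>p. Rep_diffop Q (shear c p) = shear c (Rep_diffop P p))"

lemma shear_conj:
  fixes P :: "('n::finite) diffop"
  shows "Rep_diffop (shear_conj c P) (shear c p) = shear c (Rep_diffop P p)"
  using someI_ex[OF shear_conj_exists[of c P]] unfolding shear_conj_def by blast

lemma shear_conj_unique:
  fixes P :: "('n::finite) diffop"
  assumes "\<And>p. Rep_diffop Q (shear c p) = shear c (Rep_diffop P p)"
  shows "shear_conj c P = Q"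
proof (rule diffop_eqI)
  fix p :: "'n cpoly"
  have "p = shear c (shear (- c) p)" using shear_inverse[of "- c" p] by simp
  then show "Rep_diffop (shear_conj c P) p = Rep_diffop Q p" by (metis shear_conj assms)
qed

lemma shear_conj_simps:
  fixes P Q :: "('n::finite) diffop"
  shows
  "shear_conj c (op_const d) = op_const d"
  "shear_conj c (op_coord i) = shear_coord c i"
  "shear_conj c (op_partial i) = op_partial i"
  "shear_conj c (P + Q) = shear_conj c P + shear_conj c Q"
  "shear_conj c (P * Q) = shear_conj c P * shear_conj c Q"
  "shear_conj (- c) (shear_conj c P) = P"
proof -
  show "shear_conj c (op_const d) = op_const d"
    by (rule shear_conj_unique) (simp add: Rep_diffop_simps shear_const_mult)
  show "shear_conj c (op_coord i) = shear_coord c i"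
    by (rule shear_conj_unique) (simp add: Rep_diffop_simps shear_coord_def shear_coord_mult)
  show "shear_conj c (op_partial i) = op_partial i"
    by (rule shear_conj_unique) (simp add: Rep_diffop_simps shear_partial)
  show "shear_conj c (P + Q) = shear_conj c P + shear_conj c Q"
    by (rule shear_conj_unique) (simp add: Rep_diffop_simps shear_add shear_conj)
  show "shear_conj c (P * Q) = shear_conj c P * shear_conj c Q"
    by (rule shear_conj_unique) (simp add: Rep_diffop_simps shear_conj)
  show "shear_conj (- c) (shear_conj c P) = P"
    by (rule shear_conj_unique) (metis shear_conj shear_inverse minus_minus)
qed

lemma op_const_uminus: "op_const (- c) = - op_const c"
  by (rule diffop_eqI) (simp add: Rep_diffop_simps poly_const_def single_uminus)

lemma op_const_1 [simp]: "op_const 1 = 1"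
  by (rule diffop_eqI) (simp add: Rep_diffop_simps)

lemma additive_minus:
  fixes f :: "'a::ab_group_add \<Rightarrow> 'b::ab_group_add"
  assumes "\<And>x y. f (x + y) = f x + f y"
  shows "f (- x) = - f x" "f (x - y) = f x - f y"
proof -
  interpret additive f by unfold_locales (rule assms)
  show "f (- x) = - f x" "f (x - y) = f x - f y" by (rule minus diff)+
qed

text \<open>Write \<open>T\<^sub>c\<close> for \<open>shear_conj c\<close>. The adjoint reverses products and occurs twice, so this is an automorphism.
  The two adjoints around \<open>T\<^sub>1\<close> give the map that fixes \<open>x\<close> and sends \<open>\<partial>\<close> to \<open>\<partial> + x\<close>, and then
  \<open>x \<mapsto> x - \<partial> \<mapsto> - \<partial> \<mapsto> - \<partial>\<close> and \<open>\<partial> \<mapsto> \<partial> \<mapsto> \<partial> + x \<mapsto> x\<close>. This is the usual factorization of a rotation by a right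
  angle into three shears.\<close>

definition fourier_map :: "('n::finite) diffop \<Rightarrow> 'n diffop" where
  "fourier_map P = shear_conj (- 1) (adjoint_op (shear_conj 1 (adjoint_op (shear_conj (- 1) P))))"

lemma is_fourier_iso_fourier_map: "is_fourier_iso (fourier_map :: ('n::finite) diffop \<Rightarrow> _)"
  unfolding is_fourier_iso_def
proof (intro conjI allI)
  let ?inv = "\<lambda>P :: 'n diffop. shear_conj 1 (adjoint_op (shear_conj (- 1) (adjoint_op (shear_conj 1 P))))"
  have c: "shear_conj 1 (shear_conj (- 1) P) = P" "shear_conj (- 1) (shear_conj 1 P) = P" for P :: "'n diffop"
    using shear_conj_simps(6)[of "-1"] shear_conj_simps(6)[of 1] by auto
  show "bij (fourier_map :: 'n diffop \<Rightarrow> _)"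
    by (rule o_bij[of ?inv]) (auto simp: fun_eq_iff fourier_map_def c adjoint_op_simps)
  fix P Q :: "'n diffop" and d and i :: 'n
  show "fourier_map (P + Q) = fourier_map P + fourier_map Q"
    by (simp add: fourier_map_def shear_conj_simps adjoint_op_simps)
  show "fourier_map (P * Q) = fourier_map P * fourier_map Q"
    by (simp add: fourier_map_def shear_conj_simps adjoint_op_simps)
  show "fourier_map (op_const d :: 'n diffop) = op_const d"
    by (simp add: fourier_map_def shear_conj_simps adjoint_op_simps)
  note simps = fourier_map_def shear_conj_simps adjoint_op_simps shear_coord_def op_const_uminus
  have neg: "shear_conj c (P - Q) = shear_conj c P - shear_conj c Q" "shear_conj c (- P) = - shear_conj c P"
    "adjoint_op (P - Q) = adjoint_op P - adjoint_op Q" "adjoint_op (- P) = - adjoint_op P"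
    for c and P Q :: "'n diffop"
    by (rule additive_minus; rule shear_conj_simps adjoint_op_simps)+
  show "fourier_map (op_coord i) = - op_partial i"
    by (simp add: simps neg)
  show "fourier_map (op_partial i) = op_coord i"
    by (simp add: simps neg)
qed

lemma is_fourier_iso_fourier_iso: "is_fourier_iso (fourier_iso :: ('n::finite) diffop \<Rightarrow> _)"
  unfolding fourier_iso_def
proof (rule theI[of is_fourier_iso fourier_map])
  show "is_fourier_iso (fourier_map :: 'n diffop \<Rightarrow> _)" by (rule is_fourier_iso_fourier_map)
  fix \<phi> :: "'n diffop \<Rightarrow> 'n diffop"
  assume "is_fourier_iso \<phi>"
  then have "\<phi> P = fourier_map P" for P
    using is_fourier_iso_fourier_map[where ?'n = 'n]
    by (induction P rule: diffop_induct) (simp_all add: is_fourier_iso_def)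
  then show "\<phi> = fourier_map" by blast
qed

section \<open>Alternating forms given on lists\<close>

lemma inv_forms_outside: "\<omega> \<in> inv_forms S k \<Longrightarrow> \<not> (length xs = k \<and> set xs \<subseteq> S) \<Longrightarrow> \<omega> xs = 0"
  by (simp add: inv_forms_def)

lemma inv_forms_not_distinct: "\<omega> \<in> inv_forms S k \<Longrightarrow> \<not> distinct xs \<Longrightarrow> \<omega> xs = 0"
  by (simp add: inv_forms_def)

lemma inv_forms_linear:
  assumes "\<omega> \<in> inv_forms S k" "length ps + length qs + 1 = k" "set ps \<subseteq> S" "set qs \<subseteq> S" "x \<in> S" "y \<in> S"
  shows "\<omega> (ps @ (c *s x + y) # qs) = c * \<omega> (ps @ x # qs) + \<omega> (ps @ y # qs)"
proof -
  have *: "\<forall>xs i x y c. length xs = k \<and> set xs \<subseteq> S \<and> i < k \<and> x \<in> S \<and> y \<in> S \<longrightarrow>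
        \<omega> (xs[i := c *s x + y]) = c * \<omega> (xs[i := x]) + \<omega> (xs[i := y])"
    using assms(1) by (simp add: inv_forms_def)
  have "length (ps @ x # qs) = k \<and> set (ps @ x # qs) \<subseteq> S \<and> length ps < k \<and> x \<in> S \<and> y \<in> S"
    using assms by auto
  then show ?thesis
    using *[rule_format, of "ps @ x # qs" "length ps" x y c] by (simp add: list_update_append)
qed

text \<open>Lists split at an entry are easier to handle than updates at an index.\<close>

lemma inv_formsI:
  assumes "\<And>xs. length xs \<noteq> k \<Longrightarrow> \<omega> xs = 0"
    and "\<And>xs. \<not> set xs \<subseteq> S \<Longrightarrow> \<omega> xs = 0"
    and "\<And>ps qs x y c. \<lbrakk>length ps + length qs + 1 = k; set ps \<subseteq> S; set qs \<subseteq> S; x \<in> S; y \<in> S\<rbrakk> \<Longrightarrow>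
      \<omega> (ps @ (c *s x + y) # qs) = c * \<omega> (ps @ x # qs) + \<omega> (ps @ y # qs)"
    and "\<And>ps qs rs x. \<omega> (ps @ x # qs @ x # rs) = 0"
  shows "\<omega> \<in> inv_forms S k"
  unfolding inv_forms_def
proof (intro CollectI conjI allI impI)
  fix xs i x y c
  assume *: "length xs = k \<and> set xs \<subseteq> S \<and> i < k \<and> x \<in> S \<and> y \<in> S"
  then have "set (take i xs) \<subseteq> S" "set (drop (Suc i) xs) \<subseteq> S"
    by (meson order_trans set_take_subset set_drop_subset)+
  then show "\<omega> (xs[i := c *s x + y]) = c * \<omega> (xs[i := x]) + \<omega> (xs[i := y])"
    using * assms(3)[of "take i xs" "drop (Suc i) xs" x y c] by (simp add: upd_conv_take_nth_drop)
next
  fix xs :: "(complex ^ 'a) list"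
  assume "\<not> distinct xs"
  then obtain ps qs rs x where "xs = ps @ [x] @ qs @ [x] @ rs" using not_distinct_decomp by blast
  then show "\<omega> xs = 0" using assms(4) by simp
qed (use assms in blast)

lemma inv_forms_add:
  assumes "\<omega> \<in> inv_forms S k" "length ps + length qs + 1 = k" "set ps \<subseteq> S" "set qs \<subseteq> S" "x \<in> S" "y \<in> S"
  shows "\<omega> (ps @ (x + y) # qs) = \<omega> (ps @ x # qs) + \<omega> (ps @ y # qs)"
  using inv_forms_linear[OF assms, of 1] by simp

lemma inv_forms_zero_entry:
  assumes "\<omega> \<in> inv_forms S k" "0 \<in> set xs"
  shows "\<omega> xs = 0"
proof (cases "length xs = k \<and> set xs \<subseteq> S")
  case True
  obtain ps qs where "xs = ps @ 0 # qs" using assms(2) by (meson split_list)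
  with True inv_forms_add[OF assms(1), of ps qs 0 0] show ?thesis by auto
qed (use assms inv_forms_outside in blast)

lemma inv_forms_swap:
  assumes "vec.subspace S" "\<omega> \<in> inv_forms S k"
  shows "\<omega> (ps @ x # y # qs) = - \<omega> (ps @ y # x # qs)"
proof (cases "length (ps @ x # y # qs) = k \<and> set (ps @ x # y # qs) \<subseteq> S")
  case True
  then have S: "x + y \<in> S" using vec.subspace_add[OF assms(1)] by auto
  have z: "\<omega> (ps @ z # z # qs) = 0" for z using inv_forms_not_distinct[OF assms(2)] by auto
  have "\<omega> (ps @ (x + y) # (x + y) # qs) = \<omega> (ps @ x # (x + y) # qs) + \<omega> (ps @ y # (x + y) # qs)"
    by (rule inv_forms_add[OF assms(2)]) (use True S in auto)
  also have "\<omega> (ps @ x # (x + y) # qs) = \<omega> (ps @ x # x # qs) + \<omega> (ps @ x # y # qs)"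
    using inv_forms_add[OF assms(2), of "ps @ [x]" qs x y] True by auto
  also have "\<omega> (ps @ y # (x + y) # qs) = \<omega> (ps @ y # x # qs) + \<omega> (ps @ y # y # qs)"
    using inv_forms_add[OF assms(2), of "ps @ [y]" qs x y] True by auto
  finally have "\<omega> (ps @ x # y # qs) + \<omega> (ps @ y # x # qs) = 0"
    unfolding z by (metis add.left_neutral add.right_neutral)
  then show ?thesis by (metis eq_neg_iff_add_eq_0)
next
  case False
  then show ?thesis using inv_forms_outside[OF assms(2)] by auto
qed

lemma inv_forms_move:
  assumes "vec.subspace S" "\<omega> \<in> inv_forms S k"
  shows "\<omega> (ps @ x # us @ qs) = (-1) ^ length us * \<omega> (ps @ us @ x # qs)"
proof (induction us arbitrary: ps)
  case (Cons u us)
  have "\<omega> (ps @ x # u # us @ qs) = - \<omega> ((ps @ [u]) @ x # us @ qs)"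
    using inv_forms_swap[OF assms, of ps x u "us @ qs"] by simp
  also have "\<dots> = - ((-1) ^ length us * \<omega> ((ps @ [u]) @ us @ x # qs))"
    by (subst Cons) simp
  finally show ?case by simp
qed simp

lemma inv_forms_permute:
  assumes "vec.subspace S" "\<omega> \<in> inv_forms S k" "mset xs = mset ys" "\<omega> (ps @ xs) = 0"
  shows "\<omega> (ps @ ys) = 0"
  using assms(3,4)
proof (induction xs arbitrary: ps ys)
  case (Cons x xs)
  then have "x \<in> set ys" by (metis list.set_intros(1) mset_eq_setD)
  then obtain us vs where ys: "ys = us @ x # vs" by (meson split_list)
  have "\<omega> ((ps @ [x]) @ us @ vs) = 0"
    by (rule Cons.IH) (use Cons.prems ys in auto)
  then show ?case using inv_forms_move[OF assms(1,2), of ps x us vs] ys by simp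
qed simp

text \<open>A form which vanishes on one spanning list of the right length is zero: by linearity the entries may
  be taken from the list, and a list without repetitions is then a permutation of it. Vectors of \<open>T\<close> kill the form,
  so a list that spans only modulo \<open>T\<close> is enough; this serves for forms that come from a quotient of the space.\<close>

lemma inv_forms_eq_0:
  assumes S: "vec.subspace S" and w: "\<omega> \<in> inv_forms S k"
    and bs: "length bs = k" "set bs \<subseteq> S" "S \<subseteq> vec.span (set bs \<union> T)" "T \<subseteq> S"
    and kill: "\<And>xs. set xs \<inter> T \<noteq> {} \<Longrightarrow> \<omega> xs = 0"
    and 0: "\<omega> bs = 0"
  shows "\<omega> xs = 0"
proof -
  have base: "\<omega> xs = 0" if xs: "set xs \<subseteq> set bs \<union> T" for xs
  proof (cases "set xs \<inter> T \<noteq> {} \<or> \<not> distinct xs \<or> length xs \<noteq> k")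
    case True
    then show ?thesis using kill inv_forms_not_distinct[OF w] inv_forms_outside[OF w] by blast
  next
    case False
    then have "set xs \<subseteq> set bs" "card (set xs) = k" using xs by (auto simp: distinct_card)
    moreover have "card (set bs) \<le> k" using bs(1) card_length by blast
    ultimately have "set xs = set bs" by (metis List.finite_set card_seteq)
    then have "mset bs = mset xs"
      by (metis False \<open>card (set xs) = k\<close> bs(1) card_distinct set_eq_iff_mset_eq_distinct)
    then show ?thesis using inv_forms_permute[OF S w, of bs xs "[]"] 0 by simp
  qed
  have "set ps \<subseteq> set bs \<union> T \<Longrightarrow> set xs \<subseteq> S \<Longrightarrow> length ps + length xs = k \<Longrightarrow> \<omega> (ps @ xs) = 0" for ps xs
  proof (induction xs arbitrary: ps)
    case Nil
    then show ?case using base by simp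
  next
    case (Cons x xs)
    have ps: "set ps \<subseteq> S" using Cons.prems(1) bs by blast
    have "x \<in> vec.span (set bs \<union> T)" using Cons.prems(2) bs by auto
    then have "x \<in> S \<and> \<omega> (ps @ x # xs) = 0"
    proof (induction rule: vec.span_induct_alt)
      case base
      then show ?case using inv_forms_zero_entry[OF w, of "ps @ 0 # xs"] vec.subspace_0[OF S] by simp
    next
      case (step c b y)
      have b: "b \<in> S" using step bs by blast
      have "\<omega> ((ps @ [b]) @ xs) = 0"
        by (rule Cons.IH) (use Cons.prems step in auto)
      moreover have "\<omega> (ps @ (c *s b + y) # xs) = c * \<omega> (ps @ b # xs) + \<omega> (ps @ y # xs)"
        by (rule inv_forms_linear[OF w]) (use Cons.prems ps b step in auto)
      ultimately show ?case using step b
        by (simp add: vec.subspace_add[OF S] vec.subspace_scale[OF S])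
    qed
    then show ?case by simp
  qed
  from this[of "[]" xs] show ?thesis using inv_forms_outside[OF w, of xs] by auto
qed

lemma inv_forms_combine:
  assumes "\<omega> \<in> inv_forms S k" "\<eta> \<in> inv_forms S k"
  shows "(\<lambda>xs. c * \<omega> xs + d * \<eta> xs) \<in> inv_forms S k"
proof (rule inv_formsI)
  fix ps qs :: "(complex ^ 'a) list" and x y :: "complex ^ 'a" and e
  assume *: "length ps + length qs + 1 = k" "set ps \<subseteq> S" "set qs \<subseteq> S" "x \<in> S" "y \<in> S"
  show "c * \<omega> (ps @ (e *s x + y) # qs) + d * \<eta> (ps @ (e *s x + y) # qs) =
     e * (c * \<omega> (ps @ x # qs) + d * \<eta> (ps @ x # qs)) + (c * \<omega> (ps @ y # qs) + d * \<eta> (ps @ y # qs))"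
    unfolding inv_forms_linear[OF assms(1) *] inv_forms_linear[OF assms(2) *] by (simp only: algebra_simps)
qed (auto simp: inv_forms_outside[OF assms(1)] inv_forms_outside[OF assms(2)]
        inv_forms_not_distinct[OF assms(1)] inv_forms_not_distinct[OF assms(2)])

lemma inv_forms_eqI:
  assumes "vec.subspace S" "\<omega> \<in> inv_forms S k" "\<eta> \<in> inv_forms S k"
    and "length bs = k" "set bs \<subseteq> S" "S \<subseteq> vec.span (set bs)" "\<omega> bs = \<eta> bs"
  shows "\<omega> = \<eta>"
proof
  fix xs
  have "1 * \<omega> xs + (- 1) * \<eta> xs = 0"
    by (rule inv_forms_eq_0[OF assms(1) inv_forms_combine[OF assms(2,3)] assms(4,5), where T = "{}"])
       (use assms in auto)
  then show "\<omega> xs = \<eta> xs" by simp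
qed

text \<open>A basis padded with zeros is a spanning list on which every form vanishes.\<close>

lemma inv_forms_degree_exceeds_dim:
  assumes S: "vec.subspace S" and "\<omega> \<in> inv_forms S k" "vec.dim S < k"
  shows "\<omega> xs = 0"
proof -
  obtain B where B: "B \<subseteq> S" "vec.independent B" "S \<subseteq> vec.span B" "card B = vec.dim S"
    using vec.basis_exists by blast
  obtain bs where bs: "set bs = B" "distinct bs"
    using finite_distinct_list vec.finiteI_independent[OF B(2)] by blast
  \<comment> \<open>The padding is nonempty, so a zero entry occurs.\<close>
  let ?bs = "replicate (k - vec.dim S) 0 @ bs"
  have len: "length bs = vec.dim S" using bs B(4) distinct_card by metis
  show ?thesis
  proof (rule inv_forms_eq_0[OF assms(1,2), where T = "{}" and bs = ?bs])
    show "\<omega> ?bs = 0"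
      by (rule inv_forms_zero_entry[OF assms(2)]) (use assms(3) in auto)
    show "S \<subseteq> vec.span (set ?bs \<union> {})"
      using B(3) bs(1) vec.span_mono[of B "set ?bs"] by auto
  qed (use len assms(3) B(1) bs(1) vec.subspace_0[OF S] in auto)
qed

lemma inv_forms_partial_eval:
  assumes "\<omega> \<in> inv_forms S (length as + k)" "T \<subseteq> S" "vec.subspace T"
  shows "restrict_form T (\<lambda>xs. \<omega> (as @ xs)) \<in> inv_forms T k"
proof (cases "set as \<subseteq> S")
  case True
  show ?thesis
  proof (rule inv_formsI)
    fix ps qs :: "(complex ^ 'a) list" and x y :: "complex ^ 'a" and e
    assume *: "length ps + length qs + 1 = k" "set ps \<subseteq> T" "set qs \<subseteq> T" "x \<in> T" "y \<in> T"
    then have 1: "\<omega> ((as @ ps) @ (e *s x + y) # qs) = e * \<omega> ((as @ ps) @ x # qs) + \<omega> ((as @ ps) @ y # qs)"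
      by (intro inv_forms_linear[OF assms(1)]) (use True assms(2) in auto)
    show "restrict_form T (\<lambda>xs. \<omega> (as @ xs)) (ps @ (e *s x + y) # qs) =
       e * restrict_form T (\<lambda>xs. \<omega> (as @ xs)) (ps @ x # qs) + restrict_form T (\<lambda>xs. \<omega> (as @ xs)) (ps @ y # qs)"
      using 1 * by (simp add: restrict_form_def vec.subspace_add[OF assms(3)] vec.subspace_scale[OF assms(3)])
  qed (auto simp: restrict_form_def inv_forms_outside[OF assms(1)] inv_forms_not_distinct[OF assms(1)])
next
  case False
  then have "restrict_form T (\<lambda>xs. \<omega> (as @ xs)) = (\<lambda>xs. 0)"
    by (auto simp: restrict_form_def fun_eq_iff inv_forms_outside[OF assms(1)])
  then show ?thesis by (simp add: inv_forms_def)
qed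

section \<open>The wedge product with the differential of a function\<close>

lemma remove_nth_update:
  assumes "i \<noteq> j" "j < length xs" "i < length xs"
  shows "take i (xs[j := z]) @ drop (Suc i) (xs[j := z]) =
    (take i xs @ drop (Suc i) xs)[(if j < i then j else j - 1) := z]"
  using assms by (intro nth_equalityI) (auto simp: nth_append nth_list_update min_def)

text \<open>For a repeated entry all terms of the alternating sum vanish except the two that remove one of the
  copies, and these cancel because the remaining copy is moved past the entries in between.\<close>

lemma wedge_form_in_inv_forms:
  assumes S: "vec.subspace S" and \<eta>: "\<eta> \<in> inv_forms S k"
    and f: "\<And>x y c. x \<in> S \<Longrightarrow> y \<in> S \<Longrightarrow> pairing (c *s x + y) f = c * pairing x f + pairing y f"
  shows "wedge_form S f \<eta> \<in> inv_forms S (Suc k)"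
proof (rule inv_formsI)
  fix ps qs :: "(complex ^ 'a) list" and x y :: "complex ^ 'a" and c
  assume *: "length ps + length qs + 1 = Suc k" "set ps \<subseteq> S" "set qs \<subseteq> S" "x \<in> S" "y \<in> S"
  define xs where "xs = ps @ x # qs"
  define j where "j = length ps"
  have xs: "length xs = Suc k" "set xs \<subseteq> S" "j < Suc k" "xs ! j = x" using * by (auto simp: xs_def j_def)
  have upd: "ps @ z # qs = xs[j := z]" for z by (simp add: xs_def j_def list_update_append)
  define g where "g z i = (-1) ^ i * pairing (xs[j := z] ! i) f * \<eta> (take i (xs[j := z]) @ drop (Suc i) (xs[j := z]))" for z i
  have w: "wedge_form S f \<eta> (ps @ z # qs) = (\<Sum>i<Suc k. g z i)" if "z \<in> S" for z
    using that * unfolding wedge_form_def restrict_form_def upd g_def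
    by (simp add: xs(1)) (metis insert_subset order_trans set_update_subset_insert xs(2))
  have "g (c *s x + y) i = c * g x i + g y i" if i: "i < Suc k" for i
  proof (cases "i = j")
    case True
    have fl: "pairing (c *s x + y) f = c * pairing x f + pairing y f" by (rule f) (use * in auto)
    show ?thesis using True i xs(1) by (simp add: g_def fl) (simp only: algebra_simps)
  next
    case False
    define rs where "rs = take i xs @ drop (Suc i) xs"
    define l where "l = (if j < i then j else j - 1)"
    have rs: "length rs = k" using i xs(1) by (simp add: rs_def)
    have "set rs \<subseteq> set xs"
      unfolding rs_def using set_take_subset[of i xs] set_drop_subset[of "Suc i" xs] by auto
    then have rs': "set rs \<subseteq> S" using xs(2) by blast
    have l: "l < k" using False i xs(3) by (auto simp: l_def)
    have 1: "take i (xs[j := z]) @ drop (Suc i) (xs[j := z]) = take l rs @ z # drop (Suc l) rs" for z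
    proof -
      have "take i (xs[j := z]) @ drop (Suc i) (xs[j := z]) = rs[l := z]"
        unfolding rs_def l_def by (rule remove_nth_update) (use False i xs in auto)
      then show ?thesis using l rs by (simp only: upd_conv_take_nth_drop)
    qed
    have 2: "\<eta> (take l rs @ (c *s x + y) # drop (Suc l) rs) =
      c * \<eta> (take l rs @ x # drop (Suc l) rs) + \<eta> (take l rs @ y # drop (Suc l) rs)"
      by (rule inv_forms_linear[OF \<eta>])
         (use * l rs rs' set_take_subset[of l rs] set_drop_subset[of "Suc l" rs] in auto)
    show ?thesis using False unfolding g_def 1 2 by (simp add: algebra_simps)
  qed
  then have "(\<Sum>i<Suc k. g (c *s x + y) i) = (\<Sum>i<Suc k. c * g x i + g y i)" by (intro sum.cong) auto
  moreover have "c *s x + y \<in> S" using * S by (simp add: vec.subspace_add vec.subspace_scale)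
  ultimately show "wedge_form S f \<eta> (ps @ (c *s x + y) # qs) =
      c * wedge_form S f \<eta> (ps @ x # qs) + wedge_form S f \<eta> (ps @ y # qs)"
    using * by (simp only: w) (simp only: sum.distrib sum_distrib_left)
next
  fix ps qs rs :: "(complex ^ 'a) list" and x
  define xs where "xs = ps @ x # qs @ x # rs"
  define p q where "p = length ps" and "q = length ps + Suc (length qs)"
  define g where "g i = (-1) ^ i * pairing (xs ! i) f * \<eta> (take i xs @ drop (Suc i) xs)" for i
  have pq: "p < q" "q < length xs" "xs ! p = x" "xs ! q = x"
    by (auto simp: p_def q_def xs_def nth_append)
  have 0: "g i = 0" if "i < length xs" "i \<noteq> p" "i \<noteq> q" for i
  proof -
    define ys where "ys = take i xs @ drop (Suc i) xs"
    define p' q' where "p' = (if p < i then p else p - 1)" and "q' = (if q < i then q else q - 1)"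
    have "p' < length ys" "q' < length ys" "p' \<noteq> q'"
      using that pq by (auto simp: p'_def q'_def ys_def)
    moreover have "ys ! p' = x" "ys ! q' = x"
      using that pq by (auto simp: p'_def q'_def ys_def nth_append min_def)
    ultimately have "\<not> distinct ys" by (metis nth_eq_iff_index_eq)
    then show ?thesis using inv_forms_not_distinct[OF \<eta>] by (simp add: g_def ys_def)
  qed
  have "(\<Sum>i<length xs. g i) = (\<Sum>i\<in>{p, q}. g i)"
    by (rule sum.mono_neutral_right) (use pq 0 in auto)
  also have "\<dots> = g p + g q" using pq(1) by simp
  also have "g p = (-1) ^ p * pairing x f * \<eta> (ps @ qs @ x # rs)"
    unfolding g_def by (simp add: pq) (simp add: xs_def p_def)
  also have "g q = (-1) ^ q * pairing x f * \<eta> (ps @ x # qs @ rs)"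
    unfolding g_def by (simp add: pq) (simp add: xs_def q_def)
  also have "\<eta> (ps @ x # qs @ rs) = (-1) ^ length qs * \<eta> (ps @ qs @ x # rs)"
    by (rule inv_forms_move[OF S \<eta>])
  finally have "(\<Sum>i<length xs. g i) = 0" by (simp add: p_def q_def power_add)
  then show "wedge_form S f \<eta> (ps @ x # qs @ x # rs) = 0"
    by (simp add: wedge_form_def restrict_form_def flip: xs_def) (simp add: g_def)
next
  fix xs :: "(complex ^ 'a) list"
  assume "length xs \<noteq> Suc k"
  then have "\<eta> (take i xs @ drop (Suc i) xs) = 0" if "i < length xs" for i
    using that by (intro inv_forms_outside[OF \<eta>]) auto
  then show "wedge_form S f \<eta> xs = 0" by (simp add: wedge_form_def restrict_form_def)
qed (simp add: wedge_form_def restrict_form_def)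

section \<open>Gram determinants and dual frames\<close>

definition dot :: "complex ^ 'n \<Rightarrow> complex ^ 'n \<Rightarrow> complex" where
  "dot y x = (\<Sum>i\<in>UNIV. y $ i * x $ i)"

lemma dot_commute: "dot x y = dot y x"
  by (simp add: dot_def mult.commute)

lemma dot_linear: "dot (c *s x + y) z = c * dot x z + dot y z"
  "dot z (c *s x + y) = c * dot z x + dot z y"
  by (simp_all add: dot_def sum.distrib sum_distrib_left algebra_simps)

text \<open>The determinant of the pairings supplies forms with prescribed nonzero values. Lists of different
  lengths get the value 0 so that \<open>gram\<close> is a form in each argument.\<close>

definition gram :: "(complex ^ 'n) list \<Rightarrow> (complex ^ 'n) list \<Rightarrow> complex" where
  "gram zs bs = (if length zs = length bs
     then det (mat (length zs) (length zs) (\<lambda>(i, j). dot (zs ! i) (bs ! j))) else 0)"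

lemma gram_commute: "gram zs bs = gram bs zs"
proof (cases "length zs = length bs")
  case True
  let ?A = "mat (length zs) (length zs) (\<lambda>(i, j). dot (zs ! i) (bs ! j))"
  have "mat (length bs) (length bs) (\<lambda>(i, j). dot (bs ! i) (zs ! j)) = transpose_mat ?A"
    by (rule eq_matI) (use True in \<open>auto simp: dot_commute\<close>)
  then show ?thesis using det_transpose[of ?A "length zs"] True by (simp add: gram_def)
qed (simp add: gram_def)

lemma gram_in_inv_forms: "(\<lambda>zs. gram zs bs) \<in> inv_forms UNIV (length bs)"
proof (rule inv_formsI)
  fix ps qs :: "(complex ^ 'a) list" and x y :: "complex ^ 'a" and c
  assume len: "length ps + length qs + 1 = length bs"
  define n where "n = length bs"
  define p where "p = length ps"
  define M where "M z = mat n n (\<lambda>(i, j). dot ((ps @ z # qs) ! i) (bs ! j))" for z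
  have p: "p < n" using len by (simp add: p_def n_def)
  have cof: "cofactor (M z) p j = cofactor (M x) p j" if "j < n" for z j
  proof -
    have "mat_delete (M z) p j = mat_delete (M x) p j"
      unfolding mat_delete_def
      by (rule eq_matI) (auto simp: M_def p_def n_def nth_append nth_Cons split: nat.splits)
    then show ?thesis by (simp add: cofactor_def)
  qed
  have d: "gram (ps @ z # qs) bs = (\<Sum>j<n. dot z (bs ! j) * cofactor (M x) p j)" for z
  proof -
    have "gram (ps @ z # qs) bs = det (M z)" using len by (simp add: gram_def M_def n_def)
    also have "\<dots> = (\<Sum>j<n. M z $$ (p, j) * cofactor (M z) p j)"
      by (rule laplace_expansion_row) (use p in \<open>auto simp: M_def\<close>)
    also have "\<dots> = (\<Sum>j<n. dot z (bs ! j) * cofactor (M x) p j)"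
    proof (rule sum.cong)
      fix j assume "j \<in> {..<n}"
      moreover have "(ps @ z # qs) ! p = z" by (simp add: p_def)
      ultimately show "M z $$ (p, j) * cofactor (M z) p j = dot z (bs ! j) * cofactor (M x) p j"
        using p cof[of j z] by (simp add: M_def)
    qed simp
    finally show ?thesis .
  qed
  show "gram (ps @ (c *s x + y) # qs) bs = c * gram (ps @ x # qs) bs + gram (ps @ y # qs) bs"
    unfolding d dot_linear by (simp add: sum.distrib sum_distrib_left algebra_simps)
next
  fix ps qs rs :: "(complex ^ 'a) list" and x
  let ?zs = "ps @ x # qs @ x # rs"
  let ?n = "length ?zs"
  let ?A = "mat ?n ?n (\<lambda>(i, j). dot (?zs ! i) (bs ! j))"
  have "det ?A = 0"
    by (rule det_identical_rows[of _ ?n "length ps" "length ps + Suc (length qs)"])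
       (auto simp: nth_append intro!: eq_vecI)
  then show "gram ?zs bs = 0" unfolding gram_def by (simp only: if_cancel)
qed (auto simp: gram_def)

lemma gram_Cons:
  assumes "\<forall>b\<in>set bs. dot y b = 0"
  shows "gram (y # zs) (a # bs) = dot y a * gram zs bs"
proof (cases "length zs = length bs")
  case True
  let ?n = "Suc (length bs)"
  let ?A = "mat ?n ?n (\<lambda>(i, j). dot ((y # zs) ! i) ((a # bs) ! j))"
  have "det ?A = (\<Sum>j<?n. ?A $$ (0, j) * cofactor ?A 0 j)"
    by (rule laplace_expansion_row) auto
  also have "\<dots> = (\<Sum>j\<in>{0}. ?A $$ (0, j) * cofactor ?A 0 j)"
    by (rule sum.mono_neutral_right) (use assms in auto)
  also have "\<dots> = dot y a * det (mat_delete ?A 0 0)" by (simp add: cofactor_def)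
  also have "mat_delete ?A 0 0 = mat (length bs) (length bs) (\<lambda>(i, j). dot (zs ! i) (bs ! j))"
    unfolding mat_delete_def by (rule eq_matI) auto
  finally show ?thesis using True by (simp add: gram_def)
qed (simp add: gram_def)

text \<open>The covector \<open>d b\<close> reads off the coordinate of a vector at \<open>b\<close>.\<close>

lemma dual_basis_exists:
  fixes B :: "(complex ^ 'n::finite) set"
  assumes B: "vec.independent B" "vec.span B = UNIV"
  shows "\<exists>d. \<forall>b\<in>B. \<forall>b'\<in>B. dot (d b) b' = (if b = b' then 1 else 0)"
proof -
  define d where "d b = (\<chi> i. vec.representation B (axis i 1) b)" for b
  have "dot (d b) x = vec.representation B x b" for b x
  proof -
    have "vec.representation B x b = vec.representation B (\<Sum>i\<in>UNIV. x $ i *s axis i 1) b"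
      by (simp only: basis_expansion)
    also have "\<dots> = (\<Sum>i\<in>UNIV. vec.representation B (x $ i *s axis i 1) b)"
      by (rule fun_cong[OF vec.representation_sum[OF B(1)], THEN trans]) (use B in auto)
    also have "\<dots> = (\<Sum>i\<in>UNIV. x $ i * vec.representation B (axis i 1) b)"
      using B by (intro sum.cong) (auto simp: vec.representation_scale)
    finally show ?thesis by (simp add: dot_def d_def mult.commute)
  qed
  then show ?thesis using B(1) by (intro exI[of _ d]) (auto simp: vec.representation_basis)
qed

lemma orth_iff: "y \<in> orth S \<longleftrightarrow> (\<forall>x\<in>S. dot y x = 0)"
  by (simp add: orth_def dot_def)

lemma dot_zero [simp]: "dot 0 x = 0" "dot x 0 = 0"
  by (simp_all add: dot_def)

lemma dot_add: "dot (x + y) z = dot x z + dot y z" "dot z (x + y) = dot z x + dot z y"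
  by (simp_all add: dot_def distrib_left distrib_right sum.distrib)

lemma dot_scale: "dot (c *s x) z = c * dot x z" "dot z (c *s x) = c * dot z x"
  by (simp_all add: dot_def sum_distrib_left mult_ac)

lemma subspace_orth: "vec.subspace (orth S)"
  by (rule vec.subspaceI) (auto simp: orth_iff dot_add dot_scale)

lemma dot_sum: "dot (sum f A) z = (\<Sum>a\<in>A. dot (f a) z)"
  by (induction A rule: infinite_finite_induct) (simp_all add: dot_add)

lemma dot_diff: "dot (x - y) z = dot x z - dot y z"
  using dot_add(1)[of "x - y" y z] by simp

lemma orth_span:
  assumes "\<forall>b\<in>B. dot y b = 0" "x \<in> vec.span B"
  shows "dot y x = 0"
  using assms(2) by (induction rule: vec.span_induct_alt) (use assms(1) in \<open>auto simp: dot_linear\<close>)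

lemma dot_nondegenerate:
  assumes "\<And>x. dot y x = 0"
  shows "y = (0 :: complex ^ 'n::finite)"
proof -
  have "y $ i = 0" for i
    using assms[of "axis i 1"] by (simp add: dot_def axis_def if_distrib cong: if_cong)
  then show ?thesis by (simp add: Finite_Cartesian_Product.vec_eq_iff)
qed

text \<open>A frame is a basis of the subspace together with covectors on the whole space dual to it; the covectors are
  determined only modulo the orthogonal space.\<close>

definition frame :: "(complex ^ 'n::finite) set \<Rightarrow> (complex ^ 'n) list \<Rightarrow> (complex ^ 'n) list \<Rightarrow> bool" where
  "frame S bs zs \<longleftrightarrow> length bs = vec.dim S \<and> length zs = vec.dim S \<and> set bs \<subseteq> S \<and> S \<subseteq> vec.span (set bs) \<and>
     (\<forall>i<vec.dim S. \<forall>j<vec.dim S. dot (zs ! i) (bs ! j) = (if i = j then 1 else 0))"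

lemma frame_exists:
  fixes S :: "(complex ^ 'n::finite) set"
  shows "\<exists>bs zs. frame S bs zs"
proof -
  obtain B where B: "B \<subseteq> S" "vec.independent B" "S \<subseteq> vec.span B" "card B = vec.dim S"
    using vec.basis_exists by blast
  obtain bs where bs: "set bs = B" "distinct bs"
    using finite_distinct_list vec.finiteI_independent[OF B(2)] by blast
  have len: "length bs = vec.dim S" using bs B(4) distinct_card by metis
  obtain B' where B': "B \<subseteq> B'" "vec.independent B'" "UNIV \<subseteq> vec.span B'"
    by (rule vec.maximal_independent_subset_extend[OF subset_UNIV B(2)])
  obtain d where d: "\<forall>b\<in>B'. \<forall>b'\<in>B'. dot (d b) b' = (if b = b' then 1 else 0)"
    using dual_basis_exists[OF B'(2)] B'(3) by blast
  have "frame S bs (map d bs)"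
    unfolding frame_def using len bs B B' d nth_mem[of _ bs]
    by (auto simp: nth_eq_iff_index_eq subset_iff)
  then show ?thesis by blast
qed

lemma gram_frame:
  assumes "frame S bs zs"
  shows "gram zs bs = 1"
proof -
  have "mat (length zs) (length zs) (\<lambda>(i, j). dot (zs ! i) (bs ! j)) = 1\<^sub>m (length zs)"
    by (rule eq_matI) (use assms in \<open>auto simp: frame_def\<close>)
  then show ?thesis using assms by (simp add: gram_def frame_def)
qed

text \<open>Subtracting from a covector the combination of the \<open>zs\<close> with the same values on the basis
  leaves a covector that vanishes on \<open>S\<close>.\<close>

lemma span_frame_orth:
  assumes "frame S bs zs"
  shows "vec.span (set zs \<union> orth S) = UNIV"
proof -
  have "y \<in> vec.span (set zs \<union> orth S)" for y
  proof -
    define w where "w = (\<Sum>i<vec.dim S. dot y (bs ! i) *s zs ! i)"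
    have "dot (y - w) b = 0" if b: "b \<in> set bs" for b
    proof -
      obtain j where j: "j < vec.dim S" "b = bs ! j"
        using b assms by (auto simp: in_set_conv_nth frame_def)
      have "dot w b = (\<Sum>i<vec.dim S. if i = j then dot y (bs ! i) else 0)"
        unfolding w_def dot_sum
        by (rule sum.cong) (use assms j in \<open>auto simp: frame_def dot_scale\<close>)
      then show ?thesis using j by (simp add: dot_diff)
    qed
    then have "y - w \<in> orth S"
      using assms orth_span[of "set bs"] by (auto simp: orth_iff frame_def)
    moreover have "w \<in> vec.span (set zs)"
      unfolding w_def using assms
      by (intro vec.span_sum vec.span_scale vec.span_base) (auto simp: frame_def)
    ultimately have "(y - w) + w \<in> vec.span (set zs \<union> orth S)"
      by (meson Un_upper1 Un_upper2 vec.span_add vec.span_base vec.span_mono subsetD)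
    then show ?thesis by simp
  qed
  then show ?thesis by blast
qed

text \<open>One inequality holds because the covectors of a frame and \<open>orth S\<close> span everything. For the other, extend a basis
  of \<open>S\<close> to the whole space: elements of \<open>orth S\<close> are combinations of the dual covectors of the added
  vectors.\<close>

lemma dim_orth:
  fixes S :: "(complex ^ 'n::finite) set"
  assumes "vec.subspace S"
  shows "vec.dim (orth S) + vec.dim S = CARD('n)"
proof (rule antisym)
  obtain bs zs where fr: "frame S bs zs" using frame_exists by blast
  obtain E where E: "E \<subseteq> orth S" "vec.independent E" "orth S \<subseteq> vec.span E" "card E = vec.dim (orth S)"
    using vec.basis_exists by blast
  have "set zs \<union> orth S \<subseteq> vec.span (set zs \<union> E)"
    using E(3) vec.span_mono[of E "set zs \<union> E"] vec.span_superset[of "set zs \<union> E"] by blast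
  then have "UNIV \<subseteq> vec.span (set zs \<union> E)"
    using vec.span_mono vec.span_span span_frame_orth[OF fr] by metis
  then have "CARD('n) \<le> card (set zs \<union> E)"
    using vec.dim_le_card[of UNIV "set zs \<union> E"] vec.finiteI_independent[OF E(2)] by (simp add: vec_dim_card del: vec.dim_UNIV)
  also have "\<dots> \<le> length zs + vec.dim (orth S)"
    using card_Un_le[of "set zs" E] card_length[of zs] E(4) by linarith
  finally show "CARD('n) \<le> vec.dim (orth S) + vec.dim S" using fr by (simp add: frame_def)
next
  obtain B where B: "B \<subseteq> S" "vec.independent B" "S \<subseteq> vec.span B" "card B = vec.dim S"
    using vec.basis_exists by blast
  obtain B' where B': "B \<subseteq> B'" "vec.independent B'" "UNIV \<subseteq> vec.span B'"
    by (rule vec.maximal_independent_subset_extend[OF subset_UNIV B(2)])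
  have fin: "finite B'" by (rule vec.finiteI_independent[OF B'(2)])
  have card: "card B' = CARD('n)"
    using vec.basis_card_eq_dim[of B' UNIV] B' by (simp add: vec_dim_card del: vec.dim_UNIV)
  obtain d where d: "\<forall>b\<in>B'. \<forall>b'\<in>B'. dot (d b) b' = (if b = b' then 1 else 0)"
    using dual_basis_exists[OF B'(2)] B'(3) by blast
  have "y \<in> vec.span (d ` (B' - B))" if y: "y \<in> orth S" for y
  proof -
    define w where "w = (\<Sum>b\<in>B'. dot y b *s d b)"
    have "dot (y - w) b = 0" if b: "b \<in> B'" for b
    proof -
      have "dot w b = (\<Sum>b'\<in>B'. if b' = b then dot y b' else 0)"
        unfolding w_def dot_sum by (rule sum.cong) (use b d in \<open>auto simp: dot_scale\<close>)
      then show ?thesis using b fin by (simp add: dot_diff)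
    qed
    then have "dot (y - w) x = 0" for x
      using orth_span[of B' "y - w" x] B'(3) by blast
    then have "y = w" using dot_nondegenerate[of "y - w"] by simp
    also have "w = (\<Sum>b\<in>B' - B. dot y b *s d b)"
      unfolding w_def
      by (rule sum.mono_neutral_right) (use fin y B(1) in \<open>auto simp: orth_iff\<close>)
    also have "\<dots> \<in> vec.span (d ` (B' - B))"
      by (intro vec.span_sum vec.span_scale vec.span_base) auto
    finally show ?thesis .
  qed
  then have "vec.dim (orth S) \<le> card (d ` (B' - B))"
    by (intro vec.dim_le_card) (use fin in auto)
  also have "\<dots> \<le> card B' - card B"
    using card_image_le[of "B' - B" d] fin B'(1) by (simp add: card_Diff_subset finite_subset)
  finally show "vec.dim (orth S) + vec.dim S \<le> CARD('n)"
    using card B(4) card_mono[OF fin B'(1)] by linarith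
qed

lemma orth_orth:
  fixes S :: "(complex ^ 'n::finite) set"
  assumes "vec.subspace S"
  shows "orth (orth S) = S"
proof (rule sym, rule vec.subspace_dim_equal[OF assms subspace_orth])
  show "S \<subseteq> orth (orth S)" by (auto simp: orth_iff) (metis dot_commute)
  show "vec.dim S \<ge> vec.dim (orth (orth S))"
    using dim_orth[OF assms] dim_orth[OF subspace_orth, of S] by linarith
qed

lemma orth_mono: "S \<subseteq> T \<Longrightarrow> orth T \<subseteq> orth S"
  unfolding orth_def by blast

lemma covers_orth:
  assumes "vec.subspace (S \<alpha>)" "vec.subspace (S \<beta>)"
  shows "covers (\<lambda>\<gamma>. orth (S \<gamma>)) \<beta> \<alpha> \<longleftrightarrow> covers S \<alpha> \<beta>"
proof -
  have "orth (S \<alpha>) \<subseteq> orth (S \<beta>) \<longleftrightarrow> S \<beta> \<subseteq> S \<alpha>"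
    using orth_mono orth_orth assms by metis
  then show ?thesis using dim_orth[OF assms(1)] dim_orth[OF assms(2)] by (auto simp: covers_def)
qed

lemma parallel_fields_subspace:
  assumes "vec.subspace S"
  shows "parallel_fields S = S"
proof
  show "parallel_fields S \<subseteq> S"
  proof
    fix x assume "x \<in> parallel_fields S"
    then have "0 + 1 *s x \<in> S" using vec.subspace_0[OF assms] unfolding parallel_fields_def by blast
    then show "x \<in> S" by simp
  qed
qed (auto simp: parallel_fields_def vec.subspace_add[OF assms] vec.subspace_scale[OF assms])

lemma span_codim_one:
  assumes "vec.subspace S" "vec.subspace T" "T \<subseteq> S" "vec.dim S = vec.dim T + 1" "a \<in> S" "a \<notin> T"
    "T \<subseteq> vec.span (set bs)"
  shows "S \<subseteq> vec.span (set (a # bs))"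
proof -
  have "a \<notin> vec.span T" by (metis assms(2,6) vec.span_eq_iff)
  then have "vec.dim (insert a T) = vec.dim S" using assms(4) by (simp add: vec.dim_insert)
  then have "vec.span (insert a T) = S"
    using vec.subspace_dim_equal[OF vec.subspace_span assms(1), of "insert a T"]
      vec.span_minimal[of "insert a T" S] assms by auto
  moreover have "insert a T \<subseteq> vec.span (insert a (set bs))"
    using assms(7) vec.span_mono[of "set bs" "insert a (set bs)"] vec.span_base[of a "insert a (set bs)"] by blast
  ultimately show ?thesis using vec.span_minimal[OF _ vec.subspace_span] by (metis list.simps(15))
qed

section \<open>Transition maps as contractions\<close>

lemma basis_list_exists:
  fixes S :: "(complex ^ 'n::finite) set"
  shows "\<exists>bs. length bs = vec.dim S \<and> set bs \<subseteq> S \<and> S \<subseteq> vec.span (set bs)"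
  using frame_exists[of S] by (auto simp: frame_def)

lemma contract_in_top_forms:
  fixes S T :: "(complex ^ 'n::finite) set"
  assumes "vec.subspace T" "T \<subseteq> S" "vec.dim S = vec.dim T + 1" "\<omega> \<in> top_forms S"
  shows "restrict_form T (contract_form a \<omega>) \<in> top_forms T"
  using inv_forms_partial_eval[of \<omega> S "[a]" "vec.dim T" T] assms
  by (simp add: top_forms_def contract_form_def[abs_def])

lemma form_scale_in_inv_forms: "\<omega> \<in> inv_forms S k \<Longrightarrow> (\<lambda>xs. c * \<omega> xs) \<in> inv_forms S k"
  using inv_forms_combine[of \<omega> S k \<omega> c 0] by simp

text \<open>This is \<open>i\<^sub>a (df \<and> \<omega>) + df \<and> i\<^sub>a \<omega> = \<langle>a, f\<rangle> \<omega>\<close>, where \<open>df \<and> \<omega> = 0\<close> as its degree exceeds the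
  dimension. Evaluating \<open>df \<and> \<omega>\<close> at \<open>a # xs\<close> and separating the first term gives the identity.\<close>

lemma wedge_contract_top_form:
  fixes S :: "(complex ^ 'n::finite) set"
  assumes S: "vec.subspace S" and \<omega>: "\<omega> \<in> top_forms S" and a: "a \<in> S"
    and f: "\<And>x y c. x \<in> S \<Longrightarrow> y \<in> S \<Longrightarrow> pairing (c *s x + y) f = c * pairing x f + pairing y f"
  shows "wedge_form S f (restrict_form S (contract_form a \<omega>)) = (\<lambda>xs. pairing a f * \<omega> xs)"
proof
  fix xs
  have \<omega>': "\<omega> \<in> inv_forms S (vec.dim S)" using \<omega> by (simp add: top_forms_def)
  show "wedge_form S f (restrict_form S (contract_form a \<omega>)) xs = pairing a f * \<omega> xs"
  proof (cases "set xs \<subseteq> S")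
    case False
    then show ?thesis using inv_forms_outside[OF \<omega>'] by (simp add: wedge_form_def restrict_form_def)
  next
    case True
    have "wedge_form S f \<omega> (a # xs) = 0"
      by (rule inv_forms_degree_exceeds_dim[OF S wedge_form_in_inv_forms[OF S \<omega>' f]]) auto
    moreover have "wedge_form S f \<omega> (a # xs) = pairing a f * \<omega> xs
        - (\<Sum>i<length xs. (- 1) ^ i * pairing (xs ! i) f * \<omega> (a # take i xs @ drop (Suc i) xs))"
      using True a by (simp add: wedge_form_def restrict_form_def sum.lessThan_Suc_shift sum_negf
          del: sum.lessThan_Suc)
    moreover have "set (take i xs) \<subseteq> S" "set (drop (Suc i) xs) \<subseteq> S" for i
      using True by (meson order_trans set_take_subset set_drop_subset)+
    ultimately show ?thesis using True
      by (simp add: wedge_form_def restrict_form_def contract_form_def)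
  qed
qed

text \<open>From a stratum to a hyperplane in it, the map \<open>\<pi>\<close> is contraction with any vector
  \<open>a\<close> off the hyperplane, divided by \<open>\<langle>a, f\<rangle>\<close>. The product \<open>\<langle>a, f\<rangle> \<pi>\<close> is what occurs in the
  relations, and it does not depend on \<open>f\<close>.\<close>

lemma transition_down:
  fixes S :: "'i \<Rightarrow> (complex ^ 'n::finite) set"
  assumes S: "vec.subspace (S \<alpha>)" "vec.subspace (S \<beta>)" "covers S \<alpha> \<beta>"
    and f: "\<And>x y c. x \<in> S \<alpha> \<Longrightarrow> y \<in> S \<alpha> \<Longrightarrow> pairing (c *s x + y) (f \<beta> \<alpha>) = c * pairing x (f \<beta> \<alpha>) + pairing y (f \<beta> \<alpha>)"
      "\<And>x. x \<in> S \<beta> \<Longrightarrow> pairing x (f \<beta> \<alpha>) = 0"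
    and a: "a \<in> S \<alpha>" "pairing a (f \<beta> \<alpha>) \<noteq> 0"
    and \<omega>: "\<omega> \<in> top_forms (S \<alpha>)"
  shows "(\<lambda>xs. pairing a (f \<beta> \<alpha>) * transition S f \<xi> \<beta> \<alpha> \<omega> xs) = restrict_form (S \<beta>) (contract_form a \<omega>)"
    and "transition S f \<xi> \<beta> \<alpha> \<omega> \<in> top_forms (S \<beta>)"
proof -
  let ?f = "f \<beta> \<alpha>" and ?d = "vec.dim (S \<beta>)"
  have sub: "S \<beta> \<subseteq> S \<alpha>" "vec.dim (S \<alpha>) = ?d + 1" using S(3) by (auto simp: covers_def)
  define P where "P \<omega>' \<longleftrightarrow> \<omega>' \<in> top_forms (S \<beta>) \<and>
           (\<exists>\<eta>\<in>inv_forms (S \<alpha>) ?d.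
              restrict_form (S \<beta>) \<eta> = \<omega>' \<and> wedge_form (S \<alpha>) ?f \<eta> = \<omega>)" for \<omega>'
  \<comment> \<open>An extension of \<open>\<mu>\<close> to a form on \<open>S \<alpha>\<close> is the contraction before restriction.\<close>
  define \<mu> where "\<mu> = (\<lambda>xs. inverse (pairing a ?f) * restrict_form (S \<beta>) (contract_form a \<omega>) xs)"
  define \<eta>0 where "\<eta>0 = restrict_form (S \<alpha>) (contract_form a \<omega>)"
  have \<eta>0: "\<eta>0 \<in> inv_forms (S \<alpha>) ?d"
    using inv_forms_partial_eval[of \<omega> "S \<alpha>" "[a]" ?d "S \<alpha>"] \<omega> sub S
    by (simp add: \<eta>0_def top_forms_def contract_form_def[abs_def])
  have \<mu>_top: "\<mu> \<in> top_forms (S \<beta>)"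
    unfolding \<mu>_def using contract_in_top_forms[OF S(2) sub \<omega>, of a]
    by (simp add: top_forms_def form_scale_in_inv_forms)
  have "P \<mu>"
    unfolding P_def
  proof (intro conjI bexI[of _ "\<lambda>xs. inverse (pairing a ?f) * \<eta>0 xs"])
    show "restrict_form (S \<beta>) (\<lambda>xs. inverse (pairing a ?f) * \<eta>0 xs) = \<mu>"
      using sub(1) by (auto simp: restrict_form_def \<mu>_def \<eta>0_def fun_eq_iff)
    have "wedge_form (S \<alpha>) ?f (\<lambda>xs. inverse (pairing a ?f) * \<eta>0 xs) xs =
        inverse (pairing a ?f) * wedge_form (S \<alpha>) ?f \<eta>0 xs" for xs
      by (simp add: wedge_form_def restrict_form_def sum_distrib_left mult_ac)
    then show "wedge_form (S \<alpha>) ?f (\<lambda>xs. inverse (pairing a ?f) * \<eta>0 xs) = \<omega>"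
      using wedge_contract_top_form[OF S(1) \<omega> a(1) f(1)] a(2) by (simp add: \<eta>0_def fun_eq_iff)
  qed (fact \<mu>_top, rule form_scale_in_inv_forms[OF \<eta>0])
  moreover have "\<omega>' = \<mu>" if P: "P \<omega>'" for \<omega>'
  proof -
    obtain \<eta> where \<omega>': "\<omega>' \<in> top_forms (S \<beta>)" and \<eta>: "\<eta> \<in> inv_forms (S \<alpha>) ?d"
      "restrict_form (S \<beta>) \<eta> = \<omega>'" "wedge_form (S \<alpha>) ?f \<eta> = \<omega>"
      using P unfolding P_def by blast
    have "\<omega>' xs = \<mu> xs" for xs
    proof (cases "set xs \<subseteq> S \<beta>")
      case True
      have "\<omega> (a # xs) = wedge_form (S \<alpha>) ?f \<eta> (a # xs)" using \<eta> by simp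
      also have "\<dots> = pairing a ?f * \<eta> xs"
        using True sub(1) a(1) nth_mem[of _ xs]
        by (auto simp: wedge_form_def restrict_form_def sum.lessThan_Suc_shift f(2) subset_iff
            simp del: sum.lessThan_Suc)
      finally show ?thesis using True \<eta>(2) a(2)
        by (auto simp: \<mu>_def restrict_form_def contract_form_def)
    next
      case False
      then show ?thesis using \<eta>(2)[symmetric] by (simp add: restrict_form_def \<mu>_def)
    qed
    then show ?thesis by blast
  qed
  ultimately have "(THE \<omega>'. P \<omega>') = \<mu>" by (rule the_equality)
  then have tr: "transition S f \<xi> \<beta> \<alpha> \<omega> = \<mu>"
    using S(3) by (simp add: transition_def P_def)
  show "(\<lambda>xs. pairing a ?f * transition S f \<xi> \<beta> \<alpha> \<omega> xs) = restrict_form (S \<beta>) (contract_form a \<omega>)"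
    unfolding tr \<mu>_def mult.assoc[symmetric] using a(2) by simp
  show "transition S f \<xi> \<beta> \<alpha> \<omega> \<in> top_forms (S \<beta>)" unfolding tr by (rule \<mu>_top)
qed

text \<open>Upwards, the map \<open>\<pi>\<close> is inverse to contraction with \<open>\<xi>\<close>, so it is determined by exhibiting a preimage.\<close>

lemma transition_up:
  fixes S :: "'i \<Rightarrow> (complex ^ 'n::finite) set"
  assumes S: "vec.subspace (S \<alpha>)" "vec.subspace (S \<beta>)" "covers S \<beta> \<alpha>"
    and \<xi>: "\<xi> \<beta> \<alpha> \<in> S \<beta>" "\<xi> \<beta> \<alpha> \<notin> S \<alpha>"
    and \<mu>: "\<mu> \<in> top_forms (S \<beta>)"
  shows "transition S f \<xi> \<beta> \<alpha> (restrict_form (S \<alpha>) (contract_form (\<xi> \<beta> \<alpha>) \<mu>)) = \<mu>"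
proof -
  have sub: "S \<alpha> \<subseteq> S \<beta>" "vec.dim (S \<beta>) = vec.dim (S \<alpha>) + 1" using S(3) by (auto simp: covers_def)
  then have "\<not> covers S \<alpha> \<beta>" by (auto simp: covers_def)
  moreover have "\<omega>' = \<mu>" if "\<omega>' \<in> top_forms (S \<beta>)"
    "restrict_form (S \<alpha>) (contract_form (\<xi> \<beta> \<alpha>) \<omega>') = restrict_form (S \<alpha>) (contract_form (\<xi> \<beta> \<alpha>) \<mu>)" for \<omega>'
  proof -
    obtain bs where bs: "length bs = vec.dim (S \<alpha>)" "set bs \<subseteq> S \<alpha>" "S \<alpha> \<subseteq> vec.span (set bs)"
      using basis_list_exists by blast
    show ?thesis
    proof (rule inv_forms_eqI[OF S(2)])
      show "S \<beta> \<subseteq> vec.span (set (\<xi> \<beta> \<alpha> # bs))"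
        by (rule span_codim_one[OF S(2,1) sub \<xi> bs(3)])
      show "\<omega>' (\<xi> \<beta> \<alpha> # bs) = \<mu> (\<xi> \<beta> \<alpha> # bs)"
        using fun_cong[OF that(2), of bs] bs(2) by (simp add: restrict_form_def contract_form_def)
    qed (use that \<mu> bs sub \<xi> in \<open>auto simp: top_forms_def\<close>)
  qed
  ultimately show ?thesis
    using S(3) \<mu> unfolding transition_def by (auto intro!: the_equality)
qed

lemma top_form_nonzero:
  fixes S :: "(complex ^ 'n::finite) set"
  assumes "vec.subspace S" "frame S bs zs"
  shows "restrict_form S (\<lambda>xs. gram zs xs) \<in> top_forms S"
proof -
  have "(\<lambda>xs. gram xs zs) \<in> inv_forms UNIV (length ([] :: (complex ^ 'n) list) + vec.dim S)"
    using gram_in_inv_forms[of zs] assms(2) by (simp add: frame_def)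
  from inv_forms_partial_eval[OF this _ assms(1)] show ?thesis
    by (simp add: top_forms_def gram_commute)
qed

text \<open>Both spaces of top forms are lines, so it suffices that a nonzero top form remains nonzero on the basis
  \<open>a # bs\<close> of \<open>S\<close>.\<close>

lemma contract_surj:
  fixes S T :: "(complex ^ 'n::finite) set"
  assumes S: "vec.subspace S" "vec.subspace T" "T \<subseteq> S" "vec.dim S = vec.dim T + 1" "a \<in> S" "a \<notin> T"
    and \<omega>: "\<omega> \<in> top_forms T"
  shows "\<exists>\<mu>\<in>top_forms S. restrict_form T (contract_form a \<mu>) = \<omega>"
proof -
  obtain bs where bs: "length bs = vec.dim T" "set bs \<subseteq> T" "T \<subseteq> vec.span (set bs)"
    using basis_list_exists by blast
  obtain cs zs where fr: "frame S cs zs" using frame_exists by blast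
  define \<mu> where "\<mu> = restrict_form S (\<lambda>xs. gram zs xs)"
  have \<mu>: "\<mu> \<in> top_forms S" unfolding \<mu>_def by (rule top_form_nonzero[OF S(1) fr])
  have "\<mu> cs = 1" using fr gram_frame[OF fr] by (simp add: \<mu>_def restrict_form_def frame_def)
  moreover have "\<mu> (a # bs) = 0 \<Longrightarrow> \<mu> cs = 0"
    by (rule inv_forms_eq_0[OF S(1), of \<mu> "vec.dim S" "a # bs" "{}"])
       (use \<mu> bs S span_codim_one[OF S bs(3)] in \<open>auto simp: top_forms_def\<close>)
  ultimately have nz: "\<mu> (a # bs) \<noteq> 0" by auto
  define c where "c = \<omega> bs / \<mu> (a # bs)"
  have c\<mu>: "(\<lambda>xs. c * \<mu> xs) \<in> top_forms S" using \<mu> by (simp add: top_forms_def form_scale_in_inv_forms)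
  have "restrict_form T (contract_form a (\<lambda>xs. c * \<mu> xs)) = \<omega>"
  proof (rule inv_forms_eqI[OF S(2) _ _ bs])
    show "restrict_form T (contract_form a (\<lambda>xs. c * \<mu> xs)) bs = \<omega> bs"
      using bs(2) nz by (simp add: restrict_form_def contract_form_def c_def)
  qed (use contract_in_top_forms[OF S(2-4) c\<mu>, of a] \<omega> in \<open>auto simp: top_forms_def\<close>)
  then show ?thesis using c\<mu> by blast
qed

section \<open>Top forms on a subspace and on its orthogonal space\<close>

lemma top_forms_UNIV_nonzero: "\<exists>\<omega>\<in>top_forms (UNIV :: (complex ^ 'n::finite) set). \<omega> \<noteq> (\<lambda>xs. 0)"
proof -
  obtain bs zs where fr: "frame (UNIV :: (complex ^ 'n) set) bs zs" using frame_exists by blast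
  have "restrict_form UNIV (\<lambda>xs. gram zs xs) bs = 1"
    using gram_frame[OF fr] by (simp add: restrict_form_def)
  then show ?thesis using top_form_nonzero[OF vec.subspace_UNIV fr]
    by (metis zero_neq_one)
qed

text \<open>Rescaling the volume form rescales all the isomorphisms below simultaneously, so any nonzero choice works.\<close>

definition volume :: "(complex ^ 'n::finite) list \<Rightarrow> complex" where
  "volume = (SOME \<omega>. \<omega> \<in> top_forms UNIV \<and> \<omega> \<noteq> (\<lambda>xs. 0))"

lemma volume: "volume \<in> inv_forms (UNIV :: (complex ^ 'n::finite) set) CARD('n)" "volume \<noteq> (\<lambda>xs :: (complex ^ 'n) list. 0)"
proof -
  have "\<exists>\<omega> :: (complex ^ 'n) list \<Rightarrow> complex. \<omega> \<in> top_forms UNIV \<and> \<omega> \<noteq> (\<lambda>xs. 0)"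
    using top_forms_UNIV_nonzero by blast
  from someI_ex[OF this]
  have "(volume :: (complex ^ 'n) list \<Rightarrow> complex) \<in> top_forms UNIV \<and> volume \<noteq> (\<lambda>xs :: (complex ^ 'n) list. 0)"
    unfolding volume_def .
  then show "volume \<in> inv_forms (UNIV :: (complex ^ 'n::finite) set) CARD('n)" "volume \<noteq> (\<lambda>xs :: (complex ^ 'n) list. 0)"
    by (simp_all add: top_forms_def vec_dim_card del: vec.dim_UNIV)
qed

text \<open>The identification of top forms on \<open>S\<close> with top forms on \<open>orth S\<close>. The list \<open>zs\<close> is reversed so that
  passing to a frame with one more vector at the front inserts the new covector next to \<open>ys\<close>, and no sign
  depending on the length of \<open>zs\<close> arises. The power of \<open>- 1\<close> makes every step of codimension one
  change the sign.\<close>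

definition dual_form :: "(complex ^ 'n::finite) set \<Rightarrow> ((complex ^ 'n) list \<Rightarrow> complex) \<Rightarrow> (complex ^ 'n) list \<Rightarrow> complex" where
  "dual_form S \<omega> = (let (bs, zs) = (SOME (bs, zs). frame S bs zs) in
     restrict_form (orth S) (\<lambda>ys. (- 1) ^ vec.dim (orth S) * \<omega> bs * volume (rev zs @ ys)))"

lemma dual_form_frame:
  fixes S :: "(complex ^ 'n::finite) set"
  shows "\<exists>bs zs. frame S bs zs \<and>
    (\<forall>\<omega>. dual_form S \<omega> = restrict_form (orth S) (\<lambda>ys. (- 1) ^ vec.dim (orth S) * \<omega> bs * volume (rev zs @ ys)))"
proof -
  have "\<exists>p. case p of (bs, zs) \<Rightarrow> frame S bs zs" using frame_exists[of S] by auto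
  from someI_ex[OF this] show ?thesis
    by (cases "SOME p. case p of (bs, zs) \<Rightarrow> frame S bs zs") (auto simp: dual_form_def)
qed

lemma dual_form_add: "dual_form S (\<lambda>xs. \<omega> xs + \<omega>' xs) = (\<lambda>ys. dual_form S \<omega> ys + dual_form S \<omega>' ys)"
  using dual_form_frame[of S] by (auto simp: restrict_form_def fun_eq_iff algebra_simps)

lemma dual_form_scale: "dual_form S (\<lambda>xs. c * \<omega> xs) = (\<lambda>ys. c * dual_form S \<omega> ys)"
  using dual_form_frame[of S] by (auto simp: restrict_form_def fun_eq_iff)

lemma dual_form_in_top_forms:
  fixes S :: "(complex ^ 'n::finite) set"
  assumes "vec.subspace S"
  shows "dual_form S \<omega> \<in> top_forms (orth S)"
proof -
  obtain bs zs where fr: "frame S bs zs"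
    and d: "\<And>\<omega>. dual_form S \<omega> = restrict_form (orth S) (\<lambda>ys. (- 1) ^ vec.dim (orth S) * \<omega> bs * volume (rev zs @ ys))"
    using dual_form_frame by blast
  have "restrict_form (orth S) (\<lambda>ys. volume (rev zs @ ys)) \<in> inv_forms (orth S) (vec.dim (orth S))"
    by (rule inv_forms_partial_eval[of _ UNIV])
      (use volume(1) dim_orth[OF assms] fr subspace_orth in \<open>auto simp: frame_def add.commute\<close>)
  from form_scale_in_inv_forms[OF this, of "(- 1) ^ vec.dim (orth S) * \<omega> bs"]
  show ?thesis unfolding d top_forms_def
    by (rule back_subst[where P = "\<lambda>x. x \<in> _"]) (auto simp: restrict_form_def)
qed

lemma volume_rev_in_inv_forms:
  fixes ys :: "(complex ^ 'n::finite) list"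
  assumes "d + length ys = CARD('n)"
  shows "(\<lambda>xs. volume (rev xs @ ys)) \<in> inv_forms UNIV d"
proof (rule inv_formsI)
  fix ps qs :: "(complex ^ 'n) list" and x y c
  assume "length ps + length qs + 1 = d"
  then show "volume (rev (ps @ (c *s x + y) # qs) @ ys) =
      c * volume (rev (ps @ x # qs) @ ys) + volume (rev (ps @ y # qs) @ ys)"
    using inv_forms_linear[OF volume(1), of "rev qs" "rev ps @ ys" x y c] assms by simp
qed (use assms in \<open>auto simp: inv_forms_outside[OF volume(1)] inv_forms_not_distinct[OF volume(1)]\<close>)

text \<open>The entry \<open>x\<close> can be moved next to \<open>ys\<close>, and then \<open>x # ys\<close> are more vectors of \<open>S\<close> than its dimension.\<close>

lemma volume_excess_entry:
  fixes S :: "(complex ^ 'n::finite) set"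
  assumes S: "vec.subspace S" and ys: "set ys \<subseteq> S" "length ys = vec.dim S" and x: "x \<in> set xs" "x \<in> S"
  shows "volume (rev xs @ ys) = 0"
proof (cases "length xs + length ys = CARD('n)")
  case True
  obtain us vs where xs: "xs = us @ x # vs" using x(1) by (meson split_list)
  have "restrict_form S (\<lambda>ws. volume ((rev vs @ rev us) @ ws)) \<in> inv_forms S (Suc (length ys))"
    by (rule inv_forms_partial_eval[of _ UNIV]) (use True volume(1)[where 'n = 'n] xs S in \<open>auto simp: add_ac\<close>)
  from inv_forms_degree_exceeds_dim[OF S this, of "x # ys"]
  have "volume (rev vs @ rev us @ x # ys) = 0" using ys x by (simp add: restrict_form_def)
  then show ?thesis
    using inv_forms_move[OF vec.subspace_UNIV volume(1), of "rev vs" x "rev us" ys] xs by simp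
next
  case False
  then show ?thesis using inv_forms_outside[OF volume(1)[where 'n = 'n], of "rev xs @ ys"] by simp
qed

lemma gram_orthogonal_entry:
  assumes "x \<in> set xs" "\<forall>b\<in>set bs. dot x b = 0"
  shows "gram xs bs = 0"
proof -
  obtain us vs where xs: "xs = us @ x # vs" using assms(1) by (meson split_list)
  have "gram (x # us @ vs) bs = 0"
  proof (cases bs)
    case (Cons b bs')
    then show ?thesis using gram_Cons[of bs' x "us @ vs" b] assms(2) by simp
  qed (simp add: gram_def)
  then show ?thesis
    using inv_forms_move[OF vec.subspace_UNIV gram_in_inv_forms, of "[]" x us vs bs] xs by simp
qed

text \<open>Here \<open>bs\<close> and \<open>zs\<close> are arbitrary lists, so this compares the chosen frame with any other one. As functions of \<open>bs\<close>, both
  \<open>\<omega> bs\<close> and \<open>gram zs bs\<close> are top forms on \<open>S\<close>. As functions of \<open>zs\<close>, both \<open>gram zs bs\<close> and \<open>volume (rev zs @ ys)\<close> are forms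
  on the whole space that vanish when an entry lies in \<open>orth S\<close>. In each case two
  such forms are proportional.\<close>

lemma dual_form_any_frame:
  fixes S :: "(complex ^ 'n::finite) set"
  assumes S: "vec.subspace S" and \<omega>: "\<omega> \<in> top_forms S"
    and bs: "length bs = vec.dim S" "set bs \<subseteq> S" and zs: "length zs = vec.dim S"
    and ys: "length ys = vec.dim (orth S)" "set ys \<subseteq> orth S"
  shows "dual_form S \<omega> ys * gram zs bs = (- 1) ^ vec.dim (orth S) * \<omega> bs * volume (rev zs @ ys)"
proof -
  obtain bs0 zs0 where fr: "frame S bs0 zs0"
    and d: "\<And>\<omega>. dual_form S \<omega> = restrict_form (orth S) (\<lambda>ys. (- 1) ^ vec.dim (orth S) * \<omega> bs0 * volume (rev zs0 @ ys))"
    using dual_form_frame by blast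
  have fr': "length bs0 = vec.dim S" "set bs0 \<subseteq> S" "S \<subseteq> vec.span (set bs0)" "length zs0 = vec.dim S"
    using fr by (auto simp: frame_def)
  have N: "vec.dim S + length ys = CARD('n)" using dim_orth[OF S] ys by simp
  have g1: "gram zs0 bs0 = 1" by (rule gram_frame[OF fr])
  have "(\<lambda>xs. gram xs zs) \<in> inv_forms UNIV (length ([] :: (complex ^ 'n) list) + vec.dim S)"
    using gram_in_inv_forms[of zs] zs by simp
  from inv_forms_partial_eval[OF this _ S]
  have G: "restrict_form S (\<lambda>xs. gram zs xs) \<in> inv_forms S (vec.dim S)" by (simp add: gram_commute)
  have W: "\<omega> \<in> inv_forms S (vec.dim S)" using \<omega> by (simp add: top_forms_def)
  \<comment> \<open>Two top forms on \<open>S\<close>, compared at the basis \<open>bs0\<close>.\<close>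
  have "\<omega> bs0 * restrict_form S (\<lambda>xs. gram zs xs) bs + (- gram zs bs0) * \<omega> bs = 0"
    by (rule inv_forms_eq_0[OF S inv_forms_combine[OF G W], where T = "{}" and bs = bs0])
       (use fr' in \<open>auto simp: restrict_form_def\<close>)
  then have 1: "\<omega> bs0 * gram zs bs = gram zs bs0 * \<omega> bs" using bs by (simp add: restrict_form_def)
  \<comment> \<open>Two forms on the whole space that factor through the quotient by \<open>orth S\<close>, compared at \<open>zs0\<close>, where \<open>gram zs0 bs0 = 1\<close>.\<close>
  have "volume (rev zs0 @ ys) * gram zs bs0 + (- 1) * volume (rev zs @ ys) = 0"
  proof (rule inv_forms_eq_0[OF vec.subspace_UNIV inv_forms_combine[OF _ volume_rev_in_inv_forms[OF N]],
        where T = "orth S" and bs = zs0])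
    show "(\<lambda>xs. gram xs bs0) \<in> inv_forms UNIV (vec.dim S)" using gram_in_inv_forms[of bs0] fr' by simp
    fix xs assume "set xs \<inter> orth S \<noteq> {}"
    then obtain x where x: "x \<in> set xs" "x \<in> orth S" by blast
    have "gram xs bs0 = 0"
      by (rule gram_orthogonal_entry[OF x(1)]) (use x(2) fr' in \<open>auto simp: orth_iff\<close>)
    moreover have "volume (rev xs @ ys) = 0"
      by (rule volume_excess_entry[OF subspace_orth ys(2,1) x])
    ultimately show "volume (rev zs0 @ ys) * gram xs bs0 + (- 1) * volume (rev xs @ ys) = 0" by simp
  qed (use fr' g1 span_frame_orth[OF fr] in auto)
  then have 2: "volume (rev zs0 @ ys) * gram zs bs0 = volume (rev zs @ ys)" by simp
  have "dual_form S \<omega> ys * gram zs bs = (- 1) ^ vec.dim (orth S) * volume (rev zs0 @ ys) * (\<omega> bs0 * gram zs bs)"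
    using ys by (simp add: d restrict_form_def mult_ac)
  also have "\<dots> = (- 1) ^ vec.dim (orth S) * \<omega> bs * (volume (rev zs0 @ ys) * gram zs bs0)"
    unfolding 1 by (simp add: mult_ac)
  finally show ?thesis unfolding 2 .
qed

text \<open>Take a frame \<open>(bs, zs)\<close> of \<open>T\<close> and compute the form on the right with \<open>(a # bs, y # zs)\<close>. The
  determinant of these lists is \<open>dot y a\<close> since \<open>y\<close> vanishes on \<open>T\<close>, and both sides contain the same number
  \<open>volume (rev zs @ y # ys)\<close>.\<close>

lemma dual_form_contract:
  fixes S T :: "(complex ^ 'n::finite) set"
  assumes S: "vec.subspace S" "vec.subspace T" "T \<subseteq> S" "vec.dim S = vec.dim T + 1"
    and a: "a \<in> S" and y: "y \<in> orth T" and nz: "dot y a \<noteq> 0"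
    and \<omega>: "\<omega> \<in> top_forms S"
  shows "restrict_form (orth S) (contract_form y (dual_form T (restrict_form T (contract_form a \<omega>)))) =
    (\<lambda>ys. - dot y a * dual_form S \<omega> ys)"
proof
  fix ys
  have k: "vec.dim (orth T) = vec.dim (orth S) + 1" "orth S \<subseteq> orth T"
    using dim_orth[OF S(1)] dim_orth[OF S(2)] S(4) orth_mono[OF S(3)] by auto
  have top: "restrict_form T (contract_form a \<omega>) \<in> top_forms T"
    by (rule contract_in_top_forms[OF S(2-4) \<omega>])
  show "restrict_form (orth S) (contract_form y (dual_form T (restrict_form T (contract_form a \<omega>)))) ys =
    - dot y a * dual_form S \<omega> ys"
  proof (cases "length ys = vec.dim (orth S) \<and> set ys \<subseteq> orth S")
    case True
    obtain bs zs where fr: "frame T bs zs" using frame_exists by blast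
    then have fr': "length bs = vec.dim T" "set bs \<subseteq> T" "length zs = vec.dim T" by (auto simp: frame_def)
    have g: "gram (y # zs) (a # bs) = dot y a"
      by (subst gram_Cons) (use y fr' gram_frame[OF fr] in \<open>auto simp: orth_iff\<close>)
    have *: "dual_form T (restrict_form T (contract_form a \<omega>)) (y # ys) * gram zs bs =
      (- 1) ^ vec.dim (orth T) * restrict_form T (contract_form a \<omega>) bs * volume (rev zs @ y # ys)"
      by (rule dual_form_any_frame[OF S(2) top]) (use True fr' k y in auto)
    have "dual_form T (restrict_form T (contract_form a \<omega>)) (y # ys) =
      - ((- 1) ^ vec.dim (orth S) * \<omega> (a # bs) * volume (rev zs @ y # ys))"
    proof -
      have "restrict_form T (contract_form a \<omega>) bs = \<omega> (a # bs)"
        using fr' by (simp add: restrict_form_def contract_form_def)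
      then show ?thesis using * k by (simp add: gram_frame[OF fr])
    qed
    also have "(- 1) ^ vec.dim (orth S) * \<omega> (a # bs) * volume (rev zs @ y # ys) = dual_form S \<omega> ys * dot y a"
      using dual_form_any_frame[OF S(1) \<omega>, of "a # bs" "y # zs" ys] True fr' S a by (auto simp: g)
    finally have **: "dual_form T (restrict_form T (contract_form a \<omega>)) (y # ys) = - (dual_form S \<omega> ys * dot y a)" .
    define \<eta> where "\<eta> = dual_form T (restrict_form T (contract_form a \<omega>))"
    show ?thesis using ** True unfolding \<eta>_def[symmetric]
      by (simp add: restrict_form_def contract_form_def mult.commute)
  next
    case False
    moreover have "\<not> (length (y # ys) = vec.dim (orth T) \<and> set ys \<subseteq> orth S)" using False k by auto
    ultimately show ?thesis
      using inv_forms_outside[of "dual_form S \<omega>" "orth S" _ ys] dual_form_in_top_forms[OF S(1), of \<omega>]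
        inv_forms_outside[of "dual_form T (restrict_form T (contract_form a \<omega>))" "orth T" _ "y # ys"]
        dual_form_in_top_forms[OF S(2), of "restrict_form T (contract_form a \<omega>)"]
      by (auto simp: restrict_form_def contract_form_def top_forms_def)
  qed
qed

text \<open>If \<open>ys\<close> is a basis of \<open>orth S\<close>, then \<open>rev zs @ ys\<close> spans the whole space, so the volume form does not vanish
  on it, and the value of \<open>dual_form S \<omega>\<close> at \<open>ys\<close> determines \<open>\<omega> bs\<close>.\<close>

lemma dual_form_bij:
  fixes S :: "(complex ^ 'n::finite) set"
  assumes S: "vec.subspace S"
  shows "bij_betw (dual_form S) (top_forms S) (top_forms (orth S))"
proof -
  obtain bs zs where fr: "frame S bs zs"
    and d: "\<And>\<omega>. dual_form S \<omega> = restrict_form (orth S) (\<lambda>ys. (- 1) ^ vec.dim (orth S) * \<omega> bs * volume (rev zs @ ys))"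
    using dual_form_frame by blast
  have fr': "length bs = vec.dim S" "set bs \<subseteq> S" "S \<subseteq> vec.span (set bs)" "length zs = vec.dim S"
    using fr by (auto simp: frame_def)
  obtain ys where ys: "length ys = vec.dim (orth S)" "set ys \<subseteq> orth S" "orth S \<subseteq> vec.span (set ys)"
    using basis_list_exists by blast
  define v where "v = volume (rev zs @ ys)"
  have "v \<noteq> 0"
  proof
    assume "v = 0"
    have "set zs \<union> orth S \<subseteq> vec.span (set (rev zs @ ys) \<union> {})"
      using ys(3) vec.span_mono[of "set ys" "set zs \<union> set ys"] vec.span_superset[of "set zs \<union> set ys"] by auto
    then have span: "UNIV \<subseteq> vec.span (set (rev zs @ ys) \<union> {})"
      using vec.span_mono vec.span_span span_frame_orth[OF fr] by metis
    have "volume xs = 0" for xs :: "(complex ^ 'n) list"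
      by (rule inv_forms_eq_0[OF vec.subspace_UNIV volume(1), where T = "{}" and bs = "rev zs @ ys"])
         (use span fr' ys dim_orth[OF S] \<open>v = 0\<close> in \<open>auto simp: v_def\<close>)
    then show False using volume(2) by blast
  qed
  have val: "dual_form S \<omega> ys = (- 1) ^ vec.dim (orth S) * \<omega> bs * v" for \<omega>
    using ys by (simp add: d restrict_form_def v_def)
  show ?thesis
  proof (rule bij_betwI')
    fix \<omega> \<eta> assume \<omega>: "\<omega> \<in> top_forms S" "\<eta> \<in> top_forms S"
    show "(dual_form S \<omega> = dual_form S \<eta>) = (\<omega> = \<eta>)"
    proof
      assume "dual_form S \<omega> = dual_form S \<eta>"
      then have "\<omega> bs = \<eta> bs" using val[of \<omega>] val[of \<eta>] \<open>v \<noteq> 0\<close> by simp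
      then show "\<omega> = \<eta>"
        using inv_forms_eqI[OF S _ _ fr'(1-3)] \<omega> by (simp add: top_forms_def)
    qed simp
  next
    fix \<omega> assume "\<omega> \<in> top_forms S"
    then show "dual_form S \<omega> \<in> top_forms (orth S)" by (intro dual_form_in_top_forms[OF S])
  next
    fix \<eta> assume \<eta>: "\<eta> \<in> top_forms (orth S)"
    define c where "c = (- 1) ^ vec.dim (orth S) * \<eta> ys / v"
    define \<omega> where "\<omega> = (\<lambda>xs. c * restrict_form S (\<lambda>xs. gram zs xs) xs)"
    have \<omega>: "\<omega> \<in> top_forms S"
      unfolding \<omega>_def using top_form_nonzero[OF S fr] by (simp add: top_forms_def form_scale_in_inv_forms)
    have "\<omega> bs = c" using fr' gram_frame[OF fr] by (simp add: \<omega>_def restrict_form_def)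
    then have "dual_form S \<omega> ys = \<eta> ys"
      using \<open>v \<noteq> 0\<close> unfolding val c_def by (simp flip: power_add mult.assoc)
    then have "dual_form S \<omega> = \<eta>"
      using inv_forms_eqI[OF subspace_orth _ _ ys] dual_form_in_top_forms[OF S, of \<omega>] \<eta>
      by (simp add: top_forms_def)
    with \<omega> show "\<exists>\<omega>\<in>top_forms S. \<eta> = dual_form S \<omega>" by blast
  qed
qed

section \<open>Semilinear maps of free modules\<close>

definition semilinear_extension :: "('s \<Rightarrow> 't) \<Rightarrow> ('r :: ring_1 \<Rightarrow> 'q :: ring_1) \<Rightarrow> ('s \<Rightarrow>\<^sub>0 'r) \<Rightarrow> ('t \<Rightarrow>\<^sub>0 'q)" where
  "semilinear_extension \<sigma> \<psi> p = (\<Sum>s\<in>Poly_Mapping.keys p. Poly_Mapping.single (\<sigma> s) (\<psi> (Poly_Mapping.lookup p s)))"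

lemma map_single: "Poly_Mapping.map ((*) r) (Poly_Mapping.single s a) = Poly_Mapping.single s (r * a :: 'r :: ring_1)"
  by (rule poly_mapping_eqI) (simp add: Poly_Mapping.map.rep_eq lookup_single when_def)

lemma map_times_add: "Poly_Mapping.map ((*) r) (p + q) =
    Poly_Mapping.map ((*) (r :: 'r :: ring_1)) p + Poly_Mapping.map ((*) r) q"
  by (rule poly_mapping_eqI) (auto simp: Poly_Mapping.map.rep_eq lookup_add when_def distrib_left simp flip: distrib_left)

text \<open>The Fourier automorphism and its inverse are the maps of scalars along which free modules
  are compared.\<close>

locale additive_ring_map =
  fixes \<psi> :: "'r :: ring_1 \<Rightarrow> 'q :: ring_1"
  assumes add: "\<psi> (x + y) = \<psi> x + \<psi> y" and mult: "\<psi> (x * y) = \<psi> x * \<psi> y"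
begin

sublocale additive \<psi> by unfold_locales (rule add)

lemma semilinear_extension_superset:
  assumes "finite S" "Poly_Mapping.keys p \<subseteq> S"
  shows "semilinear_extension \<sigma> \<psi> p = (\<Sum>s\<in>S. Poly_Mapping.single (\<sigma> s) (\<psi> (Poly_Mapping.lookup p s)))"
  unfolding semilinear_extension_def
  by (rule sum.mono_neutral_left) (use assms in \<open>auto simp: in_keys_iff zero\<close>)

lemma semilinear_extension_single [simp]:
  "semilinear_extension \<sigma> \<psi> (Poly_Mapping.single s a) = Poly_Mapping.single (\<sigma> s) (\<psi> a)"
  by (simp add: semilinear_extension_superset[of "{s}"])

lemma semilinear_extension_add:
  "semilinear_extension \<sigma> \<psi> (p + q) = semilinear_extension \<sigma> \<psi> p + semilinear_extension \<sigma> \<psi> q"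
  by (simp add: semilinear_extension_superset[of "Poly_Mapping.keys p \<union> Poly_Mapping.keys q"]
       Poly_Mapping.keys_add lookup_add add single_add sum.distrib)

sublocale ext: additive "semilinear_extension \<sigma> \<psi>" for \<sigma> :: "'s \<Rightarrow> 't"
  by unfold_locales (rule semilinear_extension_add)

lemma semilinear_extension_act:
  "semilinear_extension \<sigma> \<psi> (Poly_Mapping.map ((*) r) p) =
     Poly_Mapping.map ((*) (\<psi> r)) (semilinear_extension \<sigma> \<psi> p)"
  by (induction p rule: poly_mapping_add_induct)
     (simp_all add: map_single map_times_add semilinear_extension_add mult)

end

lemma poly_mapping_restrict_induct [consumes 1, case_names zero single add]:
  fixes P :: "('a \<Rightarrow>\<^sub>0 'b::comm_monoid_add) \<Rightarrow> bool"
  assumes "Poly_Mapping.keys p \<subseteq> S"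
    and zero: "P 0"
    and single: "\<And>s a. s \<in> S \<Longrightarrow> P (Poly_Mapping.single s a)"
    and add: "\<And>p q. P p \<Longrightarrow> P q \<Longrightarrow> P (p + q)"
  shows "P p"
  using assms(1)
proof (induction p rule: update_induct)
  case const
  show ?case by (rule zero)
next
  case (update p a b)
  have eq: "Poly_Mapping.update a b p = Poly_Mapping.single a b + p"
    using update by (intro poly_mapping_eqI)
      (auto simp: lookup_update lookup_add lookup_single when_def in_keys_iff)
  have "a \<in> S" "Poly_Mapping.keys p \<subseteq> S"
    using update by (auto simp: keys_update split: if_splits)
  then show ?case unfolding eq using update single add by blast
qed

lemma semilinear_extension_inverse:
  assumes "additive_ring_map \<psi>" "additive_ring_map \<psi>'"
    and "\<And>a. \<psi>' (\<psi> a) = a" "\<And>s. s \<in> S \<Longrightarrow> \<sigma>' (\<sigma> s) = s" "Poly_Mapping.keys p \<subseteq> S"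
  shows "semilinear_extension \<sigma>' \<psi>' (semilinear_extension \<sigma> \<psi> p) = p"
proof -
  interpret a: additive_ring_map \<psi> by fact
  interpret b: additive_ring_map \<psi>' by fact
  show ?thesis using assms(5)
    by (induction p rule: poly_mapping_restrict_induct)
       (simp_all add: assms a.semilinear_extension_add b.semilinear_extension_add a.ext.zero b.ext.zero)
qed

lemma keys_semilinear_extension:
  "Poly_Mapping.keys (semilinear_extension \<sigma> \<psi> p) \<subseteq> \<sigma> ` Poly_Mapping.keys p"
proof
  fix t assume t: "t \<in> Poly_Mapping.keys (semilinear_extension \<sigma> \<psi> p)"
  show "t \<in> \<sigma> ` Poly_Mapping.keys p"
  proof (rule ccontr)
    assume "t \<notin> \<sigma> ` Poly_Mapping.keys p"
    then have "Poly_Mapping.lookup (semilinear_extension \<sigma> \<psi> p) t = 0"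
      unfolding semilinear_extension_def lookup_sum
      by (intro sum.neutral) (auto simp: lookup_single when_def)
    then show False using t by (simp add: in_keys_iff)
  qed
qed

lemma semilinear_extension_bij:
  assumes "additive_ring_map \<psi>" "additive_ring_map \<phi>"
    and "\<And>a. \<phi> (\<psi> a) = a" "\<And>a. \<psi> (\<phi> a) = a" and \<sigma>: "bij_betw \<sigma> S T"
  shows "bij_betw (semilinear_extension \<sigma> \<psi>) {p. Poly_Mapping.keys p \<subseteq> S} {p. Poly_Mapping.keys p \<subseteq> T}"
proof (rule bij_betw_byWitness[where f' = "semilinear_extension (inv_into S \<sigma>) \<phi>"])
  have inv: "\<And>s. s \<in> S \<Longrightarrow> inv_into S \<sigma> (\<sigma> s) = s" "\<And>t. t \<in> T \<Longrightarrow> \<sigma> (inv_into S \<sigma> t) = t"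
    using \<sigma> by (auto simp: bij_betw_inv_into_left bij_betw_inv_into_right)
  show "\<forall>p\<in>{p. Poly_Mapping.keys p \<subseteq> S}. semilinear_extension (inv_into S \<sigma>) \<phi> (semilinear_extension \<sigma> \<psi> p) = p"
    by (intro ballI semilinear_extension_inverse[where S = S]) (auto simp: assms(1-4) inv(1))
  show "\<forall>p\<in>{p. Poly_Mapping.keys p \<subseteq> T}. semilinear_extension \<sigma> \<psi> (semilinear_extension (inv_into S \<sigma>) \<phi> p) = p"
    by (intro ballI semilinear_extension_inverse[where S = T]) (auto simp: assms(1-4) inv(2))
  show "semilinear_extension \<sigma> \<psi> ` {p. Poly_Mapping.keys p \<subseteq> S} \<subseteq> {p. Poly_Mapping.keys p \<subseteq> T}"
    using keys_semilinear_extension[of \<sigma> \<psi>] bij_betw_imp_surj_on[OF \<sigma>] by blast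
  show "semilinear_extension (inv_into S \<sigma>) \<phi> ` {p. Poly_Mapping.keys p \<subseteq> T} \<subseteq> {p. Poly_Mapping.keys p \<subseteq> S}"
    using keys_semilinear_extension[of "inv_into S \<sigma>" \<phi>] bij_betw_imp_surj_on[OF bij_betw_inv_into[OF \<sigma>]] by blast
qed

section \<open>Submodules and quotients\<close>

lemma quotient_lmodule_simps:
  "carrier (quotient_lmodule M R) = rcosets\<^bsub>M\<^esub> R"
  "mult (quotient_lmodule M R) = set_mult M"
  "act (quotient_lmodule M R) r U = (\<Union>x\<in>U. R #>\<^bsub>M\<^esub> act M r x)"
  by (simp_all add: quotient_lmodule_def FactGroup_def monoid.defs lmodule.defs)

text \<open>The isomorphism takes images of cosets. The action on a quotient is a union of cosets over all
  representatives, and this union is transported literally by \<open>h\<close>.\<close>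

lemma isomorphic_quotients:
  fixes M :: "('r, 'm) lmodule" and N :: "('r, 'k) lmodule" and \<phi> :: "'r \<Rightarrow> 'r"
  assumes bij: "bij_betw h (carrier M) (carrier N)"
    and mult: "\<And>x y. x \<in> carrier M \<Longrightarrow> y \<in> carrier M \<Longrightarrow> h (x \<otimes>\<^bsub>M\<^esub> y) = h x \<otimes>\<^bsub>N\<^esub> h y"
    and act: "\<And>r x. x \<in> carrier M \<Longrightarrow> h (act M (\<phi> r) x) = act N r (h x)"
    and closed: "\<And>x y. x \<in> carrier M \<Longrightarrow> y \<in> carrier M \<Longrightarrow> x \<otimes>\<^bsub>M\<^esub> y \<in> carrier M"
      "\<And>r x. x \<in> carrier M \<Longrightarrow> act M r x \<in> carrier M"
    and R: "R \<subseteq> carrier M"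
  shows "(quotient_lmodule M R)\<lparr>act := \<lambda>r. act (quotient_lmodule M R) (\<phi> r)\<rparr> \<cong>\<^sub>l quotient_lmodule N (h ` R)"
proof -
  have coset: "h ` (R #>\<^bsub>M\<^esub> x) = h ` R #>\<^bsub>N\<^esub> h x" if "x \<in> carrier M" for x
    using that R mult by (auto simp: r_coset_def subset_iff image_iff)
  have sub: "U \<subseteq> carrier M" if "U \<in> rcosets\<^bsub>M\<^esub> R" for U
    using that R closed(1) by (auto simp: RCOSETS_def r_coset_def)
  show ?thesis
    unfolding isomorphic_lmodules_def
  proof (intro bexI[of _ "image h"] allI ballI)
    fix r U assume "U \<in> carrier ((quotient_lmodule M R)\<lparr>act := \<lambda>r. act (quotient_lmodule M R) (\<phi> r)\<rparr>)"
    then have U: "U \<subseteq> carrier M" using sub by (simp add: quotient_lmodule_simps)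
    have "h ` (\<Union>x\<in>U. R #>\<^bsub>M\<^esub> act M (\<phi> r) x) = (\<Union>x\<in>U. h ` R #>\<^bsub>N\<^esub> act N r (h x))"
      using U closed(2) by (auto simp: image_UN coset act subset_iff)
    then show "h ` act ((quotient_lmodule M R)\<lparr>act := \<lambda>r. act (quotient_lmodule M R) (\<phi> r)\<rparr>) r U =
        act (quotient_lmodule N (h ` R)) r (h ` U)"
      by (simp add: quotient_lmodule_simps)
  next
    have "image h \<in> iso (quotient_lmodule M R) (quotient_lmodule N (h ` R))"
      unfolding iso_def hom_def quotient_lmodule_simps
    proof (intro CollectI conjI ballI funcsetI)
      fix U assume "U \<in> rcosets\<^bsub>M\<^esub> R"
      then obtain x where "x \<in> carrier M" "U = R #>\<^bsub>M\<^esub> x" by (auto simp: RCOSETS_def)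
      then show "h ` U \<in> rcosets\<^bsub>N\<^esub> (h ` R)"
        using coset bij by (auto simp: RCOSETS_def bij_betw_def)
    next
      fix U W assume UW: "U \<in> rcosets\<^bsub>M\<^esub> R" "W \<in> rcosets\<^bsub>M\<^esub> R"
      have "U \<subseteq> carrier M" "W \<subseteq> carrier M" by (rule sub, fact UW)+
      then show "h ` (U <#>\<^bsub>M\<^esub> W) = h ` U <#>\<^bsub>N\<^esub> h ` W"
        using mult by (auto simp: set_mult_def image_iff subset_iff) metis+
    next
      show "bij_betw (image h) (rcosets\<^bsub>M\<^esub> R) (rcosets\<^bsub>N\<^esub> (h ` R))"
        unfolding bij_betw_def
      proof
        show "inj_on (image h) (rcosets\<^bsub>M\<^esub> R)"
          using sub bij by (intro inj_onI) (metis bij_betw_def inj_on_image_eq_iff)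
        have "image h ` (rcosets\<^bsub>M\<^esub> R) = (\<Union>x\<in>carrier M. {h ` R #>\<^bsub>N\<^esub> h x})"
          using coset by (auto simp: RCOSETS_def image_iff)
        also have "\<dots> = rcosets\<^bsub>N\<^esub> (h ` R)"
          unfolding RCOSETS_def by (simp flip: bij_betw_imp_surj_on[OF bij])
        finally show "image h ` (rcosets\<^bsub>M\<^esub> R) = rcosets\<^bsub>N\<^esub> (h ` R)" .
      qed
    qed
    then show "image h \<in> iso ((quotient_lmodule M R)\<lparr>act := \<lambda>r. act (quotient_lmodule M R) (\<phi> r)\<rparr>)
        (quotient_lmodule N (h ` R))" by (simp add: iso_def hom_def)
  qed
qed

lemma free_lmodule_simps:
  "carrier (free_lmodule S) = {p. Poly_Mapping.keys p \<subseteq> S}"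
  "mult (free_lmodule S) = (+)"
  "one (free_lmodule S) = 0"
  "act (free_lmodule S) = (\<lambda>r. Poly_Mapping.map ((*) r))"
  by (simp_all add: free_lmodule_def)

abbreviation "free_span S G \<equiv> generated_submodule (free_lmodule S) G"

lemma free_span_intros:
  "0 \<in> free_span S G" "x \<in> G \<Longrightarrow> x \<in> free_span S G" "x \<in> free_span S G \<Longrightarrow> y \<in> free_span S G \<Longrightarrow> x + y \<in> free_span S G"
  "x \<in> free_span S G \<Longrightarrow> Poly_Mapping.map ((*) r) x \<in> free_span S G"
  using generated_submodule.intros[where M = "free_lmodule S" and G = G] by (simp_all add: free_lmodule_simps)

lemma map_uminus_one: "Poly_Mapping.map ((*) (- 1 :: 'r :: ring_1)) x = - x"
  by (rule poly_mapping_eqI) (simp add: Poly_Mapping.map.rep_eq when_def)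

lemma free_span_uminus: "x \<in> free_span S G \<Longrightarrow> - x \<in> free_span S G"
  using free_span_intros(4)[of x S G "- 1"] by (simp add: map_uminus_one)

lemma free_span_diff: "x \<in> free_span S G \<Longrightarrow> y \<in> free_span S G \<Longrightarrow> x - y \<in> free_span S G"
  using free_span_intros(3)[OF _ free_span_uminus, of x S G y] by simp

lemma free_span_sum: "(\<And>i. i \<in> A \<Longrightarrow> x i \<in> free_span S G) \<Longrightarrow> sum x A \<in> free_span S G"
  by (induction A rule: infinite_finite_induct) (auto intro: free_span_intros)

lemma free_span_mono: "x \<in> free_span S G \<Longrightarrow> G \<subseteq> H \<Longrightarrow> x \<in> free_span S H"
  by (induction x rule: generated_submodule.induct) (auto intro: free_span_intros simp: free_lmodule_simps)

lemma free_span_carrier: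
  assumes "G \<subseteq> {p. Poly_Mapping.keys p \<subseteq> S}" "x \<in> free_span S G"
  shows "Poly_Mapping.keys x \<subseteq> S"
  using assms(2)
proof (induction x rule: generated_submodule.induct)
  case (add x y)
  then show ?case using Poly_Mapping.keys_add[of x y] by (auto simp: free_lmodule_simps)
next
  case (act x r)
  moreover have "Poly_Mapping.keys (Poly_Mapping.map ((*) r) x) \<subseteq> Poly_Mapping.keys x"
    by (auto simp: in_keys_iff Poly_Mapping.map.rep_eq)
  ultimately show ?case by (auto simp: free_lmodule_simps)
qed (use assms(1) in \<open>auto simp: free_lmodule_simps\<close>)

lemma free_span_image_subset:
  assumes "additive_ring_map \<psi>" "\<And>g. g \<in> G \<Longrightarrow> semilinear_extension \<sigma> \<psi> g \<in> free_span T H" "x \<in> free_span S G"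
  shows "semilinear_extension \<sigma> \<psi> x \<in> free_span T H"
proof -
  interpret additive_ring_map \<psi> by fact
  show ?thesis using assms(3)
    by (induction x rule: generated_submodule.induct)
      (auto simp: free_lmodule_simps assms(2) ext.zero semilinear_extension_add semilinear_extension_act intro: free_span_intros)
qed

lemma free_span_image_superset:
  assumes "additive_ring_map \<psi>" "surj \<psi>" "\<And>g. g \<in> H \<Longrightarrow> g \<in> semilinear_extension \<sigma> \<psi> ` free_span S G" "x \<in> free_span T H"
  shows "x \<in> semilinear_extension \<sigma> \<psi> ` free_span S G"
proof -
  interpret additive_ring_map \<psi> by fact
  show ?thesis using assms(4)
  proof (induction x rule: generated_submodule.induct)
    case zero
    then show ?case using free_span_intros(1) ext.zero by (force simp: free_lmodule_simps)
  next
    case (gen x)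
    then show ?case using assms(3) by blast
  next
    case (add x y)
    then show ?case
      by (auto simp: free_lmodule_simps image_iff) (metis free_span_intros(3) semilinear_extension_add)
  next
    case (act x r)
    obtain r' where "r = \<psi> r'" using assms(2) by blast
    then show ?case using act
      by (auto simp: free_lmodule_simps image_iff) (metis free_span_intros(4) semilinear_extension_act)
  qed
qed

text \<open>The remaining generators correspond to each other up to sign and modulo the submodule generated by
  \<open>T2\<close>, which is known to be the image of the one generated by \<open>T1\<close>. This is how the defining relations of the two
  quiver modules compare: their summands agree only after scalars have been moved across
  the tensor signs.\<close>

lemma free_span_image_eq:
  assumes \<psi>: "additive_ring_map \<psi>" "surj \<psi>"
    and T: "semilinear_extension \<sigma> \<psi> ` T1 = T2"
    and F1: "\<And>g. g \<in> F1 \<Longrightarrow> \<exists>g'\<in>F2. semilinear_extension \<sigma> \<psi> g - g' \<in> free_span S2 T2 \<or> semilinear_extension \<sigma> \<psi> g + g' \<in> free_span S2 T2"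
    and F2: "\<And>g'. g' \<in> F2 \<Longrightarrow> \<exists>g\<in>F1. semilinear_extension \<sigma> \<psi> g - g' \<in> free_span S2 T2 \<or> semilinear_extension \<sigma> \<psi> g + g' \<in> free_span S2 T2"
  shows "semilinear_extension \<sigma> \<psi> ` free_span S1 (T1 \<union> F1) = free_span S2 (T2 \<union> F2)"
proof -
  interpret additive_ring_map \<psi> by fact
  let ?h = "semilinear_extension \<sigma> \<psi>"
  have T2: "x \<in> free_span S2 (T2 \<union> F2)" if "x \<in> free_span S2 T2" for x
    using that by (rule free_span_mono) auto
  have T1: "x \<in> ?h ` free_span S1 (T1 \<union> F1)" if "x \<in> free_span S2 T2" for x
    using \<psi> _ that by (rule free_span_image_superset) (use T in \<open>auto intro!: imageI free_span_intros(2)\<close>)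
  have "?h g \<in> free_span S2 (T2 \<union> F2)" if g: "g \<in> T1 \<union> F1" for g
  proof (cases "g \<in> T1")
    case True
    then show ?thesis using T by (auto intro!: free_span_intros(2))
  next
    case False
    then obtain g' where g'': "g' \<in> F2" "?h g - g' \<in> free_span S2 T2 \<or> ?h g + g' \<in> free_span S2 T2"
      using g F1 by blast
    have "g' \<in> free_span S2 (T2 \<union> F2)" using g''(1) by (auto intro: free_span_intros(2))
    with g''(2) show ?thesis
      using free_span_intros(3)[of "?h g - g'" S2 "T2 \<union> F2" g'] free_span_diff[of "?h g + g'" S2 "T2 \<union> F2" g'] T2 by auto
  qed
  moreover have "g' \<in> ?h ` free_span S1 (T1 \<union> F1)" if g': "g' \<in> T2 \<union> F2" for g'
  proof (cases "g' \<in> T2")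
    case True
    then show ?thesis using T by (auto intro!: free_span_intros(2))
  next
    case False
    then obtain g where g: "g \<in> F1" "?h g - g' \<in> free_span S2 T2 \<or> ?h g + g' \<in> free_span S2 T2"
      using g' F2 by blast
    have gg: "g \<in> free_span S1 (T1 \<union> F1)" using g(1) by (auto intro: free_span_intros(2))
    from g(2) show ?thesis
    proof
      assume "?h g - g' \<in> free_span S2 T2"
      then obtain t where "t \<in> free_span S1 (T1 \<union> F1)" "?h g - g' = ?h t" using T1 by blast
      then have "g' = ?h (g - t)" "g - t \<in> free_span S1 (T1 \<union> F1)"
        using gg free_span_diff by (auto simp: ext.diff algebra_simps)
      then show ?thesis by blast
    next
      assume "?h g + g' \<in> free_span S2 T2"
      then obtain t where "t \<in> free_span S1 (T1 \<union> F1)" "?h g + g' = ?h t" using T1 by blast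
      then have "g' = ?h (t - g)" "t - g \<in> free_span S1 (T1 \<union> F1)"
        using gg free_span_diff by (auto simp: ext.diff algebra_simps)
      then show ?thesis by blast
    qed
  qed
  ultimately show ?thesis
    using free_span_image_subset[OF \<psi>(1), of "T1 \<union> F1" \<sigma> S2 "T2 \<union> F2"]
      free_span_image_superset[OF \<psi>, of "T2 \<union> F2" \<sigma> S1 "T1 \<union> F1"] by blast
qed

section \<open>The Fourier transform of functions and fields\<close>

lemma fourier_iso_props:
  fixes P Q :: "('n::finite) diffop"
  shows "bij (fourier_iso :: 'n diffop \<Rightarrow> _)"
    "fourier_iso (P + Q) = fourier_iso P + fourier_iso Q"
    "fourier_iso (P * Q) = fourier_iso P * fourier_iso Q"
    "fourier_iso (op_const c) = (op_const c :: 'n diffop)"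
    "fourier_iso (op_coord i) = - op_partial (i :: 'n)"
    "fourier_iso (op_partial i) = op_coord (i :: 'n)"
  using is_fourier_iso_fourier_iso[where 'n = 'n] unfolding is_fourier_iso_def by blast+

definition inv_fourier :: "('n::finite) diffop \<Rightarrow> 'n diffop" where
  "inv_fourier = inv_into UNIV fourier_iso"

lemma inv_fourier_fourier:
  fixes P :: "('n::finite) diffop"
  shows "inv_fourier (fourier_iso P) = P" "fourier_iso (inv_fourier P) = P"
  using fourier_iso_props(1)[where 'n = 'n] by (simp_all add: inv_fourier_def bij_is_inj bij_is_surj surj_f_inv_f)

lemma additive_ring_map_fourier: "additive_ring_map (fourier_iso :: ('n::finite) diffop \<Rightarrow> _)"
  by unfold_locales (rule fourier_iso_props)+

lemma additive_ring_map_inv_fourier: "additive_ring_map (inv_fourier :: ('n::finite) diffop \<Rightarrow> _)"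
proof
  fix P Q :: "'n diffop"
  show "inv_fourier (P + Q) = inv_fourier P + inv_fourier Q"
    using inv_fourier_fourier(1)[of "inv_fourier P + inv_fourier Q"]
    by (simp add: fourier_iso_props inv_fourier_fourier)
  show "inv_fourier (P * Q) = inv_fourier P * inv_fourier Q"
    using inv_fourier_fourier(1)[of "inv_fourier P * inv_fourier Q"]
    by (simp add: fourier_iso_props inv_fourier_fourier)
qed

lemma op_const_0 [simp]: "op_const 0 = 0"
  by (rule diffop_eqI) (simp add: Rep_diffop_simps poly_const_def)

lemma op_const_mult: "op_const (c * d) = op_const c * op_const d"
  by (rule diffop_eqI) (simp add: Rep_diffop_simps poly_const_mult mult.assoc)

lemma pairing_dot: "pairing x (dot a) = dot a x"
  by (simp add: pairing_def)

lemma op_affine_dot: "op_affine (dot a) = (\<Sum>i\<in>UNIV. op_const (a $ i) * op_coord i)"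
proof -
  have "pairing (axis i 1) (dot a) = a $ i" for i
    unfolding pairing_dot by (simp add: dot_def axis_def if_distrib cong: if_cong)
  then show ?thesis by (simp add: op_affine_def)
qed

lemma fourier_op_affine: "fourier_iso (op_affine (dot a)) = - op_field a"
proof -
  interpret additive "fourier_iso :: ('a::finite) diffop \<Rightarrow> _" by unfold_locales (rule fourier_iso_props)
  show ?thesis by (simp add: op_affine_dot sum fourier_iso_props op_field_def sum_negf)
qed

lemma fourier_op_field: "fourier_iso (op_field b) = op_affine (dot b)"
proof -
  interpret additive "fourier_iso :: ('a::finite) diffop \<Rightarrow> _" by unfold_locales (rule fourier_iso_props)
  show ?thesis by (simp add: op_affine_dot sum fourier_iso_props op_field_def)
qed

lemma inv_fourier_simps:
  fixes a b :: "complex ^ 'n::finite"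
  shows
  "inv_fourier (op_field a) = - op_affine (dot a)"
  "inv_fourier (op_affine (dot b)) = op_field b"
  "inv_fourier (op_const c) = (op_const c :: 'n diffop)"
  "inv_fourier 1 = (1 :: 'n diffop)"
proof -
  interpret additive "inv_fourier :: 'n diffop \<Rightarrow> _"
    using additive_ring_map.add[OF additive_ring_map_inv_fourier] by unfold_locales
  have "inv_fourier (fourier_iso (op_affine (dot a))) = op_affine (dot a)" by (rule inv_fourier_fourier)
  then have "- inv_fourier (op_field a) = op_affine (dot a)"
    unfolding fourier_op_affine minus .
  then show "inv_fourier (op_field a) = - op_affine (dot a)" by (rule minus_equation_iff[THEN iffD1, symmetric])
  show "inv_fourier (op_affine (dot b)) = op_field b"
    by (metis fourier_op_field inv_fourier_fourier(1))
  show "inv_fourier (op_const c) = (op_const c :: 'n diffop)"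
    by (metis fourier_iso_props(4) inv_fourier_fourier(1))
  show "inv_fourier 1 = (1 :: 'n diffop)"
    by (metis fourier_iso_props(4) inv_fourier_fourier(1) op_const_1)
qed

section \<open>Functions vanishing on strata\<close>

lemma strata_subspace:
  fixes C :: "(complex ^ 'n::finite) set set"
  assumes "central_arrangement C" "\<alpha> \<in> closed_strata C"
  shows "vec.subspace \<alpha>"
proof -
  have "vec.subspace H" if H: "H \<in> C" for H
  proof -
    obtain a c where H': "H = {x. dot a x = c}" "0 \<in> H"
    proof -
      have "hyperplane H" "0 \<in> H" using assms(1) H by (auto simp: central_arrangement_def)
      then show ?thesis using that by (auto simp: hyperplane_def dot_def)
    qed
    then have "c = 0" using H' by simp
    then show ?thesis unfolding H'(1) by (intro vec.subspaceI) (auto simp: dot_add dot_scale)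
  qed
  moreover obtain B where "B \<subseteq> C" "\<alpha> = \<Inter>B" using assms(2) by (auto simp: closed_strata_def)
  ultimately show ?thesis by (auto intro: vec.subspace_Inter)
qed

lemma finite_closed_strata: "finite C \<Longrightarrow> finite (closed_strata C)"
  by (simp add: closed_strata_def Setcompr_eq_image flip: Pow_def)

text \<open>Two points of a line in \<open>U\<close> put its direction in \<open>U\<close>, and then also \<open>q\<close>.\<close>

lemma line_meets_subspace_once:
  assumes "vec.subspace U" "q \<notin> U" "q + s *s p \<in> U" "q + t *s p \<in> U"
  shows "s = (t :: complex)"
proof (rule ccontr)
  assume "s \<noteq> t"
  define u where "u = s - t"
  have "u \<noteq> 0" using \<open>s \<noteq> t\<close> by (simp add: u_def)
  have "(q + s *s p) - (q + t *s p) \<in> U" using assms vec.subspace_diff by blast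
  also have "(q + s *s p) - (q + t *s p) = u *s p" by (simp add: u_def vec.scale_left_diff_distrib)
  finally have "u *s p \<in> U" .
  from vec.subspace_scale[OF assms(1) this, of "1 / u"] have "p \<in> U" using \<open>u \<noteq> 0\<close> by simp
  then have "(q + s *s p) - s *s p \<in> U"
    using assms vec.subspace_diff vec.subspace_scale by blast
  then show False using assms(2) by simp
qed

lemma finite_bad_parameters:
  assumes "finite \<F>" "\<And>U. U \<in> \<F> \<Longrightarrow> vec.subspace U \<and> q \<notin> U"
  shows "finite {t :: complex. q + t *s p \<in> \<Union>\<F>}"
proof -
  have "finite {t. q + t *s p \<in> U}" if U: "U \<in> \<F>" for U
  proof (cases "{t. q + t *s p \<in> U} = {}")
    case False
    then obtain s where "q + s *s p \<in> U" by blast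
    then have "{t. q + t *s p \<in> U} \<subseteq> {s}"
      using line_meets_subspace_once assms(2)[OF U] by blast
    then show ?thesis using finite_subset by blast
  qed (simp only: finite.emptyI)
  moreover have "{t. q + t *s p \<in> \<Union>\<F>} = (\<Union>U\<in>\<F>. {t. q + t *s p \<in> U})" by blast
  ultimately show ?thesis using assms(1) by simp
qed

text \<open>A point \<open>q\<close> off the earlier subspaces and a point \<open>p\<close> off the new one are joined by a line. If \<open>q\<close> lies in the new
  subspace, then no \<open>q + t p\<close> with \<open>t \<noteq> 0\<close> does, and only finitely many of these points lie in an
  earlier one.\<close>

lemma subspace_not_covered:
  assumes "finite \<F>" "vec.subspace (S :: (complex ^ 'n::finite) set)" "\<And>U. U \<in> \<F> \<Longrightarrow> vec.subspace U \<and> U \<subset> S"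
  shows "\<exists>q\<in>S. q \<notin> \<Union>\<F>"
  using assms(1,3)
proof (induction \<F>)
  case empty
  then show ?case using vec.subspace_0[OF assms(2)] by blast
next
  case (insert U \<F>)
  then obtain q where q: "q \<in> S" "q \<notin> \<Union>\<F>" by blast
  show ?case
  proof (cases "q \<in> U")
    case True
    obtain p where p: "p \<in> S" "p \<notin> U" using insert.prems by blast
    have U: "vec.subspace U" using insert.prems by blast
    have "finite {t :: complex. q + t *s p \<in> \<Union>\<F>}"
      by (rule finite_bad_parameters[OF insert.hyps(1)]) (use insert.prems q in blast)
    then have "finite (insert 0 {t :: complex. q + t *s p \<in> \<Union>\<F>})" by simp
    then obtain t :: complex where t: "t \<noteq> 0" "q + t *s p \<notin> \<Union>\<F>"
      using ex_new_if_finite[OF infinite_UNIV_char_0] by blast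
    have "q + t *s p \<notin> U"
    proof
      assume "q + t *s p \<in> U"
      then have "(q + t *s p) - q \<in> U" using True vec.subspace_diff[OF U] by blast
      then show False using vec.subspace_scale[OF U, of "t *s p" "1 / t"] p t by simp
    qed
    moreover have "q + t *s p \<in> S"
      using q p vec.subspace_add[OF assms(2)] vec.subspace_scale[OF assms(2)] by blast
    ultimately show ?thesis using t by blast
  next
    case False
    then show ?thesis using q by blast
  qed
qed

text \<open>An affine function vanishing on the open stratum vanishes on the closed one: join any point \<open>p\<close> to a point
  \<open>q\<close> of the open stratum; all but finitely many points of the line are in the open stratum, and a function
  that is affine on the line and vanishes at two of its points vanishes at \<open>p\<close>.\<close>

lemma vanishing_affine_eq:
  fixes C :: "(complex ^ 'n::finite) set set"
  assumes C: "central_arrangement C" and \<alpha>: "\<alpha> \<in> closed_strata C"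
  shows "vanishing_affine C \<alpha> = dot ` orth \<alpha>"
proof
  have fin: "finite (closed_strata C)" using C by (simp add: central_arrangement_def finite_closed_strata)
  have S: "vec.subspace \<alpha>" by (rule strata_subspace[OF C \<alpha>])
  define \<F> where "\<F> = {\<beta>\<in>closed_strata C. \<beta> \<subset> \<alpha>}"
  have \<F>: "finite \<F>" "\<And>U. U \<in> \<F> \<Longrightarrow> vec.subspace U \<and> U \<subset> \<alpha>"
    using fin strata_subspace[OF C] by (auto simp: \<F>_def)
  obtain q where q: "q \<in> \<alpha>" "q \<notin> \<Union>\<F>" using subspace_not_covered[OF \<F>(1) S \<F>(2)] by blast
  show "vanishing_affine C \<alpha> \<subseteq> dot ` orth \<alpha>"
  proof
    fix f assume "f \<in> vanishing_affine C \<alpha>"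
    then obtain c b where f: "f = (\<lambda>x. c + dot b x)" and van: "\<And>x. x \<in> \<alpha> - \<Union>\<F> \<Longrightarrow> f x = 0"
      unfolding vanishing_affine_def affine_functions_def open_stratum_def dot_def \<F>_def by auto
    have 0: "f p = 0" if p: "p \<in> \<alpha>" for p
    proof -
      have "finite (insert 0 {t :: complex. q + t *s (p - q) \<in> \<Union>\<F>})"
        using finite_bad_parameters[of \<F> q "p - q"] \<F> q by blast
      then obtain t :: complex where t: "t \<noteq> 0" "q + t *s (p - q) \<notin> \<Union>\<F>"
        using ex_new_if_finite[OF infinite_UNIV_char_0] by blast
      have "q + t *s (p - q) \<in> \<alpha>"
        using q p vec.subspace_add[OF S] vec.subspace_scale[OF S] vec.subspace_diff[OF S] by blast
      then have "f (q + t *s (p - q)) = 0" "f q = 0" using t van q by blast+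
      then have "c + (dot b q + t * dot b (p - q)) = 0" and cq: "c + dot b q = 0"
        by (simp_all only: f dot_add dot_scale)
      then have "t * dot b (p - q) = 0" by (metis add.assoc add.left_neutral)
      moreover have "dot b p = dot b (p - q) + dot b q" using dot_add(2)[of b "p - q" q] by simp
      ultimately show ?thesis using t(1) cq by (simp add: f)
    qed
    from 0[OF vec.subspace_0[OF S]] have "c = 0" by (simp add: f)
    then have "f = dot b" by (simp add: f fun_eq_iff)
    moreover have "b \<in> orth \<alpha>" using 0 \<open>f = dot b\<close> by (simp add: orth_iff)
    ultimately show "f \<in> dot ` orth \<alpha>" by blast
  qed
  show "dot ` orth \<alpha> \<subseteq> vanishing_affine C \<alpha>"
  proof
    fix f assume "f \<in> dot ` orth \<alpha>"
    then obtain b where b: "b \<in> orth \<alpha>" "f = dot b" by blast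
    have "f \<in> affine_functions"
      unfolding affine_functions_def b(2) by (auto simp: dot_def fun_eq_iff intro!: exI[of _ 0] exI[of _ b])
    then show "f \<in> vanishing_affine C \<alpha>"
      using b by (auto simp: vanishing_affine_def open_stratum_def orth_iff)
  qed
qed

lemma vanishing_linear_orth_eq:
  fixes \<alpha> :: "(complex ^ 'n::finite) set"
  assumes "vec.subspace \<alpha>"
  shows "vanishing_linear_orth \<alpha> = dot ` \<alpha>"
proof -
  have "vanishing_linear_orth \<alpha> = dot ` orth (orth \<alpha>)"
    by (auto simp: vanishing_linear_orth_def linear_functions_def orth_def dot_def fun_eq_iff image_iff)
  then show ?thesis using orth_orth[OF assms] by simp
qed

section \<open>Compatibility of the transition maps with duality\<close>

lemma codim_one_decomp:
  assumes S: "vec.subspace S" "vec.subspace T" "covers (\<lambda>\<gamma>. \<gamma>) S T" "a \<in> S" "a \<notin> T" "x \<in> S"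
  shows "\<exists>k. x - k *s a \<in> (T :: (complex ^ 'n::finite) set)"
proof -
  obtain bs where bs: "length bs = vec.dim T" "set bs \<subseteq> T" "T \<subseteq> vec.span (set bs)"
    using basis_list_exists by blast
  have "x \<in> vec.span (insert a (set bs))"
    using span_codim_one[OF S(1,2) _ _ S(4,5) bs(3)] S(3,6) by (auto simp: covers_def)
  then obtain k where "x - k *s a \<in> vec.span (set bs)" using vec.span_breakdown_eq by blast
  then show ?thesis using vec.span_minimal[OF bs(2) S(2)] by blast
qed

lemma dot_nonzero_off_stratum:
  assumes S: "vec.subspace S" "vec.subspace T" "covers (\<lambda>\<gamma>. \<gamma>) S T" "a \<in> S" "a \<notin> T"
    and y: "y \<in> orth T" "y \<notin> orth S"
  shows "dot y a \<noteq> 0"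
proof
  assume 0: "dot y a = 0"
  have "dot y x = 0" if x: "x \<in> S" for x
  proof -
    obtain k where "x - k *s a \<in> T" using codim_one_decomp[OF S x] by blast
    then have "dot y (x - k *s a) = 0" using y by (simp add: orth_iff)
    then show ?thesis using 0 dot_add(2)[of y "x - k *s a" "k *s a"] by (simp add: dot_scale)
  qed
  then show False using y by (simp add: orth_iff)
qed

text \<open>For \<open>a\<close> off \<open>\<beta>\<close>, the form \<open>\<langle>a, f\<rangle> \<pi> \<omega>\<close> is the contraction of \<open>\<omega>\<close> with \<open>a\<close>, and the map \<open>\<pi>\<close>
  of the dual side is inverse to contraction with \<open>\<xi>d\<close>, so the claim is \<open>dual_form_contract\<close>. For \<open>a\<close> in
  \<open>\<beta>\<close> both pairings vanish.\<close>

lemma dual_form_transition_down: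
  fixes \<alpha> \<beta> :: "(complex ^ 'n::finite) set"
  assumes S: "vec.subspace \<alpha>" "vec.subspace \<beta>" "\<alpha> \<succ> \<beta>"
    and f: "f \<beta> \<alpha> \<in> dot ` orth \<beta> - dot ` orth \<alpha>" and \<xi>d: "\<xi>d \<beta> \<alpha> \<in> orth \<beta> - orth \<alpha>"
    and \<omega>: "\<omega> \<in> top_forms \<alpha>"
  shows "a \<in> \<alpha> \<Longrightarrow> pairing a (f \<beta> \<alpha>) * dual_form \<beta> (transition (\<lambda>\<gamma>. \<gamma>) f \<xi> \<beta> \<alpha> \<omega>) ys =
      - pairing (\<xi>d \<beta> \<alpha>) (dot a) * transition orth fd \<xi>d \<beta> \<alpha> (dual_form \<alpha> \<omega>) ys"
    and "transition (\<lambda>\<gamma>. \<gamma>) f \<xi> \<beta> \<alpha> \<omega> \<in> top_forms \<beta>"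
    and "transition orth fd \<xi>d \<beta> \<alpha> (dual_form \<alpha> \<omega>) \<in> top_forms (orth \<beta>)"
proof -
  obtain b where b: "b \<in> orth \<beta>" "b \<notin> orth \<alpha>" "f \<beta> \<alpha> = dot b" using f by blast
  let ?\<pi> = "transition (\<lambda>\<gamma>. \<gamma>) f \<xi> \<beta> \<alpha> \<omega>" and ?\<pi>' = "transition orth fd \<xi>d \<beta> \<alpha> (dual_form \<alpha> \<omega>)"
  have y: "\<xi>d \<beta> \<alpha> \<in> orth \<beta>" "\<xi>d \<beta> \<alpha> \<notin> orth \<alpha>" using \<xi>d by auto
  have sub: "\<beta> \<subseteq> \<alpha>" "vec.dim \<alpha> = vec.dim \<beta> + 1" using S(3) by (auto simp: covers_def)
  have cov: "covers orth \<beta> \<alpha>" using covers_orth[of "\<lambda>\<gamma>. \<gamma>" \<alpha> \<beta>] S by simp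
  have main: "(\<lambda>ys. dot b a * dual_form \<beta> ?\<pi> ys) = (\<lambda>ys. - dot (\<xi>d \<beta> \<alpha>) a * ?\<pi>' ys) \<and> ?\<pi> \<in> top_forms \<beta> \<and> ?\<pi>' \<in> top_forms (orth \<beta>)"
    if a: "a \<in> \<alpha>" "a \<notin> \<beta>" for a
  proof -
    have nz: "dot b a \<noteq> 0" "dot (\<xi>d \<beta> \<alpha>) a \<noteq> 0"
      by (rule dot_nonzero_off_stratum[OF S a]; use b y in blast)+
    let ?R = "restrict_form \<beta> (contract_form a \<omega>)"
    have down: "(\<lambda>xs. dot b a * ?\<pi> xs) = ?R" "?\<pi> \<in> top_forms \<beta>"
      using transition_down[of "\<lambda>\<gamma>. \<gamma>" \<alpha> \<beta> f a \<omega> \<xi>] S a \<omega> nz b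
      by (auto simp: pairing_dot dot_linear orth_iff)
    have \<kappa>: "(\<lambda>ys. dot b a * dual_form \<beta> ?\<pi> ys) = dual_form \<beta> ?R"
      unfolding down(1)[symmetric] dual_form_scale ..
    \<comment> \<open>This form is the candidate for the value of the dual transition map: its contraction is \<open>dual_form \<alpha> \<omega>\<close>.\<close>
    define \<mu> where "\<mu> = (\<lambda>ys. - inverse (dot (\<xi>d \<beta> \<alpha>) a) * dual_form \<beta> ?R ys)"
    have \<mu>: "\<mu> \<in> top_forms (orth \<beta>)"
      unfolding \<mu>_def top_forms_def
      by (rule form_scale_in_inv_forms) (use dual_form_in_top_forms[OF S(2), of ?R] in \<open>simp add: top_forms_def\<close>)
    have "restrict_form (orth \<alpha>) (contract_form (\<xi>d \<beta> \<alpha>) \<mu>) =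
        (\<lambda>ys. - inverse (dot (\<xi>d \<beta> \<alpha>) a) * restrict_form (orth \<alpha>) (contract_form (\<xi>d \<beta> \<alpha>) (dual_form \<beta> ?R)) ys)"
      by (auto simp: \<mu>_def restrict_form_def contract_form_def)
    also have "\<dots> = dual_form \<alpha> \<omega>"
      unfolding dual_form_contract[OF S(1,2) sub a(1) y(1) nz(2) \<omega>] using nz(2) by (simp flip: mult.assoc)
    finally have "?\<pi>' = \<mu>"
      using transition_up[of orth \<alpha> \<beta> \<xi>d \<mu> fd] subspace_orth[of \<alpha>] subspace_orth[of \<beta>] cov y \<mu> by simp
    then show ?thesis using \<mu> down(2) \<kappa> nz(2) by (simp add: \<mu>_def flip: mult.assoc)
  qed
  have "\<not> \<alpha> \<subseteq> \<beta>" using sub vec.dim_subset[of \<alpha> \<beta>] by auto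
  then obtain a0 where "a0 \<in> \<alpha>" "a0 \<notin> \<beta>" by blast
  from main[OF this] show "?\<pi> \<in> top_forms \<beta>" "?\<pi>' \<in> top_forms (orth \<beta>)" by blast+
  assume a: "a \<in> \<alpha>"
  show "pairing a (f \<beta> \<alpha>) * dual_form \<beta> ?\<pi> ys = - pairing (\<xi>d \<beta> \<alpha>) (dot a) * ?\<pi>' ys"
  proof (cases "a \<in> \<beta>")
    case True
    then show ?thesis using b y by (simp add: b(3) pairing_dot orth_iff dot_commute[of a])
  next
    case False
    from main[OF a this] have "dot b a * dual_form \<beta> ?\<pi> ys = - dot (\<xi>d \<beta> \<alpha>) a * ?\<pi>' ys" by metis
    then show ?thesis by (simp only: b(3) pairing_dot dot_commute[of a])
  qed
qed

text \<open>The mirror image of the previous lemma: now \<open>\<omega>\<close> is the contraction of some \<open>\<omega>'\<close> with \<open>\<xi>\<close>, and on the dual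
  side the map goes down, as contraction with any \<open>b\<close> off \<open>orth \<alpha>\<close>.\<close>

lemma dual_form_transition_up:
  fixes \<alpha> \<beta> :: "(complex ^ 'n::finite) set"
  assumes S: "vec.subspace \<alpha>" "vec.subspace \<beta>" "\<alpha> \<succ> \<beta>"
    and fd: "fd \<alpha> \<beta> \<in> dot ` \<alpha> - dot ` \<beta>" and \<xi>: "\<xi> \<alpha> \<beta> \<in> \<alpha> - \<beta>"
    and \<omega>: "\<omega> \<in> top_forms \<beta>"
  shows "b \<in> orth \<beta> \<Longrightarrow> pairing (\<xi> \<alpha> \<beta>) (dot b) * dual_form \<alpha> (transition (\<lambda>\<gamma>. \<gamma>) f \<xi> \<alpha> \<beta> \<omega>) ys =
      - pairing b (fd \<alpha> \<beta>) * transition orth fd \<xi>d \<alpha> \<beta> (dual_form \<beta> \<omega>) ys"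
    and "transition (\<lambda>\<gamma>. \<gamma>) f \<xi> \<alpha> \<beta> \<omega> \<in> top_forms \<alpha>"
    and "transition orth fd \<xi>d \<alpha> \<beta> (dual_form \<beta> \<omega>) \<in> top_forms (orth \<alpha>)"
proof -
  obtain a where a: "a \<in> \<alpha>" "a \<notin> \<beta>" "fd \<alpha> \<beta> = dot a" using fd by blast
  let ?\<pi> = "transition (\<lambda>\<gamma>. \<gamma>) f \<xi> \<alpha> \<beta> \<omega>" and ?\<pi>' = "transition orth fd \<xi>d \<alpha> \<beta> (dual_form \<beta> \<omega>)"
  have x: "\<xi> \<alpha> \<beta> \<in> \<alpha>" "\<xi> \<alpha> \<beta> \<notin> \<beta>" using \<xi> by auto
  have sub: "\<beta> \<subseteq> \<alpha>" "vec.dim \<alpha> = vec.dim \<beta> + 1" using S(3) by (auto simp: covers_def)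
  have cov: "covers orth \<beta> \<alpha>" using covers_orth[of "\<lambda>\<gamma>. \<gamma>" \<alpha> \<beta>] S by simp
  obtain \<omega>' where \<omega>': "\<omega>' \<in> top_forms \<alpha>" "restrict_form \<beta> (contract_form (\<xi> \<alpha> \<beta>) \<omega>') = \<omega>"
    using contract_surj[OF S(1,2) sub x \<omega>] by blast
  have \<pi>: "?\<pi> = \<omega>'"
    using transition_up[of "\<lambda>\<gamma>. \<gamma>" \<beta> \<alpha> \<xi> \<omega>' f] S x \<omega>' by simp
  then show "?\<pi> \<in> top_forms \<alpha>" using \<omega>' by simp
  have main: "(\<lambda>ys. dot a b * ?\<pi>' ys) = (\<lambda>ys. - dot b (\<xi> \<alpha> \<beta>) * dual_form \<alpha> \<omega>' ys) \<and> ?\<pi>' \<in> top_forms (orth \<alpha>)"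
    if b: "b \<in> orth \<beta>" "b \<notin> orth \<alpha>" for b
  proof -
    have nz: "dot b a \<noteq> 0" "dot b (\<xi> \<alpha> \<beta>) \<noteq> 0"
      using dot_nonzero_off_stratum[OF S a(1,2) b] dot_nonzero_off_stratum[OF S x b] by auto
    have "(\<lambda>ys. dot a b * ?\<pi>' ys) = restrict_form (orth \<alpha>) (contract_form b (dual_form \<beta> \<omega>)) \<and> ?\<pi>' \<in> top_forms (orth \<alpha>)"
    proof -
      have p: "pairing x (fd \<alpha> \<beta>) = dot a x" for x by (simp add: a(3) pairing_dot)
      have "dot a b \<noteq> 0" using nz(1) by (simp add: dot_commute)
      moreover have "dot a x = 0" if "x \<in> orth \<alpha>" for x
        using that a(1) by (simp add: orth_iff dot_commute[of a])
      ultimately show ?thesis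
        using transition_down[of orth \<beta> \<alpha> fd b "dual_form \<beta> \<omega>" \<xi>d, unfolded p]
          subspace_orth[of \<alpha>] subspace_orth[of \<beta>] cov b(1) dual_form_in_top_forms[OF S(2), of \<omega>]
        by (simp add: dot_linear)
    qed
    then show ?thesis
      using dual_form_contract[OF S(1,2) sub x(1) b(1) nz(2) \<omega>'(1)] \<omega>'(2) by simp
  qed
  have "\<not> orth \<beta> \<subseteq> orth \<alpha>"
    using cov vec.dim_subset[of "orth \<beta>" "orth \<alpha>"] by (auto simp: covers_def)
  then obtain b0 where "b0 \<in> orth \<beta>" "b0 \<notin> orth \<alpha>" by blast
  from main[OF this] show "?\<pi>' \<in> top_forms (orth \<alpha>)" by blast
  assume b: "b \<in> orth \<beta>"
  show "pairing (\<xi> \<alpha> \<beta>) (dot b) * dual_form \<alpha> ?\<pi> ys = - pairing b (fd \<alpha> \<beta>) * ?\<pi>' ys"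
  proof (cases "b \<in> orth \<alpha>")
    case True
    then show ?thesis using a x by (simp add: a(3) pairing_dot orth_iff dot_commute[of a])
  next
    case False
    from main[OF b this] have "dot a b * ?\<pi>' ys = - dot b (\<xi> \<alpha> \<beta>) * dual_form \<alpha> \<omega>' ys" by metis
    then show ?thesis by (simp add: \<pi> a(3) pairing_dot)
  qed
qed

section \<open>Comparison of the two presentations\<close>

definition dualize_symbol :: "('i \<Rightarrow> (complex ^ 'n::finite) set) \<Rightarrow> ('i, 'n, 'v) symbol \<Rightarrow> ('i, 'n, 'v) symbol" where
  "dualize_symbol S = (\<lambda>(\<alpha>, \<omega>, v). (\<alpha>, dual_form (S \<alpha>) \<omega>, v))"

lemma dualize_symbol_bij:
  assumes "\<And>\<alpha>. \<alpha> \<in> I \<Longrightarrow> vec.subspace (S \<alpha>)"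
  shows "bij_betw (dualize_symbol S) (symbols I S V) (symbols I (\<lambda>\<alpha>. orth (S \<alpha>)) V)"
proof (rule bij_betwI')
  fix s t assume "s \<in> symbols I S V" "t \<in> symbols I S V"
  then show "(dualize_symbol S s = dualize_symbol S t) = (s = t)"
    using dual_form_bij[OF assms] by (auto simp: symbols_def dualize_symbol_def bij_betw_def dest: inj_onD)
next
  fix s assume "s \<in> symbols I S V"
  then show "dualize_symbol S s \<in> symbols I (\<lambda>\<alpha>. orth (S \<alpha>)) V"
    using dual_form_in_top_forms[OF assms] by (auto simp: symbols_def dualize_symbol_def)
next
  fix t assume "t \<in> symbols I (\<lambda>\<alpha>. orth (S \<alpha>)) V"
  then obtain \<alpha> \<eta> v where t: "t = (\<alpha>, \<eta>, v)" "\<alpha> \<in> I" "\<eta> \<in> top_forms (orth (S \<alpha>))" "v \<in> V \<alpha>"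
    by (auto simp: symbols_def)
  then obtain \<omega> where "\<omega> \<in> top_forms (S \<alpha>)" "\<eta> = dual_form (S \<alpha>) \<omega>"
    using dual_form_bij[OF assms[OF t(2)]] by (auto simp: bij_betw_def)
  then show "\<exists>s\<in>symbols I S V. t = dualize_symbol S s"
    using t by (intro bexI[of _ "(\<alpha>, \<omega>, v)"]) (auto simp: symbols_def dualize_symbol_def)
qed

lemma map_times_diff: "Poly_Mapping.map ((*) r) (p - q) =
    Poly_Mapping.map ((*) (r :: 'r :: ring_1)) p - Poly_Mapping.map ((*) r) q"
  using map_times_add[of r "p - q" q] by (simp add: algebra_simps)

lemma tensor_relations_intros:
  assumes "\<alpha> \<in> I" "\<omega> \<in> top_forms (S \<alpha>)" "v \<in> V \<alpha>"
  shows "\<omega>' \<in> top_forms (S \<alpha>) \<Longrightarrow>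
      tens 1 \<alpha> (\<lambda>xs. \<omega> xs + \<omega>' xs) v - tens 1 \<alpha> \<omega> v - tens 1 \<alpha> \<omega>' v \<in> tensor_relations I S smul V"
    and "v' \<in> V \<alpha> \<Longrightarrow>
      tens 1 \<alpha> \<omega> (v + v') - tens 1 \<alpha> \<omega> v - tens 1 \<alpha> \<omega> v' \<in> tensor_relations I S smul V"
    and "tens 1 \<alpha> (\<lambda>xs. c * \<omega> xs) v - tens (op_const c) \<alpha> \<omega> v \<in> tensor_relations I S smul V"
    and "tens 1 \<alpha> \<omega> (smul c v) - tens (op_const c) \<alpha> \<omega> v \<in> tensor_relations I S smul V"
  using assms unfolding tensor_relations_def by blast+

lemma tensor_relations_cases:
  assumes "g \<in> tensor_relations I S smul V"
  obtains
    (add_form) \<alpha> \<omega> \<omega>' v where "g = tens 1 \<alpha> (\<lambda>xs. \<omega> xs + \<omega>' xs) v - tens 1 \<alpha> \<omega> v - tens 1 \<alpha> \<omega>' v"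
      "\<alpha> \<in> I" "\<omega> \<in> top_forms (S \<alpha>)" "\<omega>' \<in> top_forms (S \<alpha>)" "v \<in> V \<alpha>"
  | (add_vector) \<alpha> \<omega> v v' where "g = tens 1 \<alpha> \<omega> (v + v') - tens 1 \<alpha> \<omega> v - tens 1 \<alpha> \<omega> v'"
      "\<alpha> \<in> I" "\<omega> \<in> top_forms (S \<alpha>)" "v \<in> V \<alpha>" "v' \<in> V \<alpha>"
  | (scale_form) \<alpha> \<omega> v c where "g = tens 1 \<alpha> (\<lambda>xs. c * \<omega> xs) v - tens (op_const c) \<alpha> \<omega> v"
      "\<alpha> \<in> I" "\<omega> \<in> top_forms (S \<alpha>)" "v \<in> V \<alpha>"
  | (scale_vector) \<alpha> \<omega> v c where "g = tens 1 \<alpha> \<omega> (smul c v) - tens (op_const c) \<alpha> \<omega> v"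
      "\<alpha> \<in> I" "\<omega> \<in> top_forms (S \<alpha>)" "v \<in> V \<alpha>"
  using assms unfolding tensor_relations_def by blast

text \<open>Scalars move freely between the operator, the form and the vector. The factor \<open>e\<close> will be the sign
  in the linear maps of the dual quiver.\<close>

lemma tens_balance:
  assumes "\<beta> \<in> I" "\<mu> \<in> top_forms (S \<beta>)" "\<nu> \<in> top_forms (S \<beta>)" "w \<in> V \<beta>"
    and eq: "\<And>xs. c * \<mu> xs = d * (e * \<nu> xs)"
  shows "tens (op_const c) \<beta> \<mu> w - tens (op_const d) \<beta> \<nu> (smul e w) \<in> free_span T (tensor_relations I S smul V)"
proof -
  let ?R = "tensor_relations I S smul V"
  have 1: "tens 1 \<beta> (\<lambda>xs. k * \<eta> xs) w - tens (op_const k) \<beta> \<eta> w \<in> free_span T ?R"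
    if "\<eta> \<in> top_forms (S \<beta>)" for k \<eta>
    by (intro free_span_intros(2) tensor_relations_intros(3)) (use that assms in auto)
  have 2: "tens 1 \<beta> \<nu> (smul e w) - tens (op_const e) \<beta> \<nu> w \<in> free_span T ?R"
    by (intro free_span_intros(2) tensor_relations_intros(4)) (use assms in auto)
  have 3: "tens (op_const d) \<beta> \<nu> (smul e w) - tens (op_const (d * e)) \<beta> \<nu> w \<in> free_span T ?R"
    using free_span_intros(4)[OF 2, of "op_const d"] by (simp add: map_times_diff map_single op_const_mult)
  have "(\<lambda>xs. c * \<mu> xs) = (\<lambda>xs. (d * e) * \<nu> xs)" using eq by (auto simp: mult.assoc)
  then have "tens (op_const c) \<beta> \<mu> w - tens (op_const (d * e)) \<beta> \<nu> w \<in> free_span T ?R"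
    using free_span_diff[OF 1[OF assms(3), of "d * e"] 1[OF assms(2), of c]] by simp
  from free_span_diff[OF this 3] show ?thesis by simp
qed

text \<open>The data of the theorem, collected in order to share the abbreviations below.\<close>

locale quiver_duality = quiver smul C V A
  for smul :: "complex \<Rightarrow> 'v \<Rightarrow> 'v :: ab_group_add" and C :: "(complex ^ 'n::finite) set set" and V A +
  fixes f fd :: "(complex ^ 'n) set \<Rightarrow> (complex ^ 'n) set \<Rightarrow> complex ^ 'n \<Rightarrow> complex"
    and \<xi> \<xi>d :: "(complex ^ 'n) set \<Rightarrow> (complex ^ 'n) set \<Rightarrow> complex ^ 'n"
  assumes central: "central_arrangement C"
    and choice: "admissible_choice (closed_strata C) (\<lambda>\<alpha>. \<alpha>) (vanishing_affine C) f \<xi>"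
    and dual_choice: "admissible_choice (closed_strata C) orth vanishing_linear_orth fd \<xi>d"
begin

abbreviation "I \<equiv> closed_strata C"
abbreviation "symbols_X \<equiv> symbols I (\<lambda>\<alpha>. \<alpha>) V"
abbreviation "symbols_dual \<equiv> symbols I orth V"
abbreviation "tensor_X \<equiv> tensor_relations I (\<lambda>\<alpha>. \<alpha>) smul V"
abbreviation "tensor_dual \<equiv> tensor_relations I orth smul V"
abbreviation "A_signed \<equiv> signed_maps smul A"

definition fourier_dual :: "(((complex ^ 'n) set, 'n, 'v) symbol \<Rightarrow>\<^sub>0 'n diffop) \<Rightarrow> _" where
  "fourier_dual = semilinear_extension (dualize_symbol (\<lambda>\<alpha>. \<alpha>)) inv_fourier"

sublocale inv_fourier: additive_ring_map "inv_fourier :: 'n diffop \<Rightarrow> _"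
  by (rule additive_ring_map_inv_fourier)

lemma fourier_dual_tens: "fourier_dual (tens P \<alpha> \<omega> v) = tens (inv_fourier P) \<alpha> (dual_form \<alpha> \<omega>) v"
  by (simp add: fourier_dual_def dualize_symbol_def)

sublocale fourier_dual: additive fourier_dual
  unfolding fourier_dual_def by unfold_locales (rule inv_fourier.semilinear_extension_add)

lemmas subspace_stratum = strata_subspace[OF central]

lemma covers_orth_iff: "\<alpha> \<in> I \<Longrightarrow> \<beta> \<in> I \<Longrightarrow> covers orth \<beta> \<alpha> \<longleftrightarrow> \<alpha> \<succ> \<beta>"
  using covers_orth[of "\<lambda>\<gamma>. \<gamma>" \<alpha> \<beta>] subspace_stratum by simp

text \<open>The chosen functions are \<open>dot\<close> of vectors, so a choice on either side consists of
  (co)vectors in one space of a covering pair but not in the other.\<close>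

lemma choice_down:
  assumes "\<alpha> \<in> I" "\<beta> \<in> I" "\<alpha> \<succ> \<beta>"
  shows "f \<beta> \<alpha> \<in> dot ` orth \<beta> - dot ` orth \<alpha>" "\<xi> \<alpha> \<beta> \<in> \<alpha> - \<beta>"
    "fd \<alpha> \<beta> \<in> dot ` \<alpha> - dot ` \<beta>" "\<xi>d \<beta> \<alpha> \<in> orth \<beta> - orth \<alpha>"
  using choice dual_choice assms unfolding admissible_choice_def
  by (simp_all add: vanishing_affine_eq[OF central] vanishing_linear_orth_eq subspace_stratum parallel_fields_subspace
      subspace_orth covers_orth_iff)

lemma incidence_down: "\<alpha> \<succ> \<beta> \<Longrightarrow> incidence \<alpha> \<beta> = 1" "\<alpha> \<succ> \<beta> \<Longrightarrow> incidence \<beta> \<alpha> = - 1"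
  by (auto simp: incidence_def covers_def)

text \<open>The Fourier transform turns the field \<open>a\<close> into \<open>- dot a\<close>, hence the sum of the two generators and not
  their difference. Its leading terms cancel and the others cancel in pairs by
  \<open>dual_form_transition_down\<close>; the sign of the linear map is \<open>1\<close> here.\<close>

lemma match_field_function:
  assumes "\<alpha> \<in> I" "a \<in> \<alpha>" "\<omega> \<in> top_forms \<alpha>" "v \<in> V \<alpha>"
  shows "fourier_dual (tens (op_field a) \<alpha> \<omega> v -
        (\<Sum>\<beta>\<in>{\<beta>\<in>I. \<alpha> \<succ> \<beta>}. tens (op_const (pairing a (f \<beta> \<alpha>))) \<beta> (transition (\<lambda>\<gamma>. \<gamma>) f \<xi> \<beta> \<alpha> \<omega>) (A \<beta> \<alpha> v)))
    + (tens (op_affine (dot a)) \<alpha> (dual_form \<alpha> \<omega>) v -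
        (\<Sum>\<beta>\<in>{\<beta>\<in>I. covers orth \<beta> \<alpha>}. tens (op_const (pairing (\<xi>d \<beta> \<alpha>) (dot a))) \<beta>
           (transition orth fd \<xi>d \<beta> \<alpha> (dual_form \<alpha> \<omega>)) (A_signed \<beta> \<alpha> v)))
    \<in> free_span symbols_dual tensor_dual" (is "fourier_dual (_ - sum ?s _) + (_ - sum ?t _) \<in> _")
proof -
  have J: "{\<beta>\<in>I. covers orth \<beta> \<alpha>} = {\<beta>\<in>I. \<alpha> \<succ> \<beta>}" using covers_orth_iff assms(1) by blast
  have "fourier_dual (?s \<beta>) + ?t \<beta> \<in> free_span symbols_dual tensor_dual" if \<beta>: "\<beta> \<in> {\<beta>\<in>I. \<alpha> \<succ> \<beta>}" for \<beta>
  proof -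
    have \<beta>': "\<beta> \<in> I" "\<alpha> \<succ> \<beta>" using \<beta> by auto
    note D = dual_form_transition_down[where f = f and \<xi>d = \<xi>d, OF subspace_stratum[OF assms(1)] subspace_stratum[OF \<beta>'(1)] \<beta>'(2) choice_down(1,4)[OF assms(1) \<beta>'] assms(3)]
    have "tens (op_const (pairing a (f \<beta> \<alpha>))) \<beta> (dual_form \<beta> (transition (\<lambda>\<gamma>. \<gamma>) f \<xi> \<beta> \<alpha> \<omega>)) (A \<beta> \<alpha> v) -
        tens (op_const (- pairing (\<xi>d \<beta> \<alpha>) (dot a))) \<beta> (transition orth fd \<xi>d \<beta> \<alpha> (dual_form \<alpha> \<omega>)) (smul 1 (A \<beta> \<alpha> v)) \<in> free_span symbols_dual tensor_dual"
      by (rule tens_balance[OF \<beta>'(1)])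
        (use D(1)[OF assms(2)] D(3) dual_form_in_top_forms[OF subspace_stratum[OF \<beta>'(1)]] maps_A[OF \<beta>'(1) assms(1,4)] in auto)
    then show ?thesis
      by (simp add: fourier_dual_tens inv_fourier_simps signed_maps_def incidence_down(1)[OF \<beta>'(2)] op_const_uminus single_uminus)
  qed
  then have "- (\<Sum>\<beta>\<in>{\<beta>\<in>I. \<alpha> \<succ> \<beta>}. fourier_dual (?s \<beta>) + ?t \<beta>) \<in> free_span symbols_dual tensor_dual"
    by (intro free_span_uminus free_span_sum)
  then show ?thesis
    by (simp add: J fourier_dual.diff fourier_dual.sum fourier_dual_tens inv_fourier_simps single_uminus sum.distrib algebra_simps)
qed

text \<open>No sign comes from the Fourier transform; the sign \<open>- 1\<close> of the linear map cancels the one in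
  \<open>dual_form_transition_up\<close>.\<close>

lemma match_function_field:
  assumes "\<alpha> \<in> I" "b \<in> orth \<alpha>" "\<omega> \<in> top_forms \<alpha>" "v \<in> V \<alpha>"
  shows "fourier_dual (tens (op_affine (dot b)) \<alpha> \<omega> v -
        (\<Sum>\<beta>\<in>{\<beta>\<in>I. \<beta> \<succ> \<alpha>}. tens (op_const (pairing (\<xi> \<beta> \<alpha>) (dot b))) \<beta> (transition (\<lambda>\<gamma>. \<gamma>) f \<xi> \<beta> \<alpha> \<omega>) (A \<beta> \<alpha> v)))
    - (tens (op_field b) \<alpha> (dual_form \<alpha> \<omega>) v -
        (\<Sum>\<beta>\<in>{\<beta>\<in>I. covers orth \<alpha> \<beta>}. tens (op_const (pairing b (fd \<beta> \<alpha>))) \<beta>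
           (transition orth fd \<xi>d \<beta> \<alpha> (dual_form \<alpha> \<omega>)) (A_signed \<beta> \<alpha> v)))
    \<in> free_span symbols_dual tensor_dual" (is "fourier_dual (_ - sum ?s _) - (_ - sum ?t _) \<in> _")
proof -
  have J: "{\<beta>\<in>I. covers orth \<alpha> \<beta>} = {\<beta>\<in>I. \<beta> \<succ> \<alpha>}" using covers_orth_iff assms(1) by blast
  have "fourier_dual (?s \<beta>) - ?t \<beta> \<in> free_span symbols_dual tensor_dual" if \<beta>: "\<beta> \<in> {\<beta>\<in>I. \<beta> \<succ> \<alpha>}" for \<beta>
  proof -
    have \<beta>': "\<beta> \<in> I" "\<beta> \<succ> \<alpha>" using \<beta> by auto
    note D = dual_form_transition_up[where fd = fd and \<xi> = \<xi>, OF subspace_stratum[OF \<beta>'(1)] subspace_stratum[OF assms(1)] \<beta>'(2)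
        choice_down(3,2)[OF \<beta>'(1) assms(1) \<beta>'(2)] assms(3)]
    have "tens (op_const (pairing (\<xi> \<beta> \<alpha>) (dot b))) \<beta> (dual_form \<beta> (transition (\<lambda>\<gamma>. \<gamma>) f \<xi> \<beta> \<alpha> \<omega>)) (A \<beta> \<alpha> v) -
        tens (op_const (pairing b (fd \<beta> \<alpha>))) \<beta> (transition orth fd \<xi>d \<beta> \<alpha> (dual_form \<alpha> \<omega>)) (smul (- 1) (A \<beta> \<alpha> v)) \<in> free_span symbols_dual tensor_dual"
      by (rule tens_balance[OF \<beta>'(1)])
        (use D(1)[OF assms(2)] D(3) dual_form_in_top_forms[OF subspace_stratum[OF \<beta>'(1)]] maps_A[OF \<beta>'(1) assms(1,4)] in auto)
    then show ?thesis
      by (simp add: fourier_dual_tens inv_fourier_simps signed_maps_def incidence_down(2)[OF \<beta>'(2)])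
  qed
  then have "- (\<Sum>\<beta>\<in>{\<beta>\<in>I. \<beta> \<succ> \<alpha>}. fourier_dual (?s \<beta>) - ?t \<beta>) \<in> free_span symbols_dual tensor_dual"
    by (intro free_span_uminus free_span_sum)
  then show ?thesis
    by (simp add: J fourier_dual.diff fourier_dual.sum fourier_dual_tens inv_fourier_simps sum_subtractf algebra_simps)
qed

abbreviation "relations_X \<equiv> field_relations I (\<lambda>\<alpha>. \<alpha>) f \<xi> V A \<union> function_relations I (\<lambda>\<alpha>. \<alpha>) (vanishing_affine C) f \<xi> V A"
abbreviation "relations_dual \<equiv> field_relations I orth fd \<xi>d V A_signed \<union> function_relations I orth vanishing_linear_orth fd \<xi>d V A_signed"

lemma fourier_dual_tensor_relations: "fourier_dual ` tensor_X = tensor_dual"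
proof
  show "fourier_dual ` tensor_X \<subseteq> tensor_dual"
  proof
    fix t assume "t \<in> fourier_dual ` tensor_X"
    then obtain g where g: "g \<in> tensor_X" "t = fourier_dual g" by blast
    have form: "dual_form \<alpha> \<omega> \<in> top_forms (orth \<alpha>)" if "\<alpha> \<in> I" for \<alpha> \<omega>
      by (rule dual_form_in_top_forms[OF subspace_stratum[OF that]])
    from g(1) show "t \<in> tensor_dual"
      unfolding g(2)
      by (cases rule: tensor_relations_cases)
         (simp_all add: fourier_dual.diff fourier_dual_tens inv_fourier_simps dual_form_add dual_form_scale form tensor_relations_intros)
  qed
next
  have ex: "\<exists>\<omega>\<in>top_forms \<alpha>. \<eta> = dual_form \<alpha> \<omega>" if "\<alpha> \<in> I" "\<eta> \<in> top_forms (orth \<alpha>)" for \<alpha> \<eta>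
    using dual_form_bij[OF subspace_stratum[OF that(1)]] that(2) by (auto simp: bij_betw_def)
  show "tensor_dual \<subseteq> fourier_dual ` tensor_X"
  proof
    fix t assume "t \<in> tensor_dual"
    then show "t \<in> fourier_dual ` tensor_X"
    proof (cases rule: tensor_relations_cases)
      case (add_form \<alpha> \<omega> \<omega>' v)
      then obtain \<eta> \<eta>' where \<eta>: "\<eta> \<in> top_forms \<alpha>" "\<omega> = dual_form \<alpha> \<eta>" "\<eta>' \<in> top_forms \<alpha>" "\<omega>' = dual_form \<alpha> \<eta>'"
        using ex by metis
      then have "t = fourier_dual (tens 1 \<alpha> (\<lambda>xs. \<eta> xs + \<eta>' xs) v - tens 1 \<alpha> \<eta> v - tens 1 \<alpha> \<eta>' v)"
        by (simp add: add_form fourier_dual.diff fourier_dual_tens inv_fourier_simps dual_form_add)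
      then show ?thesis using add_form \<eta> by (blast intro: tensor_relations_intros(1))
    next
      case (add_vector \<alpha> \<omega> v v')
      then obtain \<eta> where \<eta>: "\<eta> \<in> top_forms \<alpha>" "\<omega> = dual_form \<alpha> \<eta>" using ex by metis
      then have "t = fourier_dual (tens 1 \<alpha> \<eta> (v + v') - tens 1 \<alpha> \<eta> v - tens 1 \<alpha> \<eta> v')"
        by (simp add: add_vector fourier_dual.diff fourier_dual_tens inv_fourier_simps)
      then show ?thesis using add_vector \<eta> by (blast intro: tensor_relations_intros(2))
    next
      case (scale_form \<alpha> \<omega> v c)
      then obtain \<eta> where \<eta>: "\<eta> \<in> top_forms \<alpha>" "\<omega> = dual_form \<alpha> \<eta>" using ex by metis
      then have "t = fourier_dual (tens 1 \<alpha> (\<lambda>xs. c * \<eta> xs) v - tens (op_const c) \<alpha> \<eta> v)"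
        by (simp add: scale_form fourier_dual.diff fourier_dual_tens inv_fourier_simps dual_form_scale)
      then show ?thesis using scale_form \<eta> by (blast intro: tensor_relations_intros(3))
    next
      case (scale_vector \<alpha> \<omega> v c)
      then obtain \<eta> where \<eta>: "\<eta> \<in> top_forms \<alpha>" "\<omega> = dual_form \<alpha> \<eta>" using ex by metis
      then have "t = fourier_dual (tens 1 \<alpha> \<eta> (smul c v) - tens (op_const c) \<alpha> \<eta> v)"
        by (simp add: scale_vector fourier_dual.diff fourier_dual_tens inv_fourier_simps)
      then show ?thesis using scale_vector \<eta> by (blast intro: tensor_relations_intros(4))
    qed
  qed
qed

lemma match_forward:
  assumes "g \<in> relations_X"
  shows "\<exists>g'\<in>relations_dual. fourier_dual g - g' \<in> free_span symbols_dual tensor_dual \<or> fourier_dual g + g' \<in> free_span symbols_dual tensor_dual"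
  using assms
proof
  assume "g \<in> field_relations I (\<lambda>\<alpha>. \<alpha>) f \<xi> V A"
  then obtain a \<alpha> \<omega> v where g: "g = tens (op_field a) \<alpha> \<omega> v -
        (\<Sum>\<beta>\<in>{\<beta>\<in>I. \<alpha> \<succ> \<beta>}. tens (op_const (pairing a (f \<beta> \<alpha>))) \<beta> (transition (\<lambda>\<gamma>. \<gamma>) f \<xi> \<beta> \<alpha> \<omega>) (A \<beta> \<alpha> v))"
    and *: "\<alpha> \<in> I" "a \<in> parallel_fields \<alpha>" "\<omega> \<in> top_forms \<alpha>" "v \<in> V \<alpha>"
    unfolding field_relations_def by blast
  have a: "a \<in> \<alpha>" using *(1,2) by (simp add: parallel_fields_subspace subspace_stratum)
  have "dual_form \<alpha> \<omega> \<in> top_forms (orth \<alpha>)" "dot a \<in> vanishing_linear_orth \<alpha>"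
    using a *(1) by (auto simp: dual_form_in_top_forms vanishing_linear_orth_eq subspace_stratum)
  then show ?thesis using match_field_function[OF *(1) a *(3,4)] *(1,4) unfolding g function_relations_def
    by blast
next
  assume "g \<in> function_relations I (\<lambda>\<alpha>. \<alpha>) (vanishing_affine C) f \<xi> V A"
  then obtain q \<alpha> \<omega> v where g: "g = tens (op_affine q) \<alpha> \<omega> v -
        (\<Sum>\<beta>\<in>{\<beta>\<in>I. \<beta> \<succ> \<alpha>}. tens (op_const (pairing (\<xi> \<beta> \<alpha>) q)) \<beta> (transition (\<lambda>\<gamma>. \<gamma>) f \<xi> \<beta> \<alpha> \<omega>) (A \<beta> \<alpha> v))"
    and *: "\<alpha> \<in> I" "q \<in> vanishing_affine C \<alpha>" "\<omega> \<in> top_forms \<alpha>" "v \<in> V \<alpha>"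
    unfolding function_relations_def by blast
  obtain b where b: "b \<in> orth \<alpha>" "q = dot b" using *(1,2) by (auto simp: vanishing_affine_eq[OF central])
  have "dual_form \<alpha> \<omega> \<in> top_forms (orth \<alpha>)" "b \<in> parallel_fields (orth \<alpha>)"
    using b *(1) by (auto simp: dual_form_in_top_forms parallel_fields_subspace subspace_orth subspace_stratum)
  then show ?thesis using match_function_field[OF *(1) b(1) *(3,4)] *(1,4) unfolding g b(2) field_relations_def
    by blast
qed

lemma match_backward:
  assumes "g' \<in> relations_dual"
  shows "\<exists>g\<in>relations_X. fourier_dual g - g' \<in> free_span symbols_dual tensor_dual \<or> fourier_dual g + g' \<in> free_span symbols_dual tensor_dual"
  using assms
proof
  assume "g' \<in> field_relations I orth fd \<xi>d V A_signed"
  then obtain b \<alpha> \<eta> v where g': "g' = tens (op_field b) \<alpha> \<eta> v -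
        (\<Sum>\<beta>\<in>{\<beta>\<in>I. covers orth \<alpha> \<beta>}. tens (op_const (pairing b (fd \<beta> \<alpha>))) \<beta> (transition orth fd \<xi>d \<beta> \<alpha> \<eta>) (A_signed \<beta> \<alpha> v))"
    and *: "\<alpha> \<in> I" "b \<in> parallel_fields (orth \<alpha>)" "\<eta> \<in> top_forms (orth \<alpha>)" "v \<in> V \<alpha>"
    unfolding field_relations_def by blast
  obtain \<omega> where \<omega>: "\<omega> \<in> top_forms \<alpha>" "\<eta> = dual_form \<alpha> \<omega>"
    using dual_form_bij[OF subspace_stratum[OF *(1)]] *(3) by (auto simp: bij_betw_def)
  have b: "b \<in> orth \<alpha>" "dot b \<in> vanishing_affine C \<alpha>"
    using *(1,2) by (auto simp: parallel_fields_subspace subspace_orth vanishing_affine_eq[OF central])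
  then show ?thesis using match_function_field[OF *(1) b(1) \<omega>(1) *(4)] *(1,4) \<omega>(1) unfolding g' \<omega>(2) function_relations_def
    by blast
next
  assume "g' \<in> function_relations I orth vanishing_linear_orth fd \<xi>d V A_signed"
  then obtain q \<alpha> \<eta> v where g': "g' = tens (op_affine q) \<alpha> \<eta> v -
        (\<Sum>\<beta>\<in>{\<beta>\<in>I. covers orth \<beta> \<alpha>}. tens (op_const (pairing (\<xi>d \<beta> \<alpha>) q)) \<beta> (transition orth fd \<xi>d \<beta> \<alpha> \<eta>) (A_signed \<beta> \<alpha> v))"
    and *: "\<alpha> \<in> I" "q \<in> vanishing_linear_orth \<alpha>" "\<eta> \<in> top_forms (orth \<alpha>)" "v \<in> V \<alpha>"
    unfolding function_relations_def by blast
  obtain \<omega> where \<omega>: "\<omega> \<in> top_forms \<alpha>" "\<eta> = dual_form \<alpha> \<omega>"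
    using dual_form_bij[OF subspace_stratum[OF *(1)]] *(3) by (auto simp: bij_betw_def)
  obtain a where a: "a \<in> \<alpha>" "q = dot a" using *(1,2) by (auto simp: vanishing_linear_orth_eq subspace_stratum)
  then have "a \<in> parallel_fields \<alpha>" using *(1) by (simp add: parallel_fields_subspace subspace_stratum)
  then show ?thesis using match_field_function[OF *(1) a(1) \<omega>(1) *(4)] *(1,4) \<omega>(1) unfolding g' \<omega>(2) a(2) field_relations_def
    by blast
qed

text \<open>The transform is injective only on the free module, not on all finitely supported functions, so
  the relations have to be located in it.\<close>

lemma relations_in_carrier: "tensor_X \<union> relations_X \<subseteq> {p. Poly_Mapping.keys p \<subseteq> symbols_X}"
proof -
  have diff: "Poly_Mapping.keys (p - q) \<subseteq> symbols_X" if "Poly_Mapping.keys p \<subseteq> symbols_X" "Poly_Mapping.keys q \<subseteq> symbols_X"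
    for p q :: "((complex ^ 'n) set, 'n, 'v) symbol \<Rightarrow>\<^sub>0 'n diffop"
    using that keys_diff[of p q] by blast
  have sum: "Poly_Mapping.keys (sum p J) \<subseteq> symbols_X" if "\<And>\<beta>. \<beta> \<in> J \<Longrightarrow> Poly_Mapping.keys (p \<beta>) \<subseteq> symbols_X"
    for p :: "(complex ^ 'n) set \<Rightarrow> ((complex ^ 'n) set, 'n, 'v) symbol \<Rightarrow>\<^sub>0 'n diffop" and J
    using that Poly_Mapping.keys_sum[of p J] by blast
  have tens: "Poly_Mapping.keys (tens P \<alpha> \<omega> v) \<subseteq> symbols_X" if "\<alpha> \<in> I" "\<omega> \<in> top_forms \<alpha>" "v \<in> V \<alpha>"
    for P :: "'n diffop" and \<alpha> \<omega> v
    using that by (auto simp: symbols_def keys_single)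
  have forms: "(\<lambda>xs. \<omega> xs + \<omega>' xs) \<in> top_forms \<alpha>" "(\<lambda>xs. c * \<omega> xs) \<in> top_forms \<alpha>"
    if "\<omega> \<in> top_forms \<alpha>" "\<omega>' \<in> top_forms \<alpha>" for \<omega> \<omega>' c and \<alpha> :: "(complex ^ 'n) set"
    using that inv_forms_combine[of \<omega> \<alpha> "vec.dim \<alpha>" \<omega>' 1 1] form_scale_in_inv_forms by (auto simp: top_forms_def)
  have V: "v + w \<in> V \<alpha>" "smul c v \<in> V \<alpha>" if "\<alpha> \<in> I" "v \<in> V \<alpha>" "w \<in> V \<alpha>" for \<alpha> v w c
    using that subspace_V subspace_add subspace_scale by blast+
  have down: "transition (\<lambda>\<gamma>. \<gamma>) f \<xi> \<beta> \<alpha> \<omega> \<in> top_forms \<beta>"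
    if "\<alpha> \<in> I" "\<beta> \<in> I" "\<alpha> \<succ> \<beta>" "\<omega> \<in> top_forms \<alpha>" for \<alpha> \<beta> \<omega>
    by (rule dual_form_transition_down(2)[where \<xi>d = \<xi>d, OF subspace_stratum subspace_stratum]; (use that choice_down[of \<alpha> \<beta>] in blast)?)
  have up: "transition (\<lambda>\<gamma>. \<gamma>) f \<xi> \<beta> \<alpha> \<omega> \<in> top_forms \<beta>"
    if "\<alpha> \<in> I" "\<beta> \<in> I" "\<beta> \<succ> \<alpha>" "\<omega> \<in> top_forms \<alpha>" for \<alpha> \<beta> \<omega>
    by (rule dual_form_transition_up(2)[where fd = fd, OF subspace_stratum subspace_stratum]; (use that choice_down[of \<beta> \<alpha>] in blast)?)
  have "Poly_Mapping.keys g \<subseteq> symbols_X" if "g \<in> tensor_X" for g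
    using that
  proof (cases rule: tensor_relations_cases)
    case (add_form \<alpha> \<omega> \<omega>' v)
    then show ?thesis by (simp only: diff tens forms V)
  next
    case (add_vector \<alpha> \<omega> v v')
    then show ?thesis by (simp only: diff tens forms V)
  next
    case (scale_form \<alpha> \<omega> v c)
    then show ?thesis by (simp only: diff tens forms(2)[of \<omega> \<alpha> \<omega>])
  next
    case (scale_vector \<alpha> \<omega> v c)
    then show ?thesis by (simp only: diff tens V(2)[of \<alpha> v v])
  qed
  moreover have "Poly_Mapping.keys g \<subseteq> symbols_X" if g: "g \<in> relations_X" for g
    using g
  proof
    assume "g \<in> field_relations I (\<lambda>\<alpha>. \<alpha>) f \<xi> V A"
    then obtain a \<alpha> \<omega> v where g: "g = tens (op_field a) \<alpha> \<omega> v -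
          (\<Sum>\<beta>\<in>{\<beta>\<in>I. \<alpha> \<succ> \<beta>}. tens (op_const (pairing a (f \<beta> \<alpha>))) \<beta> (transition (\<lambda>\<gamma>. \<gamma>) f \<xi> \<beta> \<alpha> \<omega>) (A \<beta> \<alpha> v))"
      and *: "\<alpha> \<in> I" "\<omega> \<in> top_forms \<alpha>" "v \<in> V \<alpha>"
      unfolding field_relations_def by blast
    show ?thesis unfolding g by (rule diff[OF tens sum[OF tens]]) (use * down maps_A in auto)
  next
    assume "g \<in> function_relations I (\<lambda>\<alpha>. \<alpha>) (vanishing_affine C) f \<xi> V A"
    then obtain q \<alpha> \<omega> v where g: "g = tens (op_affine q) \<alpha> \<omega> v -
          (\<Sum>\<beta>\<in>{\<beta>\<in>I. \<beta> \<succ> \<alpha>}. tens (op_const (pairing (\<xi> \<beta> \<alpha>) q)) \<beta> (transition (\<lambda>\<gamma>. \<gamma>) f \<xi> \<beta> \<alpha> \<omega>) (A \<beta> \<alpha> v))"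
      and *: "\<alpha> \<in> I" "\<omega> \<in> top_forms \<alpha>" "v \<in> V \<alpha>"
      unfolding function_relations_def by blast
    show ?thesis unfolding g by (rule diff[OF tens sum[OF tens]]) (use * up maps_A in auto)
  qed
  ultimately show ?thesis by blast
qed

theorem fourier_quiver_module:
  "fourier_transform (quiver_module C f \<xi> smul V A) \<cong>\<^sub>l dual_quiver_module C fd \<xi>d smul V A_signed"
proof -
  let ?R = "free_span symbols_X (tensor_X \<union> relations_X)"
  let ?M = "free_lmodule symbols_X :: ('n diffop, _) lmodule" and ?N = "free_lmodule symbols_dual :: ('n diffop, _) lmodule"
  have surj: "surj (inv_fourier :: 'n diffop \<Rightarrow> _)" by (metis inv_fourier_fourier(1) surjI)
  have image: "fourier_dual ` ?R = free_span symbols_dual (tensor_dual \<union> relations_dual)"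
    unfolding fourier_dual_def
    by (rule free_span_image_eq[OF additive_ring_map_inv_fourier surj])
       (use fourier_dual_tensor_relations match_forward match_backward in \<open>simp_all add: fourier_dual_def\<close>)
  have "(quotient_lmodule ?M ?R)\<lparr>act := \<lambda>r. act (quotient_lmodule ?M ?R) (fourier_iso r)\<rparr> \<cong>\<^sub>l quotient_lmodule ?N (fourier_dual ` ?R)"
  proof (rule isomorphic_quotients)
    show "bij_betw fourier_dual (carrier ?M) (carrier ?N)"
      unfolding fourier_dual_def free_lmodule_simps
      by (rule semilinear_extension_bij[OF additive_ring_map_inv_fourier additive_ring_map_fourier])
         (use dualize_symbol_bij[of I "\<lambda>\<alpha>. \<alpha>" V] subspace_stratum in \<open>auto simp: inv_fourier_fourier\<close>)
    show "?R \<subseteq> carrier ?M"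
      using free_span_carrier[OF relations_in_carrier] by (auto simp: free_lmodule_simps)
    fix x y :: "((complex ^ 'n) set, 'n, 'v) symbol \<Rightarrow>\<^sub>0 'n diffop" and r :: "'n diffop"
    show "fourier_dual (x \<otimes>\<^bsub>?M\<^esub> y) = fourier_dual x \<otimes>\<^bsub>?N\<^esub> fourier_dual y" by (simp add: free_lmodule_simps fourier_dual.add)
    show "fourier_dual (act ?M (fourier_iso r) x) = act ?N r (fourier_dual x)"
      by (simp add: free_lmodule_simps fourier_dual_def inv_fourier.semilinear_extension_act inv_fourier_fourier)
    show "x \<otimes>\<^bsub>?M\<^esub> y \<in> carrier ?M" if "x \<in> carrier ?M" "y \<in> carrier ?M"
      using that Poly_Mapping.keys_add[of x y] by (auto simp: free_lmodule_simps)
    show "act ?M r x \<in> carrier ?M" if "x \<in> carrier ?M"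
      using that by (auto simp: free_lmodule_simps in_keys_iff Poly_Mapping.map.rep_eq subset_iff)
  qed
  then show ?thesis
    unfolding image
    by (simp add: fourier_transform_def quiver_module_def dual_quiver_module_def strata_module_def Let_def Un_assoc)
qed

end

theorem proposition4p16:
  fixes C :: "(complex ^ 'n :: finite) set set"
    and smul :: "complex \<Rightarrow> 'v \<Rightarrow> 'v :: ab_group_add"
    and V :: "(complex ^ 'n) set \<Rightarrow> 'v set"
    and A :: "(complex ^ 'n) set \<Rightarrow> (complex ^ 'n) set \<Rightarrow> 'v \<Rightarrow> 'v"
    and f f_dual :: "(complex ^ 'n) set \<Rightarrow> (complex ^ 'n) set \<Rightarrow> complex ^ 'n \<Rightarrow> complex"
    and \<xi> \<xi>_dual :: "(complex ^ 'n) set \<Rightarrow> (complex ^ 'n) set \<Rightarrow> complex ^ 'n"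
  assumes "central_arrangement C"
    and "quiver smul C V A"
    and "admissible_choice (closed_strata C) (\<lambda>\<alpha>. \<alpha>) (vanishing_affine C) f \<xi>"
    and "admissible_choice (closed_strata C) orth vanishing_linear_orth f_dual \<xi>_dual"
  shows "fourier_transform (quiver_module C f \<xi> smul V A) \<cong>\<^sub>l
         dual_quiver_module C f_dual \<xi>_dual smul V (signed_maps smul A)"
proof -
  interpret quiver_duality smul C V A f f_dual \<xi> \<xi>_dual
    using assms by (simp add: quiver_duality_def quiver_duality_axioms_def)
  show ?thesis by (rule fourier_quiver_module)
qed

end
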